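(* Let $f\in L_p(\mathbb{R}^d)\cap\ell_p(X_\sigma)$, $1\le p<\infty$, and $r,s\in\mathbb{N}$. Suppose that $G_\sigma$ satisfies $(A_1)$, $(A_2)$ and $$\|g-G_\sigma g\|_p\le\kappa_3\sigma^{-s}|g|_{W_p^s},\quad g\in W_p^s(\mathbb{R}^d).$$ Suppose also that $G_\sigma f\in\Phi_\sigma\cap W_p^s(\mathbb{R}^d)$ and that, for some constant $B$ independent of $\sigma$ and for each $\beta\in\mathbb{Z}_+^d$ with $|\beta|_1=s$, $$\big\|\tfrac{\partial}{\partial x_i}D^\beta g\big\|_p\le B\sigma\|D^\beta g\|_p,\quad i=1,\dots,d,\quad g\in\Phi_\sigma .$$ Then $$\|f_{\gamma/\sigma,r}-f\|_{\ell_p(X_\sigma)}+\omega_s(f,\sigma^{-1})_p\asymp\|f-G_\sigma f\|_p+\sigma^{-s}|G_\sigma f|_{W_p^s},$$ where $\asymp$ is a two-sided inequality with positive constants independent of $f$ and $\sigma$.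
   Context: $L_p(\mathbb{R}^d)$, $1\le p<\infty$, is the space of finite-valued measurable $f:\mathbb{R}^d\to\mathbb{R}$ with $\|f\|_p=(\int_{\mathbb{R}^d}|f|^p)^{1/p}<\infty$; functions equal almost everywhere are not identified (each function is determined by its values at each point). $W_p^s(\mathbb{R}^d)$ is the usual Sobolev space, with norm $\|g\|_p+|g|_{W_p^s}$ and semi-norm $|g|_{W_p^s}=\sum_{|\beta|_1=s}\|D^\beta g\|_p$. Sampling points: for $\sigma>0$, $X_\sigma\subset\mathbb{R}^d$ is a finite or infinite set with $\min_{\xi\ne\xi'\in X_\sigma}|\xi-\xi'|>2\gamma/\sigma$, where $\gamma\in(0,1]$ is independent of $\sigma$. $\|f\|_{\ell_p(X_\sigma)}=\big(\sigma^{-d}\sum_{\xi\in X_\sigma}|f(\xi)|^p\big)^{1/p}$, and $f\in\ell_p(X_\sigma)$ means this is finite. Sampling operator: $G_\sigma f(x)=\sum_{\xi\in X_\sigma}f(\xi)\psi_{\xi,\sigma}(x)$ with given kernel functions $\psi_{\xi,\sigma}$. Assumptions, with positive constants $\kappa_i$ independent of $\sigma$ and of the function: $(A_1)$ $\|G_\sigma f\|_p\le\kappa_1\|f\|_{\ell_p(X_\sigma)}$ for all $f\in L_p(\mathbb{R}^d)\cap\ell_p(X_\sigma)$; $(A_2)$ $\kappa_2\|f\|_{\ell_p(X_\sigma)}\le\|G_\sigma f\|_p$ for all $f\in L_p(\mathbb{R}^d)\cap\ell_p(X_\sigma)$. The constant $\kappa_3$ is likewise positive and independent of $\sigma$ and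 $g$. Approximating family: $\Phi=(\Phi_\sigma)_{\sigma\ge0}$ is a family of subspaces such that $0\in\Phi_\sigma$ for all $\sigma>0$; $\Phi_0=\{0\}$; $a\Phi_\sigma=\Phi_\sigma$ for each $a\ne0$; $\Phi_\sigma+\Phi_\sigma\subset\Phi_{c\sigma}$ for some constant $c=c(\Phi)$; and, for the given $p$ and $s$, there are constants $c_1,c_2>0$ such that for all $\sigma>0$: (Jackson) $\inf_{g\in\Phi_\sigma}\|f-g\|_p\le c_1\sigma^{-s}|f|_{W_p^s}$ for $f\in W_p^s(\mathbb{R}^d)$, and (Bernstein) $|g|_{W_p^s}\le c_2\sigma^s\|g\|_p$ for $g\in\Phi_\sigma$. Modulus of smoothness: $\omega_s(f,\delta)_p=\sup_{|h|<\delta}\|\Delta_h^sf\|_p$, $\Delta_h^sf(x)=\sum_{\nu=0}^s\binom{s}{\nu}(-1)^\nu f(x+(s-\nu)h)$. Averaged operator: $f_{\delta,r}(x)=-\frac{2}{\binom{2r}{r}}\sum_{j=1}^r(-1)^j\binom{2r}{r-j}f_{\delta j/r}(x)$, where $f_\delta(x)=\frac1{|B_\delta|}\int_{B_\delta(x)}f(y)\,dy$ and $B_\delta(x)$ is the open Euclidean ball of radius $\delta$ centred at $x$, $B_\delta=B_\delta(0)$.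
   Formalization: The condition s ≤ 2r is added, since for s > 2r the equivalence fails (e.g. Shannon sampling of functions with spectrum in [-ε,ε]); the estimate for g in W_p^s is assumed only for continuous g, as asking it of all versions contradicts (A_2); a.e. convergence of the sampling series is made explicit. *)

theory Defs
  imports "HOL-Analysis.Analysis"
begin

section \<open>Lebesgue and sampled norms\<close>

text \<open>Functions are not identified modulo null sets: \<open>Lp_space p\<close> is a set of everywhere defined
  functions, and the values of its members at the sampling points are meaningful.\<close>

definition Lp_space :: "real \<Rightarrow> (real^'d::finite \<Rightarrow> real) set" where
  "Lp_space p = {f. f \<in> borel_measurable lebesgue \<and> integrable lebesgue (\<lambda>x. \<bar>f x\<bar> powr p)}"

definition Lp_norm :: "real \<Rightarrow> (real^'d::finite \<Rightarrow> real) \<Rightarrow> real" where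
  "Lp_norm p f = (LINT x|lebesgue. \<bar>f x\<bar> powr p) powr (1 / p)"

definition lp_space :: "real \<Rightarrow> (real^'d::finite) set \<Rightarrow> (real^'d \<Rightarrow> real) set" where
  "lp_space p X = {f. (\<lambda>\<xi>. \<bar>f \<xi>\<bar> powr p) summable_on X}"

definition lp_norm :: "real \<Rightarrow> real \<Rightarrow> (real^'d::finite) set \<Rightarrow> (real^'d \<Rightarrow> real) \<Rightarrow> real" where
  "lp_norm p \<sigma> X f = (\<sigma> powr (- real CARD('d)) * (\<Sum>\<^sub>\<infinity>\<xi>\<in>X. \<bar>f \<xi>\<bar> powr p)) powr (1 / p)"


section \<open>Sobolev spaces\<close>

text \<open>A multi-index in $\mathbb{Z}_+^d$ is a function \<open>\<beta> :: 'd \<Rightarrow> nat\<close>.\<close>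

definition mi_abs :: "('d::finite \<Rightarrow> nat) \<Rightarrow> nat" where
  "mi_abs \<beta> = (\<Sum>i\<in>UNIV. \<beta> i)"

definition mi_unit :: "'d::finite \<Rightarrow> 'd \<Rightarrow> nat" where
  "mi_unit i = (\<lambda>j. if j = i then 1 else 0)"

definition partial_deriv :: "'d::finite \<Rightarrow> (real^'d \<Rightarrow> real) \<Rightarrow> real^'d \<Rightarrow> real" where
  "partial_deriv i \<phi> x = frechet_derivative \<phi> (at x) (axis i 1)"

text \<open>Infinitely often differentiable: every iterated partial derivative is (totally)
  differentiable.\<close>

definition smooth :: "(real^'d::finite \<Rightarrow> real) \<Rightarrow> bool" where
  "smooth \<phi> \<longleftrightarrow> (\<forall>is. foldr partial_deriv is \<phi> differentiable_on UNIV)"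

definition test_function :: "(real^'d::finite \<Rightarrow> real) \<Rightarrow> bool" where
  "test_function \<phi> \<longleftrightarrow> smooth \<phi> \<and> compact (closure {x. \<phi> x \<noteq> 0})"

text \<open>The classical $D^\beta$, used on smooth functions only; for these the order in which the
  partial derivatives are taken is immaterial, so any list of coordinates containing each \<open>i\<close>
  exactly \<open>\<beta> i\<close> times may be chosen.\<close>

definition classical_D :: "('d::finite \<Rightarrow> nat) \<Rightarrow> (real^'d \<Rightarrow> real) \<Rightarrow> real^'d \<Rightarrow> real" where
  "classical_D \<beta> \<phi> = foldr partial_deriv (SOME is. \<forall>i. count_list is i = \<beta> i) \<phi>"

definition locally_integrable :: "(real^'d::finite \<Rightarrow> real) \<Rightarrow> bool" where
  "locally_integrable f \<longleftrightarrow> (\<forall>K. compact K \<longrightarrow> set_integrable lebesgue K f)"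

definition is_weak_deriv ::
  "('d::finite \<Rightarrow> nat) \<Rightarrow> (real^'d \<Rightarrow> real) \<Rightarrow> (real^'d \<Rightarrow> real) \<Rightarrow> bool" where
  "is_weak_deriv \<beta> g h \<longleftrightarrow> locally_integrable g \<and> locally_integrable h \<and>
     (\<forall>\<phi>. test_function \<phi> \<longrightarrow>
        (LINT x|lebesgue. g x * classical_D \<beta> \<phi> x)
          = (-1) ^ mi_abs \<beta> * (LINT x|lebesgue. h x * \<phi> x))"

text \<open>Weak derivatives are unique up to null sets, so \<open>Lp_norm p (weak_D \<beta> g)\<close> and membership of
  \<open>weak_D \<beta> g\<close> in \<open>Lp_space p\<close> do not depend on the version chosen here.  When \<open>g\<close> has no weak
  derivative, \<open>weak_D \<beta> g\<close> carries no information; below, existence is always required separately.\<close>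

definition weak_D :: "('d::finite \<Rightarrow> nat) \<Rightarrow> (real^'d \<Rightarrow> real) \<Rightarrow> real^'d \<Rightarrow> real" where
  "weak_D \<beta> g = (SOME h. is_weak_deriv \<beta> g h)"

definition has_weak_deriv_in_Lp :: "real \<Rightarrow> ('d::finite \<Rightarrow> nat) \<Rightarrow> (real^'d \<Rightarrow> real) \<Rightarrow> bool" where
  "has_weak_deriv_in_Lp p \<beta> g \<longleftrightarrow> (\<exists>h\<in>Lp_space p. is_weak_deriv \<beta> g h)"

definition Sobolev :: "real \<Rightarrow> nat \<Rightarrow> (real^'d::finite \<Rightarrow> real) set" where
  "Sobolev p s = {g \<in> Lp_space p. \<forall>\<beta>. mi_abs \<beta> \<le> s \<longrightarrow> has_weak_deriv_in_Lp p \<beta> g}"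

definition Sobolev_seminorm :: "real \<Rightarrow> nat \<Rightarrow> (real^'d::finite \<Rightarrow> real) \<Rightarrow> real" where
  "Sobolev_seminorm p s g = (\<Sum>\<beta> | mi_abs \<beta> = s. Lp_norm p (weak_D \<beta> g))"


section \<open>Sampling operators\<close>

text \<open>Here \<open>X\<close> and \<open>\<psi>\<close> are the sampling set and the kernels belonging to one fixed \<open>\<sigma>\<close>.\<close>

definition separated :: "real \<Rightarrow> real \<Rightarrow> (real^'d::finite) set \<Rightarrow> bool" where
  "separated \<gamma> \<sigma> X \<longleftrightarrow> (\<forall>\<xi>\<in>X. \<forall>\<xi>'\<in>X. \<xi> \<noteq> \<xi>' \<longrightarrow> norm (\<xi> - \<xi>') > 2 * \<gamma> / \<sigma>)"

definition sampling_op ::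
  "(real^'d::finite) set \<Rightarrow> (real^'d \<Rightarrow> real^'d \<Rightarrow> real) \<Rightarrow> (real^'d \<Rightarrow> real) \<Rightarrow> real^'d \<Rightarrow> real" where
  "sampling_op X \<psi> f x = (\<Sum>\<^sub>\<infinity>\<xi>\<in>X. f \<xi> * \<psi> \<xi> x)"

text \<open>The series defining \<open>sampling_op\<close> is meaningful: it converges (unconditionally) at almost
  every point.  This has to be said, since \<open>infsum\<close> is \<open>0\<close> on non-summable families.\<close>

definition sampling_converges ::
  "real \<Rightarrow> (real^'d::finite) set \<Rightarrow> (real^'d \<Rightarrow> real^'d \<Rightarrow> real) \<Rightarrow> bool" where
  "sampling_converges p X \<psi> \<longleftrightarrow>
     (\<forall>f \<in> Lp_space p \<inter> lp_space p X. AE x in lebesgue. (\<lambda>\<xi>. f \<xi> * \<psi> \<xi> x) summable_on X)"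

text \<open>An upper bound for a norm or seminorm includes that it is finite, i.e. that the function
  lies in the space in question.\<close>

definition cond_A1 ::
  "real \<Rightarrow> real \<Rightarrow> real \<Rightarrow> (real^'d::finite) set \<Rightarrow> (real^'d \<Rightarrow> real^'d \<Rightarrow> real) \<Rightarrow> bool" where
  "cond_A1 \<kappa> p \<sigma> X \<psi> \<longleftrightarrow>
     (\<forall>f \<in> Lp_space p \<inter> lp_space p X.
        sampling_op X \<psi> f \<in> Lp_space p \<and>
        Lp_norm p (sampling_op X \<psi> f) \<le> \<kappa> * lp_norm p \<sigma> X f)"

definition cond_A2 ::
  "real \<Rightarrow> real \<Rightarrow> real \<Rightarrow> (real^'d::finite) set \<Rightarrow> (real^'d \<Rightarrow> real^'d \<Rightarrow> real) \<Rightarrow> bool" where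
  "cond_A2 \<kappa> p \<sigma> X \<psi> \<longleftrightarrow>
     (\<forall>f \<in> Lp_space p \<inter> lp_space p X.
        \<kappa> * lp_norm p \<sigma> X f \<le> Lp_norm p (sampling_op X \<psi> f))"

text \<open>The estimate $\|g - G_\sigma g\|_p \le \kappa\sigma^{-s}|g|_{W_p^s}$ for $g \in W_p^s$.
  Since \<open>sampling_op\<close> depends on the point values of \<open>g\<close>, a Sobolev function is entered through its
  continuous representative.  Asking the estimate of all representatives would be inconsistent with
  \<open>cond_A2\<close>: changing \<open>g\<close> at one sampling point alters the left-hand side but not the right.\<close>

definition Sobolev_estimate ::
  "real \<Rightarrow> real \<Rightarrow> nat \<Rightarrow> real \<Rightarrow> (real^'d::finite) set \<Rightarrow> (real^'d \<Rightarrow> real^'d \<Rightarrow> real) \<Rightarrow> bool" where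
  "Sobolev_estimate \<kappa> p s \<sigma> X \<psi> \<longleftrightarrow>
     (\<forall>g \<in> Sobolev p s. continuous_on UNIV g \<longrightarrow>
        (\<lambda>x. g x - sampling_op X \<psi> g x) \<in> Lp_space p \<and>
        Lp_norm p (\<lambda>x. g x - sampling_op X \<psi> g x)
          \<le> \<kappa> * \<sigma> powr (- real s) * Sobolev_seminorm p s g)"


section \<open>Approximating families\<close>

text \<open>The members \<open>\<Phi> \<sigma>\<close> need not be linear: sums only have to lie in \<open>\<Phi> (c * \<sigma>)\<close>.\<close>

definition approx_family ::
  "real \<Rightarrow> nat \<Rightarrow> (real \<Rightarrow> (real^'d::finite \<Rightarrow> real) set) \<Rightarrow> bool" where
  "approx_family p s \<Phi> \<longleftrightarrow>
     (\<forall>\<sigma>\<ge>0. \<Phi> \<sigma> \<subseteq> Lp_space p) \<and>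
     (\<forall>\<sigma>>0. (\<lambda>x. 0) \<in> \<Phi> \<sigma>) \<and>
     \<Phi> 0 = {\<lambda>x. 0} \<and>
     (\<forall>\<sigma>\<ge>0. \<forall>a. a \<noteq> 0 \<longrightarrow> (\<lambda>g x. a * g x) ` \<Phi> \<sigma> = \<Phi> \<sigma>) \<and>
     (\<exists>c>0. \<forall>\<sigma>\<ge>0. \<forall>g\<in>\<Phi> \<sigma>. \<forall>h\<in>\<Phi> \<sigma>. (\<lambda>x. g x + h x) \<in> \<Phi> (c * \<sigma>)) \<and>
     (\<exists>c1>0. \<forall>\<sigma>>0. \<forall>f\<in>Sobolev p s.
        (INF g\<in>\<Phi> \<sigma>. Lp_norm p (\<lambda>x. f x - g x))
          \<le> c1 * \<sigma> powr (- real s) * Sobolev_seminorm p s f) \<and>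
     (\<exists>c2>0. \<forall>\<sigma>>0. \<forall>g\<in>\<Phi> \<sigma>.
        g \<in> Sobolev p s \<and> Sobolev_seminorm p s g \<le> c2 * \<sigma> powr (real s) * Lp_norm p g)"

definition deriv_bound ::
  "real \<Rightarrow> real \<Rightarrow> nat \<Rightarrow> real \<Rightarrow> (real^'d::finite \<Rightarrow> real) set \<Rightarrow> bool" where
  "deriv_bound B p s \<sigma> \<Phi>\<sigma> \<longleftrightarrow>
     (\<forall>\<beta> i. \<forall>g\<in>\<Phi>\<sigma>. mi_abs \<beta> = s \<longrightarrow>
        has_weak_deriv_in_Lp p (mi_unit i) (weak_D \<beta> g) \<and>
        Lp_norm p (weak_D (mi_unit i) (weak_D \<beta> g)) \<le> B * \<sigma> * Lp_norm p (weak_D \<beta> g))"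


section \<open>Modulus of smoothness and averages\<close>

definition fin_diff :: "nat \<Rightarrow> real^'d::finite \<Rightarrow> (real^'d \<Rightarrow> real) \<Rightarrow> real^'d \<Rightarrow> real" where
  "fin_diff s h f x =
     (\<Sum>\<nu>=0..s. real (s choose \<nu>) * (-1) ^ \<nu> * f (x + real (s - \<nu>) *\<^sub>R h))"

definition modulus :: "real \<Rightarrow> nat \<Rightarrow> (real^'d::finite \<Rightarrow> real) \<Rightarrow> real \<Rightarrow> real" where
  "modulus p s f \<delta> = (SUP h\<in>{h. norm h < \<delta>}. Lp_norm p (fin_diff s h f))"

definition ball_avg :: "real \<Rightarrow> (real^'d::finite \<Rightarrow> real) \<Rightarrow> real^'d \<Rightarrow> real" where
  "ball_avg \<delta> f x =
     1 / measure lebesgue (ball (0 :: real^'d) \<delta>) * (LINT y:ball x \<delta>|lebesgue. f y)"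

text \<open>For \<open>j = 0\<close> the summand below would be the identity: \<open>f - avg_op \<delta> r f\<close> is, up to a constant,
  an average of central differences of \<open>f\<close> of order \<open>2 * r\<close>.  It can therefore be controlled by
  smoothness of order \<open>s\<close> with constants independent of the scale only if \<open>s \<le> 2 * r\<close>.\<close>

definition avg_op :: "real \<Rightarrow> nat \<Rightarrow> (real^'d::finite \<Rightarrow> real) \<Rightarrow> real^'d \<Rightarrow> real" where
  "avg_op \<delta> r f x = - (2 / real ((2 * r) choose r)) *
     (\<Sum>j=1..r. (-1) ^ j * real ((2 * r) choose (r - j)) * ball_avg (\<delta> * real j / real r) f x)"

end

theory Submission
  imports Defs "HOL-Probability.Probability"
begin

text \<open>Write \<open>K(f, g) = \<parallel>f - g\<parallel> + \<sigma>^(-s) |g|\<close> and let \<open>A\<close> be the averaging operator at scale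
  \<open>\<gamma> / \<sigma>\<close>. For every \<open>g\<close> in the Sobolev space, \<open>f - A f\<close> and \<open>A f - G (A f)\<close> are bounded in norm
  by a multiple of \<open>K(f, g)\<close>: the part \<open>A (f - g)\<close> is sampled stably, since averages over disjoint
  balls are controlled by the $L_p$ norm, and \<open>A g\<close> is a continuous Sobolev function, to which the
  assumed estimate applies. For the upper bound take \<open>g = G f\<close> and recover the sampled norm of
  \<open>f - A f\<close> from \<open>(A\<^sub>2)\<close>. For the lower bound take for \<open>g\<close> a Steklov mean of \<open>f\<close>, for which
  \<open>K(f, g)\<close> is bounded by the modulus of smoothness, and use \<open>(A\<^sub>1)\<close>; finally \<open>|G f|\<close> is bounded
  by the modulus of \<open>G f\<close>, because the bound on the next derivatives makes derivatives of order \<open>s\<close>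
  comparable to difference quotients with a step proportional to \<open>1 / \<sigma>\<close>.

  Iterated differences are expressed as averages \<open>x \<mapsto> \<integral> f (x + y) d\<mu>(y)\<close> of derivatives over
  probability measures \<open>\<mu>\<close>. Such identities are proved for test functions and transferred to weak
  derivatives by duality.\<close>

text \<open>Sampling reads point values, whereas a competitor \<open>g\<close> from the Sobolev
  space is determined only up to null sets and need not lie in \<open>lp_space\<close>, even for
  \<open>g = G f\<close>. Hence \<open>G\<close> is never applied to \<open>g\<close> or to
  \<open>f - g\<close>, only to \<open>f\<close>, to averages and to differences of these: averages
  of functions that agree almost everywhere agree everywhere, are continuous and have p-summable
  samples.

  A second obstacle is that the modulus of smoothness tests one step at a time, whereas a derivative
  of order \<beta> corresponds to differences along several coordinate directions. Two arguments
  connect them: decomposing a step into its coordinates bounds a pure difference by mixed ones, and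
  Kemperman's identity bounds a mixed difference by pure ones. Each costs a factor that depends only
  on \<open>s\<close> and the dimension.

  Since \<open>p = 1\<close> is allowed, convexity and Jensen's inequality take the place of duality
  between Lebesgue spaces; the pairings that occur are with bounded functions of bounded
  support.\<close>

section \<open>Borel versions and translation invariance\<close>

lemma AE_lebesgue_translate:
  fixes a :: "'a::euclidean_space"
  assumes "AE x in lebesgue. P x"
  shows "AE x in lebesgue. P (x + a)"
proof -
  obtain N where N: "N \<in> null_sets lebesgue" "{x. \<not> P x} \<subseteq> N"
    using assms by (auto simp: eventually_ae_filter)
  then have "negligible ((+) (- a) ` N)"
    by (intro negligible_translation) (simp add: negligible_iff_null_sets)
  then have "(+) (- a) ` N \<in> null_sets lebesgue"
    by (simp add: negligible_iff_null_sets)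
  moreover have "{x. \<not> P (x + a)} \<subseteq> (+) (- a) ` N"
    using N(2) by (force simp: image_iff intro: bexI[of _ "_ + a"])
  ultimately show ?thesis
    by (auto simp: eventually_ae_filter)
qed

text \<open>Fubini arguments need \<open>f (x + y)\<close> to be jointly measurable, which is clear
  for Borel \<open>f\<close> but not for Lebesgue measurable \<open>f\<close>. Results are therefore
  proved for Borel versions and transferred: norms, moduli, weak derivatives and ball averages do
  not see null sets.\<close>

lemma borel_version:
  fixes f :: "'a::euclidean_space \<Rightarrow> real"
  assumes "f \<in> borel_measurable lebesgue"
  obtains g where "g \<in> borel_measurable borel" "AE x in lebesgue. f x = g x"
  using completion_ex_borel_measurable_real[OF assms] by (auto simp: AE_completion_iff)

lemma integral_lebesgue_lborel:
  fixes f :: "'a::euclidean_space \<Rightarrow> real"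
  assumes "f \<in> borel_measurable borel"
  shows "(LINT x|lebesgue. f x) = (LINT x|lborel. f x)"
  by (rule integral_completion) (use assms in simp)

lemma integrable_lebesgue_lborel:
  fixes f :: "'a::euclidean_space \<Rightarrow> real"
  assumes "f \<in> borel_measurable borel"
  shows "integrable lebesgue f \<longleftrightarrow> integrable lborel f"
  by (rule integrable_completion) (use assms in simp)

lemma nn_integral_lborel_translate:
  fixes a :: "'a::euclidean_space"
  assumes [measurable]: "f \<in> borel_measurable borel"
  shows "(\<integral>\<^sup>+x. f (x + a) \<partial>lborel) = (\<integral>\<^sup>+x. f x \<partial>lborel)"
proof -
  have "(\<integral>\<^sup>+x. f x \<partial>lborel) = (\<integral>\<^sup>+x. f x \<partial>(distr lborel borel ((+) a)))"
    by (simp only: lborel_distr_plus)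
  also have "\<dots> = (\<integral>\<^sup>+x. f (x + a) \<partial>lborel)"
    by (subst nn_integral_distr) (auto simp: add.commute)
  finally show ?thesis by simp
qed

lemma integral_lborel_translate:
  fixes a :: "'a::euclidean_space" and f :: "'a \<Rightarrow> real"
  assumes [measurable]: "f \<in> borel_measurable borel"
  shows "(LINT x|lborel. f (x + a)) = (LINT x|lborel. f x)"
proof -
  have "(LINT x|lborel. f x) = (LINT x|(distr lborel borel ((+) a)). f x)"
    by (simp only: lborel_distr_plus)
  also have "\<dots> = (LINT x|lborel. f (x + a))"
    by (subst integral_distr) (auto simp: add.commute)
  finally show ?thesis by simp
qed

section \<open>The spaces $L_p$\<close>

lemma Lp_space_measurable: "f \<in> Lp_space p \<Longrightarrow> f \<in> borel_measurable lebesgue"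
  by (simp add: Lp_space_def)

lemma Lp_norm_nonneg [simp]: "0 \<le> Lp_norm p f"
  by (simp add: Lp_norm_def)

lemma Lp_norm_powr:
  assumes "0 < p"
  shows "Lp_norm p f powr p = (LINT x|lebesgue. \<bar>f x\<bar> powr p)"
  using assms by (simp add: Lp_norm_def powr_powr)

lemma nn_integral_Lp_norm:
  assumes "f \<in> Lp_space p" "0 < p"
  shows "(\<integral>\<^sup>+x. ennreal (\<bar>f x\<bar> powr p) \<partial>lebesgue) = ennreal (Lp_norm p f powr p)"
  using assms by (subst nn_integral_eq_integral) (auto simp: Lp_space_def Lp_norm_powr)

text \<open>A bound on the nonnegative integral gives integrability and the norm estimate together,
  so membership never has to be known beforehand.\<close>

lemma Lp_boundI:
  assumes [measurable]: "f \<in> borel_measurable lebesgue" and "0 < p" "0 \<le> K"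
    and le: "(\<integral>\<^sup>+x. ennreal (\<bar>f x\<bar> powr p) \<partial>lebesgue) \<le> ennreal (K powr p)"
  shows "f \<in> Lp_space p" "Lp_norm p f \<le> K"
proof -
  have "(\<integral>\<^sup>+x. ennreal (\<bar>f x\<bar> powr p) \<partial>lebesgue) < \<infinity>"
    using le by (rule order.strict_trans1) simp
  then have "integrable lebesgue (\<lambda>x. \<bar>f x\<bar> powr p)"
    by (intro integrableI_nonneg) auto
  then show mem: "f \<in> Lp_space p"
    by (simp add: Lp_space_def)
  have "Lp_norm p f powr p \<le> K powr p"
    using le nn_integral_Lp_norm[OF mem \<open>0 < p\<close>] by simp
  then show "Lp_norm p f \<le> K"
    using \<open>0 < p\<close> \<open>0 \<le> K\<close> by (metis Lp_norm_nonneg powr_less_mono2 linorder_not_le)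
qed

lemma Lp_cong_AE:
  assumes "f \<in> Lp_space p" "AE x in lebesgue. f x = g x"
  shows "g \<in> Lp_space p" "Lp_norm p g = Lp_norm p f"
proof -
  have g: "g \<in> borel_measurable lebesgue"
    using assms by (auto intro: borel_measurable_AE simp: Lp_space_def)
  have "integrable lebesgue (\<lambda>x. \<bar>f x\<bar> powr p) = integrable lebesgue (\<lambda>x. \<bar>g x\<bar> powr p)"
    using assms g by (intro integrable_cong_AE) (auto simp: Lp_space_def)
  then show "g \<in> Lp_space p"
    using assms g by (simp add: Lp_space_def)
  have "(LINT x|lebesgue. \<bar>f x\<bar> powr p) = (LINT x|lebesgue. \<bar>g x\<bar> powr p)"
    using assms g by (intro integral_cong_AE) (auto simp: Lp_space_def)
  then show "Lp_norm p g = Lp_norm p f"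
    by (simp add: Lp_norm_def)
qed

lemma Lp_zero [simp]: "(\<lambda>x. 0) \<in> Lp_space p" "Lp_norm p (\<lambda>x. 0) = 0"
  by (auto simp: Lp_space_def Lp_norm_def)

lemma Lp_cmult:
  assumes "f \<in> Lp_space p" "0 < p"
  shows "(\<lambda>x. c * f x) \<in> Lp_space p" "Lp_norm p (\<lambda>x. c * f x) = \<bar>c\<bar> * Lp_norm p f"
  using assms
  by (auto simp: Lp_space_def Lp_norm_def abs_mult powr_mult powr_powr)

text \<open>Makes functions in \<open>Lp_space p\<close> integrable over compact sets and for
  probability measures, where Hoelder's inequality would be the usual tool.\<close>

lemma abs_le_one_plus_powr:
  fixes u :: real
  assumes "1 \<le> p"
  shows "\<bar>u\<bar> \<le> 1 + \<bar>u\<bar> powr p"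
proof (cases "\<bar>u\<bar> \<le> 1")
  case False
  then show ?thesis using powr_mono[of 1 p "\<bar>u\<bar>"] assms by simp
qed (simp add: add_increasing2)

lemma convex_on_abs_powr:
  assumes "1 \<le> p"
  shows "convex_on UNIV (\<lambda>x::real. \<bar>x\<bar> powr p)"
proof -
  have cv: "convex_on {0..} (\<lambda>x::real. x powr p)"
  proof (rule convex_onI)
    fix t x y :: real assume t: "0 < t" "t < 1" and xy: "x \<in> {0..}" "y \<in> {0..}"
    show "((1 - t) *\<^sub>R x + t *\<^sub>R y) powr p \<le> (1 - t) * x powr p + t * y powr p"
    proof (cases "x = 0 \<or> y = 0")
      case False
      then show ?thesis
        using xy t by (intro convex_onD[OF powr_convex[OF assms], of t x y]) auto
    next
      case True
      \<comment> \<open>With one endpoint equal to 0 the claim becomes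
        \<open>(t * y) powr p \<le> t * y powr p\<close>, that is
        \<open>t powr p \<le> t\<close>.\<close>
      have pl: "u powr p \<le> u" if "0 < u" "u < 1" for u :: real
        using that assms powr_mono'[of 1 p u] by simp
      show ?thesis
        using True t xy assms pl[of t] pl[of "1 - t"]
        by (auto simp: powr_mult intro!: mult_right_mono)
    qed
  qed auto
  show ?thesis
  proof (rule convex_onI)
    fix t x y :: real assume t: "0 < t" "t < 1"
    have "\<bar>(1 - t) *\<^sub>R x + t *\<^sub>R y\<bar> powr p \<le> ((1 - t) *\<^sub>R \<bar>x\<bar> + t *\<^sub>R \<bar>y\<bar>) powr p"
      using t assms by (intro powr_mono2) (auto intro!: order_trans[OF abs_triangle_ineq] simp: abs_mult)
    also have "\<dots> \<le> (1 - t) * \<bar>x\<bar> powr p + t * \<bar>y\<bar> powr p"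
      using t by (intro convex_onD[OF cv]) auto
    finally show "\<bar>(1 - t) *\<^sub>R x + t *\<^sub>R y\<bar> powr p \<le> (1 - t) * \<bar>x\<bar> powr p + t * \<bar>y\<bar> powr p" .
  qed auto
qed

text \<open>With \<open>a = \<parallel>f\<parallel>\<close>, \<open>b = \<parallel>g\<parallel>\<close>, convexity is applied to
  \<open>(f + g) / (a + b)\<close> as a convex combination of \<open>f / a\<close> and \<open>g / b\<close>.\<close>

lemma Lp_add_bound:
  assumes p: "1 \<le> p" and f: "f \<in> Lp_space p" and g: "g \<in> Lp_space p"
    and a: "Lp_norm p f \<le> a" "0 < a" and b: "Lp_norm p g \<le> b" "0 < b"
  shows "(\<lambda>x. f x + g x) \<in> Lp_space p" "Lp_norm p (\<lambda>x. f x + g x) \<le> a + b"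
proof -
  have meas [measurable]: "f \<in> borel_measurable lebesgue" "g \<in> borel_measurable lebesgue"
    using f g by (auto simp: Lp_space_def)
  define t where "t = b / (a + b)"
  have t: "0 < t" "t < 1" "1 - t = a / (a + b)"
    using a b by (auto simp: t_def field_simps)
  have pt: "\<bar>f x + g x\<bar> powr p
      \<le> (a + b) powr p * ((1 - t) * (\<bar>f x\<bar> powr p / a powr p) + t * (\<bar>g x\<bar> powr p / b powr p))" for x
  proof -
    have "f x + g x = (a + b) * ((1 - t) *\<^sub>R (f x / a) + t *\<^sub>R (g x / b))"
    proof -
      have "(a + b) * ((1 - t) *\<^sub>R (f x / a) + t *\<^sub>R (g x / b)) = ((a + b) * (1 - t)) * (f x / a) + ((a + b) * t) * (g x / b)"
        by (simp only: distrib_left real_scaleR_def mult.assoc)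
      moreover have "(a + b) * (1 - t) = a" "(a + b) * t = b"
        using a b unfolding t(3) by (simp_all add: t_def)
      ultimately show ?thesis
        using a b by simp
    qed
    then have "\<bar>f x + g x\<bar> powr p = (a + b) powr p * \<bar>(1 - t) *\<^sub>R (f x / a) + t *\<^sub>R (g x / b)\<bar> powr p"
      using a b by (simp add: abs_mult powr_mult)
    also have "\<dots> \<le> (a + b) powr p * ((1 - t) * \<bar>f x / a\<bar> powr p + t * \<bar>g x / b\<bar> powr p)"
      using t by (intro mult_left_mono convex_onD[OF convex_on_abs_powr[OF p]]) auto
    finally show ?thesis
      using a b by (simp add: powr_divide)
  qed
  have i: "integrable lebesgue (\<lambda>x. \<bar>f x\<bar> powr p)" "integrable lebesgue (\<lambda>x. \<bar>g x\<bar> powr p)"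
    using f g by (auto simp: Lp_space_def)
  have "(\<integral>\<^sup>+x. ennreal (\<bar>f x + g x\<bar> powr p) \<partial>lebesgue)
      \<le> (\<integral>\<^sup>+x. ennreal ((a + b) powr p * ((1 - t) * (\<bar>f x\<bar> powr p / a powr p) + t * (\<bar>g x\<bar> powr p / b powr p))) \<partial>lebesgue)"
    by (intro nn_integral_mono ennreal_leI pt)
  also have "\<dots> = ennreal (LINT x|lebesgue. (a + b) powr p * ((1 - t) * (\<bar>f x\<bar> powr p / a powr p) + t * (\<bar>g x\<bar> powr p / b powr p)))"
    by (intro nn_integral_eq_integral AE_I2 mult_nonneg_nonneg add_nonneg_nonneg divide_nonneg_nonneg)
      (use i t in auto)
  also have "(LINT x|lebesgue. (a + b) powr p * ((1 - t) * (\<bar>f x\<bar> powr p / a powr p) + t * (\<bar>g x\<bar> powr p / b powr p)))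
     = (a + b) powr p * ((1 - t) * (Lp_norm p f powr p / a powr p) + t * (Lp_norm p g powr p / b powr p))"
    using i p by (simp add: Lp_norm_powr)
  also have "\<dots> \<le> (a + b) powr p * ((1 - t) * 1 + t * 1)"
    using t a b p by (intro mult_left_mono add_mono) (auto simp: divide_le_eq_1 intro!: powr_mono2)
  finally have *: "(\<integral>\<^sup>+x. ennreal (\<bar>f x + g x\<bar> powr p) \<partial>lebesgue) \<le> ennreal ((a + b) powr p)"
    by (simp add: ennreal_leI)
  show "(\<lambda>x. f x + g x) \<in> Lp_space p" "Lp_norm p (\<lambda>x. f x + g x) \<le> a + b"
    using Lp_boundI[OF _ _ _ *] p a b by auto
qed

text \<open>\<open>Lp_add_bound\<close> divides by \<open>a\<close> and \<open>b\<close>, so a norm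
  may not be used there if it vanishes; a positive amount is added to both norms and then made
  small.\<close>

lemma Lp_add:
  assumes p: "1 \<le> p" and f: "f \<in> Lp_space p" and g: "g \<in> Lp_space p"
  shows "(\<lambda>x. f x + g x) \<in> Lp_space p"
    "Lp_norm p (\<lambda>x. f x + g x) \<le> Lp_norm p f + Lp_norm p g"
proof -
  show "(\<lambda>x. f x + g x) \<in> Lp_space p"
    using Lp_add_bound(1)[OF p f g, of "Lp_norm p f + 1" "Lp_norm p g + 1"]
    by (simp add: add_nonneg_pos)
  show "Lp_norm p (\<lambda>x. f x + g x) \<le> Lp_norm p f + Lp_norm p g"
  proof (rule field_le_epsilon)
    fix e :: real assume "0 < e"
    then show "Lp_norm p (\<lambda>x. f x + g x) \<le> Lp_norm p f + Lp_norm p g + e"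
      using Lp_add_bound(2)[OF p f g, of "Lp_norm p f + e / 2" "Lp_norm p g + e / 2"]
      by (simp add: add_nonneg_pos)
  qed
qed

lemma Lp_diff:
  assumes "1 \<le> p" "f \<in> Lp_space p" "g \<in> Lp_space p"
  shows "(\<lambda>x. f x - g x) \<in> Lp_space p"
    "Lp_norm p (\<lambda>x. f x - g x) \<le> Lp_norm p f + Lp_norm p g"
proof -
  have "(\<lambda>x. - g x) \<in> Lp_space p" "Lp_norm p (\<lambda>x. - g x) = Lp_norm p g"
    using Lp_cmult[OF assms(3), of "-1"] assms(1) by simp_all
  then show "(\<lambda>x. f x - g x) \<in> Lp_space p"
      "Lp_norm p (\<lambda>x. f x - g x) \<le> Lp_norm p f + Lp_norm p g"
    using Lp_add[OF assms(1,2), of "\<lambda>x. - g x"] by simp_all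
qed

lemma Lp_sum:
  assumes "1 \<le> p" "finite A" "\<And>i. i \<in> A \<Longrightarrow> f i \<in> Lp_space p"
  shows "(\<lambda>x. \<Sum>i\<in>A. f i x) \<in> Lp_space p \<and>
    Lp_norm p (\<lambda>x. \<Sum>i\<in>A. f i x) \<le> (\<Sum>i\<in>A. Lp_norm p (f i))"
  using assms(2,3)
proof (induction A rule: finite_induct)
  case (insert a A)
  then have IH: "(\<lambda>x. \<Sum>i\<in>A. f i x) \<in> Lp_space p" "Lp_norm p (\<lambda>x. \<Sum>i\<in>A. f i x) \<le> (\<Sum>i\<in>A. Lp_norm p (f i))"
    by auto
  have fa: "f a \<in> Lp_space p"
    using insert.prems by simp
  show ?case
    using Lp_add[OF assms(1) fa IH(1)] IH(2) insert.hyps by auto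
qed auto

lemma Lp_translate:
  fixes f :: "real^'d::finite \<Rightarrow> real"
  assumes "f \<in> Lp_space p" "0 < p"
  shows "(\<lambda>x. f (x + a)) \<in> Lp_space p" "Lp_norm p (\<lambda>x. f (x + a)) = Lp_norm p f"
proof -
  obtain g where g [measurable]: "g \<in> borel_measurable borel" and ae: "AE x in lebesgue. f x = g x"
    using borel_version[OF Lp_space_measurable[OF assms(1)]] by blast
  have ae': "AE x in lebesgue. g (x + a) = f (x + a)"
    using AE_lebesgue_translate[OF ae, of a] by (auto elim: eventually_mono)
  have gLp: "g \<in> Lp_space p" "Lp_norm p g = Lp_norm p f"
    using Lp_cong_AE[OF assms(1) ae] by auto
  have int: "integrable lborel (\<lambda>x. \<bar>g (x + a)\<bar> powr p)"
  proof (rule integrableI_nonneg)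
    show "(\<integral>\<^sup>+x. ennreal (\<bar>g (x + a)\<bar> powr p) \<partial>lborel) < \<infinity>"
      using nn_integral_lborel_translate[of "\<lambda>x. ennreal (\<bar>g x\<bar> powr p)" a]
        nn_integral_Lp_norm[OF gLp(1) assms(2)] by (simp add: nn_integral_completion)
  qed auto
  have g': "(\<lambda>x. g (x + a)) \<in> Lp_space p"
    unfolding Lp_space_def using int by (auto simp: integrable_lebesgue_lborel intro: measurable_completion)
  show "(\<lambda>x. f (x + a)) \<in> Lp_space p"
    by (rule Lp_cong_AE(1)[OF g' ae'])
  have "Lp_norm p (\<lambda>x. g (x + a)) = Lp_norm p g"
    using integral_lborel_translate[of "\<lambda>x. \<bar>g x\<bar> powr p" a]
    by (simp add: Lp_norm_def integral_lebesgue_lborel)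
  then show "Lp_norm p (\<lambda>x. f (x + a)) = Lp_norm p f"
    using Lp_cong_AE(2)[OF g' ae'] gLp by simp
qed

text \<open>If the integral of \<open>H\<close> is junk because \<open>H\<close> is not integrable, then the right-hand side is
  infinite, as \<open>\<bar>H\<bar> \<le> 1 + \<bar>H\<bar> powr p\<close>.\<close>

lemma (in prob_space) nn_Jensen_powr:
  assumes p: "1 \<le> p" and [measurable]: "H \<in> borel_measurable M"
  shows "ennreal (\<bar>\<integral>w. H w \<partial>M\<bar> powr p) \<le> (\<integral>\<^sup>+w. ennreal (\<bar>H w\<bar> powr p) \<partial>M)"
proof (cases "integrable M (\<lambda>w. \<bar>H w\<bar> powr p)")
  case True
  note le = abs_le_one_plus_powr[OF p]
  have iH: "integrable M H"
    by (rule Bochner_Integration.integrable_bound[of _ "\<lambda>w. 1 + \<bar>H w\<bar> powr p"])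
       (use True le in \<open>auto simp: abs_of_nonneg add_nonneg_nonneg\<close>)
  have "\<bar>\<integral>w. H w \<partial>M\<bar> powr p \<le> (\<integral>w. \<bar>H w\<bar> powr p \<partial>M)"
    by (rule jensens_inequality[where I = UNIV]) (use iH True convex_on_abs_powr[OF p] in auto)
  then show ?thesis
    using True by (subst nn_integral_eq_integral) (auto intro: ennreal_leI)
next
  case False
  then have "\<not> (\<integral>\<^sup>+w. ennreal (\<bar>H w\<bar> powr p) \<partial>M) < \<infinity>"
    by (intro notI) (erule notE, rule integrableI_nonneg, auto)
  then have "(\<integral>\<^sup>+w. ennreal (\<bar>H w\<bar> powr p) \<partial>M) = \<infinity>"
    by (simp add: less_top[symmetric])
  then show ?thesis by simp
qed

text \<open>Jensen's inequality at each \<open>x\<close>, then an exchange of integrals: what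
  remains inside is the p-th power of the norm in \<open>x\<close> for fixed
  \<open>w\<close>.\<close>

lemma Lp_average:
  fixes H :: "real^'d::finite \<Rightarrow> 'w \<Rightarrow> real"
  assumes M: "prob_space M" and p: "1 \<le> p"
    and [measurable]: "case_prod H \<in> borel_measurable (lborel \<Otimes>\<^sub>M M)"
    and K: "0 \<le> K" and bd: "AE w in M. (\<lambda>x. H x w) \<in> Lp_space p \<and> Lp_norm p (\<lambda>x. H x w) \<le> K"
  shows "(\<lambda>x. \<integral>w. H x w \<partial>M) \<in> Lp_space p" "Lp_norm p (\<lambda>x. \<integral>w. H x w \<partial>M) \<le> K"
proof -
  interpret M: prob_space M by (rule M)
  interpret pair_sigma_finite lborel M ..
  have bm: "(\<lambda>x. \<integral>w. H x w \<partial>M) \<in> borel_measurable lborel"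
    by measurable
  have "(\<integral>\<^sup>+x. ennreal (\<bar>\<integral>w. H x w \<partial>M\<bar> powr p) \<partial>lborel)
      \<le> (\<integral>\<^sup>+x. (\<integral>\<^sup>+w. ennreal (\<bar>H x w\<bar> powr p) \<partial>M) \<partial>lborel)"
    by (intro nn_integral_mono M.nn_Jensen_powr p) measurable
  also have "\<dots> = (\<integral>\<^sup>+w. (\<integral>\<^sup>+x. ennreal (\<bar>H x w\<bar> powr p) \<partial>lborel) \<partial>M)"
    by (rule Fubini'[symmetric]) measurable
  also have "\<dots> \<le> (\<integral>\<^sup>+w. ennreal (K powr p) \<partial>M)"
  proof (rule nn_integral_mono_AE)
    show "AE w in M. (\<integral>\<^sup>+x. ennreal (\<bar>H x w\<bar> powr p) \<partial>lborel) \<le> ennreal (K powr p)"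
      using bd
    proof eventually_elim
      case (elim w)
      then show ?case
        using nn_integral_Lp_norm[of "\<lambda>x. H x w" p] p
        by (simp add: nn_integral_completion powr_mono2)
    qed
  qed
  also have "\<dots> = ennreal (K powr p)"
    by (simp add: M.emeasure_space_1)
  finally have *: "(\<integral>\<^sup>+x. ennreal (\<bar>\<integral>w. H x w \<partial>M\<bar> powr p) \<partial>lebesgue) \<le> ennreal (K powr p)"
    by (simp add: nn_integral_completion)
  have bm': "(\<lambda>x. \<integral>w. H x w \<partial>M) \<in> borel_measurable lebesgue"
    using bm by (rule measurable_completion)
  show "(\<lambda>x. \<integral>w. H x w \<partial>M) \<in> Lp_space p" "Lp_norm p (\<lambda>x. \<integral>w. H x w \<partial>M) \<le> K"
    using Lp_boundI[OF bm' _ K *] p by auto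
qed

section \<open>Test functions\<close>

text \<open>The family \<open>t \<mapsto> t\<^bsup>-k\<^esup> exp (-1/t)\<close>, extended by \<open>0\<close>, spans a space that is closed under
  differentiation.\<close>

definition flat :: "nat \<Rightarrow> real \<Rightarrow> real" where
  "flat k t = (if 0 < t then (1 / t) ^ k * exp (- (1 / t)) else 0)"

lemma flat_tendsto_0: "(flat k \<longlongrightarrow> 0) (at_right 0)"
proof -
  have "((\<lambda>t::real. inverse t ^ k / exp (inverse t)) \<longlongrightarrow> 0) (at_right 0)"
    by (rule filterlim_compose[OF tendsto_power_div_exp_0 filterlim_inverse_at_top_right])
  then show ?thesis
    by (rule Lim_transform_eventually)
       (auto simp: flat_def eventually_at_right_less exp_minus field_simps
             intro!: eventually_mono[OF eventually_at_right_less])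
qed

lemma flat_DERIV: "(flat k has_real_derivative flat (k + 2) t - real k * flat (k + 1) t) (at t)"
proof (cases t "0 :: real" rule: linorder_cases)
  case less
  have "(flat k has_real_derivative 0) (at t)"
    by (rule has_field_derivative_transform_within_open[OF DERIV_const, of "{..<0}"])
       (use less in \<open>auto simp: flat_def\<close>)
  then show ?thesis using less by (simp add: flat_def)
next
  case equal
  have q: "((\<lambda>h. (flat k (0 + h) - flat k 0) / h) \<longlongrightarrow> 0) (at 0)"
  proof (rule filterlim_split_at_real)
    \<comment> \<open>To the right of 0 the difference quotient of \<open>flat k\<close> at 0 is
      \<open>flat (k + 1)\<close>, to the left it is 0.\<close>
    have "((\<lambda>h. flat (k + 1) h) \<longlongrightarrow> 0) (at_right 0)"
      by (rule flat_tendsto_0)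
    then show "((\<lambda>h. (flat k (0 + h) - flat k 0) / h) \<longlongrightarrow> 0) (at_right 0)"
      by (rule Lim_transform_eventually)
         (auto simp: flat_def intro!: eventually_mono[OF eventually_at_right_less])
    have "((\<lambda>h::real. 0::real) \<longlongrightarrow> 0) (at_left 0)" by simp
    then show "((\<lambda>h. (flat k (0 + h) - flat k 0) / h) \<longlongrightarrow> 0) (at_left 0)"
      by (rule Lim_transform_eventually)
         (auto simp: flat_def eventually_at_left_field intro!: exI[of _ "-1"])
  qed
  then show ?thesis using equal by (simp add: DERIV_def flat_def)
next
  case greater
  have "((\<lambda>t. (1 / t) ^ k * exp (- (1 / t))) has_real_derivative
      (real k * (1 / t) ^ (k - 1) * (- 1 / t\<^sup>2)) * exp (- (1 / t)) + (1 / t) ^ k * (exp (- (1 / t)) * (1 / t\<^sup>2))) (at t)"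
    using greater by (auto intro!: derivative_eq_intros simp: power2_eq_square)
  also have "(real k * (1 / t) ^ (k - 1) * (- 1 / t\<^sup>2)) * exp (- (1 / t)) + (1 / t) ^ k * (exp (- (1 / t)) * (1 / t\<^sup>2))
     = flat (k + 2) t - real k * flat (k + 1) t"
    using greater by (cases k) (auto simp: flat_def power2_eq_square field_simps)
  finally show ?thesis
    by (rule has_field_derivative_transform_within_open[of _ _ _ "{0<..}"])
       (use greater in \<open>auto simp: flat_def\<close>)
qed

text \<open>An algebra of functions that contains the bumps needed below and is mapped into itself
  by every partial derivative. Differentiability of its members therefore carries over to all
  iterated derivatives, which is \<open>smooth\<close>.\<close>

inductive_set gen_smooth :: "(real^'d::finite \<Rightarrow> real) set" where
  const: "(\<lambda>x. c) \<in> gen_smooth"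
| flat: "(\<lambda>x. flat k (a * x $ i + b)) \<in> gen_smooth"
| add: "f \<in> gen_smooth \<Longrightarrow> g \<in> gen_smooth \<Longrightarrow> (\<lambda>x. f x + g x) \<in> gen_smooth"
| mult: "f \<in> gen_smooth \<Longrightarrow> g \<in> gen_smooth \<Longrightarrow> (\<lambda>x. f x * g x) \<in> gen_smooth"

lemma partial_deriv_eqI: "(f has_derivative D) (at x) \<Longrightarrow> partial_deriv i f x = D (axis i 1)"
  by (simp add: partial_deriv_def frechet_derivative_at[symmetric])

lemma gen_smooth_deriv:
  fixes f :: "real^'d::finite \<Rightarrow> real"
  shows "f \<in> gen_smooth \<Longrightarrow> f differentiable_on UNIV \<and> (\<forall>i. partial_deriv i f \<in> gen_smooth)"
proof (induction rule: gen_smooth.induct)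
  case (const c)
  have "partial_deriv i (\<lambda>x::real^'d. c) = (\<lambda>x. 0)" for i
    by (rule ext, rule trans[OF partial_deriv_eqI], rule has_derivative_const) simp
  then show ?case by (intro conjI allI) (simp_all add: gen_smooth.const)
next
  case (flat k a i b)
  have d: "((\<lambda>x::real^'d. flat k (a * x $ i + b)) has_derivative
      (\<lambda>h. (flat (k + 2) (a * x $ i + b) - real k * flat (k + 1) (a * x $ i + b)) * (a * h $ i))) (at x)" for x
  proof -
    have "((\<lambda>x::real^'d. a * x $ i + b) has_derivative (\<lambda>h. a * h $ i)) (at x)"
      by (auto intro!: derivative_eq_intros bounded_linear_imp_has_derivative bounded_linear_vec_nth)
    from DERIV_compose_FDERIV[OF flat_DERIV this] show ?thesis
      by (simp add: mult.commute)
  qed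
  have pd: "partial_deriv j (\<lambda>x::real^'d. flat k (a * x $ i + b)) =
      (\<lambda>x. (flat (k + 2) (a * x $ i + b) + (- real k) * flat (k + 1) (a * x $ i + b)) * (a * (axis j 1 :: real^'d) $ i))" for j
    by (rule ext, rule trans[OF partial_deriv_eqI], rule d) simp
  have "partial_deriv j (\<lambda>x::real^'d. flat k (a * x $ i + b)) \<in> gen_smooth" for j
    unfolding pd by (intro gen_smooth.intros)
  then show ?case
    using d unfolding differentiable_on_def differentiable_def by blast
next
  case (add f g)
  have d: "(f has_derivative frechet_derivative f (at x)) (at x)" "(g has_derivative frechet_derivative g (at x)) (at x)" for x
    using add.IH by (auto simp: differentiable_on_def frechet_derivative_works[symmetric])
  have s: "((\<lambda>x. f x + g x) has_derivative (\<lambda>h. frechet_derivative f (at x) h + frechet_derivative g (at x) h)) (at x)" for x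
    by (intro derivative_intros d)
  have "partial_deriv j (\<lambda>x. f x + g x) = (\<lambda>x. partial_deriv j f x + partial_deriv j g x)" for j
    by (rule ext, rule trans[OF partial_deriv_eqI], rule s) (simp add: partial_deriv_def)
  then show ?case
    using s add.IH by (auto simp: differentiable_on_def differentiable_def intro!: gen_smooth.intros)
next
  case (mult f g)
  have d: "(f has_derivative frechet_derivative f (at x)) (at x)" "(g has_derivative frechet_derivative g (at x)) (at x)" for x
    using mult.IH by (auto simp: differentiable_on_def frechet_derivative_works[symmetric])
  have s: "((\<lambda>x. f x * g x) has_derivative (\<lambda>h. f x * frechet_derivative g (at x) h + frechet_derivative f (at x) h * g x)) (at x)" for x
    by (intro derivative_intros d)
  have "partial_deriv j (\<lambda>x. f x * g x) = (\<lambda>x. f x * partial_deriv j g x + partial_deriv j f x * g x)" for j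
    by (rule ext, rule trans[OF partial_deriv_eqI], rule s) (simp add: partial_deriv_def)
  then show ?case
    using s mult by (auto simp: differentiable_on_def differentiable_def intro!: gen_smooth.intros)
qed

lemma gen_smooth_smooth: "f \<in> gen_smooth \<Longrightarrow> smooth f"
proof -
  assume f: "f \<in> gen_smooth"
  have "foldr partial_deriv is f \<in> gen_smooth" for "is"
    by (induction "is") (use f gen_smooth_deriv in auto)
  then show ?thesis
    using gen_smooth_deriv by (auto simp: smooth_def)
qed

lemma gen_smooth_prod:
  "finite A \<Longrightarrow> (\<And>i. i \<in> A \<Longrightarrow> f i \<in> gen_smooth) \<Longrightarrow> (\<lambda>x. \<Prod>i\<in>A. f i x) \<in> gen_smooth"
  by (induction A rule: finite_induct) (auto intro: gen_smooth.intros)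

text \<open>The functions are products over the coordinates of
  \<open>flat 0 (n * (x $ i - a $ i)) * flat 0 (n * (c $ i - x $ i))\<close>. Each factor lies
  between 0 and 1, vanishes outside the box and, as \<open>exp (- 1 / (n * u))\<close> with
  \<open>u > 0\<close>, tends to 1 inside it.\<close>

lemma test_functions_approx_box:
  fixes a c :: "real^'d::finite"
  obtains \<phi> where "\<And>n. test_function (\<phi> n)" "\<And>n x. \<bar>\<phi> n x\<bar> \<le> indicator (cbox a c) x"
    "\<And>x. (\<lambda>n. \<phi> n x) \<longlonglongrightarrow> indicator (box a c) x"
proof
  define \<phi> :: "nat \<Rightarrow> real^'d \<Rightarrow> real" where
    "\<phi> n x = (\<Prod>i\<in>UNIV. flat 0 (real n * x $ i + (- real n * a $ i)) * flat 0 ((- real n) * x $ i + real n * c $ i))" for n x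
  have fl: "0 \<le> flat 0 t" "flat 0 t \<le> 1" for t
    by (auto simp: flat_def)
  have out: "\<phi> n x = 0" if "x \<notin> box a c" for n x
  proof -
    obtain i where i: "x $ i \<le> a $ i \<or> c $ i \<le> x $ i"
      using \<open>x \<notin> box a c\<close> by (auto simp: mem_box_cart not_less)
    then have "real n * x $ i \<le> real n * a $ i \<or> real n * c $ i \<le> real n * x $ i"
      by (auto intro: mult_left_mono)
    then have "flat 0 (real n * x $ i + (- real n * a $ i)) * flat 0 ((- real n) * x $ i + real n * c $ i) = 0"
      by (auto simp: flat_def)
    then show ?thesis
      unfolding \<phi>_def by (intro prod_zero) auto
  qed
  show "test_function (\<phi> n)" for n
  proof -
    have "\<phi> n \<in> gen_smooth"
      unfolding \<phi>_def by (intro gen_smooth_prod gen_smooth.intros) auto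
    moreover have "{x. \<phi> n x \<noteq> 0} \<subseteq> box a c"
      using out[of _ n] by auto
    then have "compact (closure {x. \<phi> n x \<noteq> 0})"
      by (auto intro: bounded_subset[OF bounded_box])
    ultimately show ?thesis
      by (simp add: test_function_def gen_smooth_smooth)
  qed
  show "\<bar>\<phi> n x\<bar> \<le> indicator (cbox a c) x" for n x
  proof (cases "x \<in> box a c")
    case True
    then have "x \<in> cbox a c" using box_subset_cbox by blast
    moreover have "0 \<le> \<phi> n x" "\<phi> n x \<le> 1"
      unfolding \<phi>_def by (auto intro!: prod_nonneg prod_le_1 mult_nonneg_nonneg mult_le_one fl)
    ultimately show ?thesis by simp
  qed (simp add: out)
  show "(\<lambda>n. \<phi> n x) \<longlonglongrightarrow> indicator (box a c) x" for x
  proof (cases "x \<in> box a c")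
    case True
    have lim: "(\<lambda>n. flat 0 (real n * u)) \<longlonglongrightarrow> 1" if "0 < u" for u
    proof -
      have "(\<lambda>n. exp (- (1 / (real n * u)))) \<longlonglongrightarrow> exp 0"
        using that by (intro tendsto_exp) real_asymp
      then have "(\<lambda>n. exp (- (1 / (real n * u)))) \<longlonglongrightarrow> 1"
        by simp
      then show ?thesis
        by (rule Lim_transform_eventually)
           (use that in \<open>auto simp: flat_def intro!: eventually_mono[OF eventually_gt_at_top[of 0]]\<close>)
    qed
    have "(\<lambda>n. \<Prod>i\<in>(UNIV::'d set). flat 0 (real n * (x $ i - a $ i)) * flat 0 (real n * (c $ i - x $ i))) \<longlonglongrightarrow> (\<Prod>i\<in>(UNIV::'d set). 1 * 1)"
      using True by (intro tendsto_prod tendsto_mult lim) (auto simp: mem_box_cart)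
    then show ?thesis
      using True by (simp add: \<phi>_def algebra_simps)
  qed (simp add: out)
qed

lemma smooth_foldr: "smooth \<phi> \<Longrightarrow> smooth (foldr partial_deriv L \<phi>)"
  unfolding smooth_def by (metis foldr_append comp_apply)

lemma smooth_differentiable: "smooth \<phi> \<Longrightarrow> \<phi> differentiable (at x)"
  unfolding smooth_def by (drule spec[of _ "[]"]) (simp add: differentiable_on_def)

lemma smooth_continuous: "smooth \<phi> \<Longrightarrow> continuous_on UNIV \<phi>"
  unfolding smooth_def by (drule spec[of _ "[]"]) (simp add: differentiable_imp_continuous_on)

lemma smooth_partial_deriv: "smooth \<phi> \<Longrightarrow> smooth (partial_deriv i \<phi>)"
  using smooth_foldr[of \<phi> "[i]"] by simp

lemma partial_deriv_outside_support:
  assumes "x \<notin> closure {x. \<phi> x \<noteq> 0}"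
  shows "partial_deriv i \<phi> x = 0"
proof -
  have "((\<lambda>x. 0) has_derivative (\<lambda>h. 0)) (at x)" by simp
  then have "(\<phi> has_derivative (\<lambda>h. 0)) (at x)"
    by (rule has_derivative_transform_within_open[of _ _ _ _ "- closure {x. \<phi> x \<noteq> 0}"])
       (use assms closure_subset[of "{x. \<phi> x \<noteq> 0}"] in auto)
  then show ?thesis by (simp add: partial_deriv_eqI)
qed

lemma test_function_partial_deriv:
  assumes "test_function \<phi>"
  shows "test_function (partial_deriv i \<phi>)"
proof -
  have "closure {x. partial_deriv i \<phi> x \<noteq> 0} \<subseteq> closure {x. \<phi> x \<noteq> 0}"
    by (rule closure_minimal) (use partial_deriv_outside_support in auto)
  then have "compact (closure {x. partial_deriv i \<phi> x \<noteq> 0})"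
    using assms compact_Int_closed[OF _ closed_closure, of "closure {x. \<phi> x \<noteq> 0}" "{x. partial_deriv i \<phi> x \<noteq> 0}"]
    by (simp add: Int_absorb1 test_function_def)
  then show ?thesis
    using assms by (simp add: test_function_def smooth_partial_deriv)
qed

lemma test_function_foldr: "test_function \<phi> \<Longrightarrow> test_function (foldr partial_deriv L \<phi>)"
  by (induction L) (auto intro: test_function_partial_deriv)

lemma test_function_classical_D: "test_function \<phi> \<Longrightarrow> test_function (classical_D \<beta> \<phi>)"
  unfolding classical_D_def by (rule test_function_foldr)

lemma test_function_continuous: "test_function \<phi> \<Longrightarrow> continuous_on UNIV \<phi>"
  by (simp add: test_function_def smooth_continuous)

lemma test_function_borel [measurable_dest]: "test_function \<phi> \<Longrightarrow> \<phi> \<in> borel_measurable borel"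
  by (intro borel_measurable_continuous_onI test_function_continuous)

lemma test_function_bound:
  assumes "test_function \<phi>"
  obtains K R where "0 \<le> K" "0 \<le> R" "\<And>x. \<bar>\<phi> x\<bar> \<le> K * indicator (cball 0 R) x"
proof -
  let ?S = "closure {x. \<phi> x \<noteq> 0}"
  have cpt: "compact ?S"
    using assms by (simp add: test_function_def)
  have "compact (\<phi> ` ?S)"
    using test_function_continuous[OF assms] by (intro compact_continuous_image cpt) (auto intro: continuous_on_subset)
  then have "bounded (\<phi> ` ?S)"
    by (rule compact_imp_bounded)
  then obtain K where "\<forall>y\<in>\<phi> ` ?S. norm y \<le> K"
    unfolding bounded_iff by blast
  then have K: "\<bar>\<phi> x\<bar> \<le> K" if "x \<in> ?S" for x
    using that by simp
  obtain R where "\<forall>x\<in>?S. norm x \<le> R"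
    using compact_imp_bounded[OF cpt] unfolding bounded_iff by blast
  then have R: "x \<in> cball 0 R" if "x \<in> ?S" for x
    using that by simp
  show ?thesis
  proof
    show "0 \<le> max K 0" "0 \<le> max R 0" by auto
    show "\<bar>\<phi> x\<bar> \<le> max K 0 * indicator (cball 0 (max R 0)) x" for x
    proof (cases "\<phi> x = 0")
      case False
      then have "x \<in> ?S"
        using closure_subset[of "{x. \<phi> x \<noteq> 0}"] by blast
      then have "\<bar>\<phi> x\<bar> \<le> max K 0" "x \<in> cball 0 (max R 0)"
        using K[of x] R[of x] by auto
      then show ?thesis by simp
    qed simp
  qed
qed

section \<open>Uniqueness of weak derivatives\<close>

lemma locally_integrable_mult_test:
  assumes f: "locally_integrable f" and \<phi>: "test_function \<phi>"
  shows "integrable lebesgue (\<lambda>x. f x * \<phi> x)"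
proof -
  obtain K R where K: "\<And>x. \<bar>\<phi> x\<bar> \<le> K * indicator (cball 0 R) x" "0 \<le> K"
    using test_function_bound[OF \<phi>] by metis
  have i: "integrable lebesgue (\<lambda>x. indicator (cball 0 R) x *\<^sub>R f x)"
    using f unfolding locally_integrable_def set_integrable_def by auto
  have eq: "f x * \<phi> x = (indicator (cball 0 R) x *\<^sub>R f x) * \<phi> x" for x
    using K(1)[of x] by (auto simp: indicator_def)
  have \<phi>m: "\<phi> \<in> borel_measurable lebesgue"
    using test_function_borel[OF \<phi>] by (intro measurable_completion) simp
  show ?thesis
    unfolding eq
  proof (rule Bochner_Integration.integrable_bound)
    show "integrable lebesgue (\<lambda>x. K * (indicator (cball 0 R) x *\<^sub>R f x))"
      using i by simp
    show "(\<lambda>x. (indicator (cball 0 R) x *\<^sub>R f x) * \<phi> x) \<in> borel_measurable lebesgue"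
      using borel_measurable_integrable[OF i] \<phi>m by (rule borel_measurable_times)
    show "AE x in lebesgue. norm ((indicator (cball 0 R) x *\<^sub>R f x) * \<phi> x) \<le> norm (K * (indicator (cball 0 R) x *\<^sub>R f x))"
    proof (rule AE_I2)
      fix x :: "real^'a"
      have "\<bar>\<phi> x\<bar> * \<bar>f x\<bar> \<le> (K * indicator (cball 0 R) x) * \<bar>f x\<bar>"
        by (rule mult_right_mono[OF K(1)]) simp
      then show "norm ((indicator (cball 0 R) x *\<^sub>R f x) * \<phi> x) \<le> norm (K * (indicator (cball 0 R) x *\<^sub>R f x))"
        using K(2) by (cases "x \<in> cball 0 R") (auto simp: abs_mult mult.commute)
    qed
  qed
qed

lemma locally_integrable_diff:
  "locally_integrable f \<Longrightarrow> locally_integrable g \<Longrightarrow> locally_integrable (\<lambda>x. f x - g x)"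
  unfolding locally_integrable_def by auto

text \<open>Dominated convergence passes from test functions to indicators of boxes, so all box
  integrals of \<open>h\<close> vanish; by Lebesgue's differentiation theorem \<open>h\<close> is
  almost everywhere a limit of averages over small cubes.\<close>

lemma AE_zero_if_orthogonal_to_test:
  fixes h :: "real^'d::finite \<Rightarrow> real"
  assumes h: "locally_integrable h"
    and orth: "\<And>\<phi>. test_function \<phi> \<Longrightarrow> (LINT x|lebesgue. h x * \<phi> x) = 0"
  shows "AE x in lebesgue. h x = 0"
proof -
  have cint: "set_integrable lebesgue (cbox a c) h" for a c
    using h by (auto simp: locally_integrable_def)
  have zero: "integral (cbox a c) h = 0" for a c
  proof -
    obtain \<phi> where \<phi>: "\<And>n. test_function (\<phi> n)" "\<And>n x. \<bar>\<phi> n x\<bar> \<le> indicator (cbox a c) x"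
      "\<And>x. (\<lambda>n. \<phi> n x) \<longlonglongrightarrow> indicator (box a c) x"
      using test_functions_approx_box by metis
    have bi: "set_integrable lebesgue (box a c) h"
      by (rule set_integrable_subset[OF cint[of a c]]) (auto simp: box_subset_cbox)
    have "(\<lambda>n. LINT x|lebesgue. h x * \<phi> n x) \<longlonglongrightarrow> (LINT x|lebesgue. h x * indicator (box a c) x)"
    proof (rule integral_dominated_convergence)
      show "integrable lebesgue (\<lambda>x. indicator (cbox a c) x *\<^sub>R \<bar>h x\<bar>)"
        using cint[of a c] set_integrable_abs unfolding set_integrable_def by auto
      show "(\<lambda>x. h x * indicator (box a c) x) \<in> borel_measurable lebesgue"
        using bi by (auto simp: set_integrable_def mult.commute dest: borel_measurable_integrable)
      show "(\<lambda>x. h x * \<phi> n x) \<in> borel_measurable lebesgue" for n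
        using locally_integrable_mult_test[OF h \<phi>(1)] by (rule borel_measurable_integrable)
      show "AE x in lebesgue. (\<lambda>n. h x * \<phi> n x) \<longlonglongrightarrow> h x * indicator (box a c) x"
        by (intro AE_I2 tendsto_intros \<phi>(3))
      show "AE x in lebesgue. norm (h x * \<phi> n x) \<le> indicator (cbox a c) x *\<^sub>R \<bar>h x\<bar>" for n
        using mult_left_mono[OF \<phi>(2)[of n], of "\<bar>h _\<bar>"] by (auto simp: abs_mult mult.commute)
    qed
    then have "(LINT x|lebesgue. h x * indicator (box a c) x) = 0"
      using orth[OF \<phi>(1)] LIMSEQ_unique[OF _ tendsto_const] by simp
    then have "integral (box a c) h = 0"
      using set_lebesgue_integral_eq_integral(2)[OF bi]
      by (simp add: set_lebesgue_integral_def mult.commute)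
    then show ?thesis
      by (simp add: integral_open_interval)
  qed
  have "h integrable_on cbox a c" for a c
    using cint set_lebesgue_integral_eq_integral(1) by blast
  then obtain N where N: "negligible N"
    "\<And>x e. x \<notin> N \<Longrightarrow> 0 < e \<Longrightarrow> \<exists>d>0. \<forall>t. 0 < t \<and> t < d \<longrightarrow>
        norm (integral (cbox x (x + t *\<^sub>R One)) h /\<^sub>R t ^ DIM(real^'d) - h x) < e"
    by (rule integrable_ccontinuous_explicit[of h]) blast
  have "h x = 0" if xN: "x \<notin> N" for x
  proof (rule ccontr)
    assume "h x \<noteq> 0"
    then obtain d where d: "0 < d" "\<And>t. 0 < t \<and> t < d \<longrightarrow>
        norm (integral (cbox x (x + t *\<^sub>R One)) h /\<^sub>R t ^ DIM(real^'d) - h x) < \<bar>h x\<bar>"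
      using N(2)[OF xN, of "\<bar>h x\<bar>"] by auto
    \<comment> \<open>The cube integral is 0, so the quotient at \<open>t = d / 2\<close> is at
      distance exactly \<open>\<bar>h x\<bar>\<close> from \<open>h x\<close>, against the strict
      inequality.\<close>
    from d(2)[of "d / 2"] d(1) show False
      by (simp add: zero)
  qed
  then show ?thesis
    using N(1) by (auto simp: eventually_ae_filter negligible_iff_null_sets intro!: bexI[of _ N])
qed

lemma AE_eq_if_test_eq:
  assumes f: "locally_integrable f" and g: "locally_integrable g"
    and eq: "\<And>\<phi>. test_function \<phi> \<Longrightarrow> (LINT x|lebesgue. f x * \<phi> x) = (LINT x|lebesgue. g x * \<phi> x)"
  shows "AE x in lebesgue. f x = g x"
proof -
  have "AE x in lebesgue. f x - g x = 0"
  proof (rule AE_zero_if_orthogonal_to_test[OF locally_integrable_diff[OF f g]])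
    fix \<phi> :: "real^'a \<Rightarrow> real" assume \<phi>: "test_function \<phi>"
    show "(LINT x|lebesgue. (f x - g x) * \<phi> x) = 0"
      using eq[OF \<phi>] locally_integrable_mult_test[OF f \<phi>] locally_integrable_mult_test[OF g \<phi>]
      by (simp add: left_diff_distrib)
  qed
  then show ?thesis by simp
qed

lemma Lp_locally_integrable:
  assumes f: "f \<in> Lp_space p" and p: "1 \<le> p"
  shows "locally_integrable f"
  unfolding locally_integrable_def set_integrable_def
proof (intro allI impI)
  fix K :: "(real^'a) set" assume K: "compact K"
  have [measurable]: "f \<in> borel_measurable lebesgue"
    using f by (rule Lp_space_measurable)
  have Ks: "K \<in> lmeasurable"
    using K by (rule lmeasurable_compact)
  then have [measurable]: "K \<in> sets lebesgue" by auto
  show "integrable lebesgue (\<lambda>x. indicator K x *\<^sub>R f x)"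
  proof (rule Bochner_Integration.integrable_bound)
    show "integrable lebesgue (\<lambda>x. indicator K x + \<bar>f x\<bar> powr p)"
      using f Ks by (intro Bochner_Integration.integrable_add)
        (auto simp: Lp_space_def fmeasurable_def)
    note le = abs_le_one_plus_powr[OF p]
    show "AE x in lebesgue. norm (indicator K x *\<^sub>R f x) \<le> norm (indicator K x + \<bar>f x\<bar> powr p)"
      using le by (auto simp: indicator_def)
  qed measurable
qed

lemma is_weak_deriv_unique:
  assumes "is_weak_deriv \<beta> g h" "is_weak_deriv \<beta> g h'"
  shows "AE x in lebesgue. h x = h' x"
proof (rule AE_eq_if_test_eq)
  show "locally_integrable h" "locally_integrable h'"
    using assms by (auto simp: is_weak_deriv_def)
  fix \<phi> :: "real^'a \<Rightarrow> real" assume "test_function \<phi>"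
  then have "(-1) ^ mi_abs \<beta> * (LINT x|lebesgue. h x * \<phi> x) = (-1) ^ mi_abs \<beta> * (LINT x|lebesgue. h' x * \<phi> x)"
    using assms by (auto simp: is_weak_deriv_def)
  then show "(LINT x|lebesgue. h x * \<phi> x) = (LINT x|lebesgue. h' x * \<phi> x)"
    by simp
qed

text \<open>Lets any explicitly constructed weak derivative stand in for the chosen
  \<open>weak_D\<close>; the reason is uniqueness up to null sets.\<close>

lemma weak_D_Lp:
  assumes "is_weak_deriv \<beta> g h" "h \<in> Lp_space p"
  shows "is_weak_deriv \<beta> g (weak_D \<beta> g)" "weak_D \<beta> g \<in> Lp_space p"
    "Lp_norm p (weak_D \<beta> g) = Lp_norm p h"
proof -
  show w: "is_weak_deriv \<beta> g (weak_D \<beta> g)"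
    unfolding weak_D_def by (rule someI[of _ h]) (rule assms(1))
  have "AE x in lebesgue. h x = weak_D \<beta> g x"
    using is_weak_deriv_unique[OF assms(1) w] .
  then show "weak_D \<beta> g \<in> Lp_space p" "Lp_norm p (weak_D \<beta> g) = Lp_norm p h"
    by (rule Lp_cong_AE[OF assms(2)])+
qed

section \<open>Averages over translates\<close>

text \<open>The convolution of \<open>f\<close> with the reflection of \<open>\<mu>\<close>; its
  adjoint is the average over the reflected measure.\<close>

definition avg :: "(real^'d::finite) measure \<Rightarrow> (real^'d \<Rightarrow> real) \<Rightarrow> real^'d \<Rightarrow> real" where
  "avg \<mu> f x = (LINT y|\<mu>. f (x + y))"

text \<open>Bounded support makes averages of test functions compactly supported again.\<close>

definition bounded_law :: "real \<Rightarrow> (real^'d::finite) measure \<Rightarrow> bool" where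
  "bounded_law R \<mu> \<longleftrightarrow> prob_space \<mu> \<and> sets \<mu> = sets borel \<and> (AE y in \<mu>. norm y \<le> R)"

text \<open>The properties of test functions on which the duality identities rest. They pass to
  differences and averages at once, with no question of smoothness.\<close>

definition bump_like :: "(real^'d::finite \<Rightarrow> real) \<Rightarrow> bool" where
  "bump_like \<phi> \<longleftrightarrow> \<phi> \<in> borel_measurable borel \<and>
     (\<exists>K\<ge>0. \<exists>R\<ge>0. \<forall>x. \<bar>\<phi> x\<bar> \<le> K * indicator (cball 0 R) x)"

lemma bump_like_test: "test_function \<phi> \<Longrightarrow> bump_like \<phi>"
  unfolding bump_like_def by (metis test_function_bound test_function_borel)

lemma bump_likeE:
  assumes "bump_like \<phi>"
  obtains K R where "\<phi> \<in> borel_measurable borel" "0 \<le> K" "0 \<le> R"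
    "\<And>x. \<bar>\<phi> x\<bar> \<le> K" "\<And>x. R < norm x \<Longrightarrow> \<phi> x = 0" "\<And>x. \<bar>\<phi> x\<bar> \<le> K * indicator (cball 0 R) x"
proof -
  obtain K R where K: "\<phi> \<in> borel_measurable borel" "0 \<le> K" "0 \<le> R" "\<And>x. \<bar>\<phi> x\<bar> \<le> K * indicator (cball 0 R) x"
    using assms unfolding bump_like_def by blast
  have "\<bar>\<phi> x\<bar> \<le> K" "R < norm x \<longrightarrow> \<phi> x = 0" for x
    using K(4)[of x] K(2) by (auto simp: indicator_def of_bool_def split: if_splits)
  then show ?thesis
    using that[OF K(1-3)] K(4) by blast
qed

context
  fixes \<mu> :: "(real^'d::finite) measure" and R :: real
  assumes law: "bounded_law R \<mu>"
begin

interpretation prob_space \<mu>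
  using law by (simp add: bounded_law_def)

lemma law_sets [measurable_cong]: "sets \<mu> = sets borel"
  using law by (simp add: bounded_law_def)

lemma law_prob: "prob_space \<mu>"
  using law by (simp add: bounded_law_def)

lemma law_norm: "AE y in \<mu>. norm y \<le> R"
  using law by (simp add: bounded_law_def)

lemma law_nonneg: "0 \<le> R"
proof -
  have "AE y in \<mu>. 0 \<le> R"
    using law_norm by eventually_elim (use norm_ge_zero order_trans in blast)
  then show ?thesis by simp
qed

lemma integrable_bounded_law:
  fixes \<phi> :: "real^'d \<Rightarrow> real"
  assumes [measurable]: "\<phi> \<in> borel_measurable borel" and K: "\<And>x. \<bar>\<phi> x\<bar> \<le> K"
  shows "integrable \<mu> (\<lambda>y. \<phi> (x + y))"
  by (rule integrable_const_bound[of _ K]) (use K in auto)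

lemma avg_measurable [measurable]:
  assumes [measurable]: "\<phi> \<in> borel_measurable borel"
  shows "avg \<mu> \<phi> \<in> borel_measurable borel"
proof -
  interpret sigma_finite_measure \<mu> ..
  show ?thesis
    unfolding avg_def[abs_def] by measurable
qed

lemma avg_bump_like:
  assumes "bump_like \<phi>"
  shows "bump_like (avg \<mu> \<phi>)"
proof -
  obtain K S where \<phi>: "\<phi> \<in> borel_measurable borel" "0 \<le> K" "0 \<le> S"
    "\<And>x. \<bar>\<phi> x\<bar> \<le> K" "\<And>x. S < norm x \<Longrightarrow> \<phi> x = 0"
    using bump_likeE[OF assms] by metis
  have R: "0 \<le> R" by (rule law_nonneg)
  note [measurable] = \<phi>(1)
  have "\<bar>avg \<mu> \<phi> x\<bar> \<le> K * indicator (cball 0 (S + R)) x" for x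
  proof (cases "norm x \<le> S + R")
    case True
    have "\<bar>avg \<mu> \<phi> x\<bar> \<le> (LINT y|\<mu>. \<bar>\<phi> (x + y)\<bar>)"
      unfolding avg_def by (rule integral_abs_bound)
    also have "\<dots> \<le> (LINT y|\<mu>. K)"
      using integrable_bounded_law[OF \<phi>(1,4)] \<phi>(4) by (intro integral_mono integrable_abs) auto
    finally show ?thesis
      using True by (simp add: prob_space)
  next
    case False
    have "AE y in \<mu>. \<phi> (x + y) = 0"
      using law_norm
    proof eventually_elim
      case (elim y)
      have "norm x \<le> norm (x + y) + norm y"
        using norm_triangle_ineq4[of "x + y" y] by simp
      with elim False show ?case by (intro \<phi>(5)) simp
    qed
    then have "avg \<mu> \<phi> x = 0"
      unfolding avg_def by (intro integral_eq_zero_AE)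
    then show ?thesis by (simp add: \<phi>(2))
  qed
  then show ?thesis
    unfolding bump_like_def using \<phi> R by (intro conjI avg_measurable exI[of _ K] exI[of _ "S + R"]) auto
qed

text \<open>Differentiation under the integral. The sum \<open>C\<close> of bounds for the partial
  derivatives is a Lipschitz constant of \<open>\<phi>\<close> and bounds the linear part too, so
  the normalised remainders are dominated by the constant \<open>2 * C\<close>; they tend to 0
  pointwise along every sequence.\<close>

lemma avg_has_derivative:
  fixes \<phi> :: "real^'d \<Rightarrow> real"
  assumes \<phi>: "test_function \<phi>"
  shows "(avg \<mu> \<phi> has_derivative (\<lambda>h. \<Sum>i\<in>UNIV. h $ i * avg \<mu> (partial_deriv i \<phi>) x)) (at x)"
proof -
  have \<phi>b [measurable]: "\<phi> \<in> borel_measurable borel" by (rule test_function_borel[OF \<phi>])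
  have pb [measurable]: "partial_deriv i \<phi> \<in> borel_measurable borel" for i
    by (rule test_function_borel[OF test_function_partial_deriv[OF \<phi>]])
  obtain K0 where K0: "\<And>x. \<bar>\<phi> x\<bar> \<le> K0"
    using bump_likeE[OF bump_like_test[OF \<phi>]] by metis
  have "\<exists>K\<ge>0. \<forall>x. \<bar>partial_deriv i \<phi> x\<bar> \<le> K" for i
    using bump_likeE[OF bump_like_test[OF test_function_partial_deriv[OF \<phi>]]] by metis
  then obtain K where K: "\<And>i. 0 \<le> K i" "\<And>i x. \<bar>partial_deriv i \<phi> x\<bar> \<le> K i" by metis
  define D where "D z h = (\<Sum>i\<in>UNIV. h $ i * partial_deriv i \<phi> z)" for z h :: "real^'d"
  define C where "C = (\<Sum>i\<in>UNIV. K i)"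
  have C0: "0 \<le> C" unfolding C_def by (intro sum_nonneg K)
  have D: "(\<phi> has_derivative D z) (at z)" for z
  proof -
    have d: "(\<phi> has_derivative frechet_derivative \<phi> (at z)) (at z)"
      using \<phi> smooth_differentiable frechet_derivative_works by (auto simp: test_function_def)
    then interpret bl: bounded_linear "frechet_derivative \<phi> (at z)"
      by (rule has_derivative_bounded_linear)
    have "frechet_derivative \<phi> (at z) h = D z h" for h
    proof -
      have "h = (\<Sum>i\<in>UNIV. h $ i *\<^sub>R axis i 1)"
        by (simp add: vec_eq_iff axis_def if_distrib[of "\<lambda>u. _ * u"] cong: if_cong)
      then have "frechet_derivative \<phi> (at z) h = frechet_derivative \<phi> (at z) (\<Sum>i\<in>UNIV. h $ i *\<^sub>R axis i 1)"
        by simp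
      also have "\<dots> = D z h"
        by (simp add: bl.sum bl.scaleR D_def partial_deriv_def)
      finally show ?thesis .
    qed
    with d show ?thesis by (simp add: ext[of "frechet_derivative \<phi> (at z)" "D z"])
  qed
  have Dle: "\<bar>D z h\<bar> \<le> C * norm h" for z h
  proof -
    have "\<bar>D z h\<bar> \<le> (\<Sum>i\<in>UNIV. \<bar>h $ i * partial_deriv i \<phi> z\<bar>)"
      unfolding D_def by (rule sum_abs)
    also have "\<dots> \<le> (\<Sum>i\<in>UNIV. norm h * K i)"
      unfolding abs_mult by (intro sum_mono mult_mono component_le_norm_cart K) auto
    finally show ?thesis
      by (simp add: C_def sum_distrib_left mult.commute)
  qed
  have lip: "\<bar>\<phi> (z + h) - \<phi> z\<bar> \<le> C * norm h" for z h
  proof -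
    have "norm (\<phi> (z + h) - \<phi> z) \<le> C * norm (z + h - z)"
    proof (rule differentiable_bound[of UNIV])
      show "onorm (D y) \<le> C" for y
        using Dle C0 by (intro onorm_bound) auto
    qed (use D has_derivative_at_withinI in auto)
    then show ?thesis by simp
  qed
  have avgD: "(LINT y|\<mu>. D (x + y) h) = (\<Sum>i\<in>UNIV. h $ i * avg \<mu> (partial_deriv i \<phi>) x)" for h
  proof -
    have "integrable \<mu> (\<lambda>y. h $ i * partial_deriv i \<phi> (x + y))" for i
      using integrable_bounded_law[OF pb K(2)] by simp
    then show ?thesis unfolding D_def avg_def by simp
  qed
  have intD: "integrable \<mu> (\<lambda>y. D (x + y) h)" for h
    unfolding D_def using integrable_bounded_law[OF pb K(2)] by auto
  show ?thesis
    unfolding has_derivative_at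
  proof (intro conjI)
    show "bounded_linear (\<lambda>h. \<Sum>i\<in>UNIV. h $ i * avg \<mu> (partial_deriv i \<phi>) x)"
      by (intro bounded_linear_sum bounded_linear_compose[OF bounded_linear_mult_left bounded_linear_vec_nth])
    show "(\<lambda>h. norm (avg \<mu> \<phi> (x + h) - avg \<mu> \<phi> x - (\<Sum>i\<in>UNIV. h $ i * avg \<mu> (partial_deriv i \<phi>) x)) / norm h) \<midarrow>0\<rightarrow> 0"
      unfolding tendsto_at_iff_sequentially comp_def
    proof (intro allI impI)
      fix h :: "nat \<Rightarrow> real^'d"
      assume h0: "\<forall>n. h n \<in> UNIV - {0}" and hl: "h \<longlonglongrightarrow> 0"
      define q where "q n y = (\<phi> (x + h n + y) - \<phi> (x + y) - D (x + y) (h n)) / norm (h n)" for n y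
      have "(\<lambda>n. LINT y|\<mu>. q n y) \<longlonglongrightarrow> (LINT y|\<mu>. 0)"
      proof (rule integral_dominated_convergence)
        show "integrable \<mu> (\<lambda>y. 2 * C)" by simp
        show "(\<lambda>y. q n y) \<in> borel_measurable \<mu>" for n
          unfolding q_def D_def by measurable
        show "AE y in \<mu>. (\<lambda>n. q n y) \<longlonglongrightarrow> 0"
        proof (rule AE_I2)
          fix y
          have "(\<lambda>h. norm (\<phi> (x + y + h) - \<phi> (x + y) - D (x + y) h) / norm h) \<midarrow>0\<rightarrow> 0"
            using D[of "x + y"] by (simp add: has_derivative_at)
          then have "(\<lambda>n. norm (q n y)) \<longlonglongrightarrow> 0"
            unfolding tendsto_at_iff_sequentially comp_def using h0 hl
            by (auto simp: q_def add_ac)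
          then show "(\<lambda>n. q n y) \<longlonglongrightarrow> 0"
            by (simp add: tendsto_rabs_zero_iff)
        qed
        show "AE y in \<mu>. norm (q n y) \<le> 2 * C" for n
        proof (rule AE_I2)
          fix y
          have "\<bar>\<phi> (x + h n + y) - \<phi> (x + y) - D (x + y) (h n)\<bar> \<le> 2 * C * norm (h n)"
            using lip[of "x + y" "h n"] Dle[of "x + y" "h n"] by (simp add: add_ac)
          then show "norm (q n y) \<le> 2 * C"
            using h0 by (simp add: q_def pos_divide_le_eq)
        qed
      qed simp
      moreover have "(LINT y|\<mu>. q n y)
          = (avg \<mu> \<phi> (x + h n) - avg \<mu> \<phi> x - (\<Sum>i\<in>UNIV. h n $ i * avg \<mu> (partial_deriv i \<phi>) x)) / norm (h n)" for n
        unfolding q_def avgD[symmetric]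
        using integrable_bounded_law[OF \<phi>b K0] intD by (simp add: avg_def)
      ultimately have "(\<lambda>n. (avg \<mu> \<phi> (x + h n) - avg \<mu> \<phi> x - (\<Sum>i\<in>UNIV. h n $ i * avg \<mu> (partial_deriv i \<phi>) x)) / norm (h n)) \<longlonglongrightarrow> 0"
        by simp
      from tendsto_norm[OF this]
      show "(\<lambda>n. norm (avg \<mu> \<phi> (x + h n) - avg \<mu> \<phi> x - (\<Sum>i\<in>UNIV. h n $ i * avg \<mu> (partial_deriv i \<phi>) x)) / norm (h n)) \<longlonglongrightarrow> 0"
        by simp
    qed
  qed
qed

lemma partial_deriv_avg:
  assumes "test_function \<phi>"
  shows "partial_deriv i (avg \<mu> \<phi>) = avg \<mu> (partial_deriv i \<phi>)"
proof
  fix x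
  have "(\<Sum>j\<in>UNIV. (axis i 1 :: real^'d) $ j * avg \<mu> (partial_deriv j \<phi>) x) = avg \<mu> (partial_deriv i \<phi>) x"
    by (simp add: axis_def if_distrib[of "\<lambda>u. u * _"] cong: if_cong)
  then show "partial_deriv i (avg \<mu> \<phi>) x = avg \<mu> (partial_deriv i \<phi>) x"
    using partial_deriv_eqI[OF avg_has_derivative[OF assms]] by simp
qed

lemma foldr_partial_deriv_avg:
  assumes "test_function \<phi>"
  shows "foldr partial_deriv L (avg \<mu> \<phi>) = avg \<mu> (foldr partial_deriv L \<phi>)"
  by (induction L) (simp_all add: partial_deriv_avg[OF test_function_foldr[OF assms]])

lemma test_function_avg:
  assumes \<phi>: "test_function \<phi>"
  shows "test_function (avg \<mu> \<phi>)"
proof -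
  have "foldr partial_deriv L (avg \<mu> \<phi>) differentiable_on UNIV" for L
    unfolding foldr_partial_deriv_avg[OF \<phi>]
    using avg_has_derivative[OF test_function_foldr[OF \<phi>]]
    by (auto simp: differentiable_on_def differentiable_def)
  then have "smooth (avg \<mu> \<phi>)"
    by (simp add: smooth_def)
  moreover obtain S where "\<And>x. S < norm x \<Longrightarrow> avg \<mu> \<phi> x = 0"
    using bump_likeE[OF avg_bump_like[OF bump_like_test[OF \<phi>]]] by metis
  then have "{x. avg \<mu> \<phi> x \<noteq> 0} \<subseteq> cball 0 S"
    by (auto simp: not_less[symmetric])
  then have "bounded {x. avg \<mu> \<phi> x \<noteq> 0}"
    by (rule bounded_subset[OF bounded_cball])
  ultimately show ?thesis
    by (simp add: test_function_def)
qed

lemma classical_D_avg: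
  "test_function \<phi> \<Longrightarrow> classical_D \<beta> (avg \<mu> \<phi>) = avg \<mu> (classical_D \<beta> \<phi>)"
  unfolding classical_D_def by (rule foldr_partial_deriv_avg)

lemma avg_Lp:
  assumes p: "1 \<le> p" and [measurable]: "f \<in> borel_measurable borel" and f: "f \<in> Lp_space p"
  shows "avg \<mu> f \<in> Lp_space p" "Lp_norm p (avg \<mu> f) \<le> Lp_norm p f"
proof -
  have m: "case_prod (\<lambda>x y. f (x + y)) \<in> borel_measurable (lborel \<Otimes>\<^sub>M \<mu>)"
    by measurable
  have "AE y in \<mu>. (\<lambda>x. f (x + y)) \<in> Lp_space p \<and> Lp_norm p (\<lambda>x. f (x + y)) \<le> Lp_norm p f"
    using Lp_translate[OF f] p by simp
  from Lp_average[OF law_prob p m Lp_norm_nonneg this]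
  show "avg \<mu> f \<in> Lp_space p" "Lp_norm p (avg \<mu> f) \<le> Lp_norm p f"
    by (simp_all add: avg_def[abs_def])
qed

text \<open>Fubini's theorem with the translation of \<open>x\<close> by \<open>y\<close> in
  between. Absolute integrability on the product follows from
  \<open>\<bar>f\<bar> \<le> 1 + \<bar>f\<bar> powr p\<close> on the bounded support of
  \<open>\<phi>\<close>.\<close>

lemma avg_duality:
  assumes p: "1 \<le> p" and [measurable]: "f \<in> borel_measurable borel" and f: "f \<in> Lp_space p"
    and \<phi>: "bump_like \<phi>"
  shows "(LINT x|lborel. avg \<mu> f x * \<phi> x) = (LINT x|lborel. f x * (LINT y|\<mu>. \<phi> (x - y)))"
proof -
  interpret P: pair_sigma_finite lborel \<mu> ..
  obtain K S where [measurable]: "\<phi> \<in> borel_measurable borel" and K: "0 \<le> K" "0 \<le> S"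
    "\<And>x. \<bar>\<phi> x\<bar> \<le> K" "\<And>x. \<bar>\<phi> x\<bar> \<le> K * indicator (cball 0 S) x"
    using bump_likeE[OF \<phi>] by metis
  note le = abs_le_one_plus_powr[OF p]
  have bd: "norm (f (x + y) * \<phi> x) \<le> K * indicator (cball 0 S) x + K * \<bar>f (x + y)\<bar> powr p" for x y
  proof -
    have "norm (f (x + y) * \<phi> x) \<le> (1 + \<bar>f (x + y)\<bar> powr p) * \<bar>\<phi> x\<bar>"
      using le by (simp add: abs_mult mult_right_mono)
    also have "\<dots> = \<bar>\<phi> x\<bar> + \<bar>f (x + y)\<bar> powr p * \<bar>\<phi> x\<bar>"
      by (simp add: algebra_simps)
    also have "\<dots> \<le> K * indicator (cball 0 S) x + \<bar>f (x + y)\<bar> powr p * K"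
      by (intro add_mono K mult_left_mono) simp
    finally show ?thesis by (simp add: mult.commute)
  qed
  have fnn: "(\<integral>\<^sup>+x. ennreal (\<bar>f (x + y)\<bar> powr p) \<partial>lborel) = ennreal (Lp_norm p f powr p)" for y
    using nn_integral_lborel_translate[of "\<lambda>x. ennreal (\<bar>f x\<bar> powr p)" y] nn_integral_Lp_norm[OF f] p
    by (simp add: nn_integral_completion)
  have int: "integrable (lborel \<Otimes>\<^sub>M \<mu>) (\<lambda>(x, y). f (x + y) * \<phi> x)"
  proof (rule integrableI_bounded)
    show "(\<lambda>(x, y). f (x + y) * \<phi> x) \<in> borel_measurable (lborel \<Otimes>\<^sub>M \<mu>)" by measurable
    have "(\<integral>\<^sup>+z. ennreal (norm (case z of (x, y) \<Rightarrow> f (x + y) * \<phi> x)) \<partial>(lborel \<Otimes>\<^sub>M \<mu>))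
        = (\<integral>\<^sup>+y. (\<integral>\<^sup>+x. ennreal (norm (f (x + y) * \<phi> x)) \<partial>lborel) \<partial>\<mu>)"
      by (subst P.nn_integral_snd[symmetric]) (simp_all, measurable)
    also have "\<dots> \<le> (\<integral>\<^sup>+y. (\<integral>\<^sup>+x. (ennreal (K * indicator (cball (0::real^'d) S) x) + ennreal K * ennreal (\<bar>f (x + y)\<bar> powr p)) \<partial>lborel) \<partial>\<mu>)"
    proof (intro nn_integral_mono)
      fix x y
      show "ennreal (norm (f (x + y) * \<phi> x))
          \<le> ennreal (K * indicator (cball (0::real^'d) S) x) + ennreal K * ennreal (\<bar>f (x + y)\<bar> powr p)"
        using ennreal_leI[OF bd[of x y]] K(1) by (simp add: ennreal_mult[symmetric] ennreal_plus[symmetric] del: ennreal_plus)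
    qed
    also have "\<dots> = (\<integral>\<^sup>+y. (\<integral>\<^sup>+x. ennreal (K * indicator (cball (0::real^'d) S) x) \<partial>lborel) + ennreal K * ennreal (Lp_norm p f powr p) \<partial>\<mu>)"
    proof (rule nn_integral_cong)
      fix y
      show "(\<integral>\<^sup>+x. (ennreal (K * indicator (cball (0::real^'d) S) x) + ennreal K * ennreal (\<bar>f (x + y)\<bar> powr p)) \<partial>lborel)
          = (\<integral>\<^sup>+x. ennreal (K * indicator (cball (0::real^'d) S) x) \<partial>lborel) + ennreal K * ennreal (Lp_norm p f powr p)"
      proof -
        have m1: "(\<lambda>x. ennreal (K * indicator (cball (0::real^'d) S) x)) \<in> borel_measurable lborel"
          by (intro measurable_compose[OF _ measurable_ennreal] borel_measurable_times
              borel_measurable_const borel_measurable_indicator) simp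
        have m2: "(\<lambda>x. ennreal (\<bar>f (x + y)\<bar> powr p)) \<in> borel_measurable lborel"
          by measurable
        show ?thesis
          using m1 m2 by (simp add: nn_integral_add nn_integral_cmult fnn)
      qed
    qed
    also have "\<dots> = (\<integral>\<^sup>+x. ennreal (K * indicator (cball (0::real^'d) S) x) \<partial>lborel) + ennreal K * ennreal (Lp_norm p f powr p)"
      by (simp add: emeasure_space_1)
    also have "(\<integral>\<^sup>+x. ennreal (K * indicator (cball (0::real^'d) S) x) \<partial>lborel) = ennreal K * emeasure lborel (cball (0::real^'d) S)"
      using K by (simp add: ennreal_mult' nn_integral_cmult_indicator ennreal_indicator)
    finally show "(\<integral>\<^sup>+z. ennreal (norm (case z of (x, y) \<Rightarrow> f (x + y) * \<phi> x)) \<partial>(lborel \<Otimes>\<^sub>M \<mu>)) < \<infinity>"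
      using emeasure_lborel_cball_finite[of "0::real^'d" S]
      by (elim order.strict_trans1) (auto simp: ennreal_mult_less_top)
  qed
  have "(LINT x|lborel. avg \<mu> f x * \<phi> x) = (LINT x|lborel. (LINT y|\<mu>. f (x + y) * \<phi> x))"
    by (simp add: avg_def)
  also have "\<dots> = (LINT y|\<mu>. (LINT x|lborel. f (x + y) * \<phi> x))"
    using P.Fubini_integral[OF int] by simp
  also have "\<dots> = (LINT y|\<mu>. (LINT x|lborel. f x * \<phi> (x - y)))"
  proof (rule Bochner_Integration.integral_cong)
    fix y
    show "(LINT x|lborel. f (x + y) * \<phi> x) = (LINT x|lborel. f x * \<phi> (x - y))"
      using integral_lborel_translate[of "\<lambda>x. f x * \<phi> (x - y)" y] by simp
  qed simp
  also have "\<dots> = (LINT x|lborel. (LINT y|\<mu>. f x * \<phi> (x - y)))"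
  proof (rule P.Fubini_integral)
    \<comment> \<open>For fixed \<open>y\<close> a translation in \<open>x\<close> turns the
      absolute integral into the one already shown to be finite.\<close>
    have "integrable (lborel \<Otimes>\<^sub>M \<mu>) (\<lambda>(x, y). f x * \<phi> (x - y))"
    proof (rule integrableI_bounded)
      show "(\<lambda>(x, y). f x * \<phi> (x - y)) \<in> borel_measurable (lborel \<Otimes>\<^sub>M \<mu>)" by measurable
      have "(\<integral>\<^sup>+z. ennreal (norm (case z of (x, y) \<Rightarrow> f x * \<phi> (x - y))) \<partial>(lborel \<Otimes>\<^sub>M \<mu>))
          = (\<integral>\<^sup>+y. (\<integral>\<^sup>+x. ennreal (norm (f x * \<phi> (x - y))) \<partial>lborel) \<partial>\<mu>)"
        by (subst P.nn_integral_snd[symmetric]) (simp_all, measurable)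
      also have "\<dots> = (\<integral>\<^sup>+y. (\<integral>\<^sup>+x. ennreal (norm (f (x + y) * \<phi> x)) \<partial>lborel) \<partial>\<mu>)"
      proof (rule nn_integral_cong)
        fix y
        show "(\<integral>\<^sup>+x. ennreal (norm (f x * \<phi> (x - y))) \<partial>lborel) = (\<integral>\<^sup>+x. ennreal (norm (f (x + y) * \<phi> x)) \<partial>lborel)"
          using nn_integral_lborel_translate[of "\<lambda>x. ennreal (norm (f x * \<phi> (x - y)))" y] by simp
      qed
      also have "\<dots> = (\<integral>\<^sup>+z. ennreal (norm (case z of (x, y) \<Rightarrow> f (x + y) * \<phi> x)) \<partial>(lborel \<Otimes>\<^sub>M \<mu>))"
        by (subst P.nn_integral_snd[symmetric]) (simp_all, measurable)
      also have "\<dots> < \<infinity>"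
        using int by (simp add: integrable_iff_bounded)
      finally show "(\<integral>\<^sup>+z. ennreal (norm (case z of (x, y) \<Rightarrow> f x * \<phi> (x - y))) \<partial>(lborel \<Otimes>\<^sub>M \<mu>)) < \<infinity>" .
    qed
    then show "integrable (lborel \<Otimes>\<^sub>M \<mu>) (case_prod (\<lambda>x y. f x * \<phi> (x - y)))" by simp
  qed
  finally show ?thesis by simp
qed

end

section \<open>Random combinations of vectors and iterated differences\<close>

lemma borel_measurable_pair_cong:
  assumes "sets M = sets borel" "sets N = sets borel" "f \<in> borel_measurable (borel \<Otimes>\<^sub>M borel)"
  shows "f \<in> borel_measurable (M \<Otimes>\<^sub>M N)"
  using assms measurable_cong_sets[OF sets_pair_measure_cong refl] by blast

definition unif :: "real measure" where
  "unif = density lborel (\<lambda>t. ennreal (indicator {0..1} t))"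

lemma unif_sets [simp, measurable_cong]: "sets unif = sets borel"
  by (simp add: unif_def)

lemma unif_space [simp]: "space unif = UNIV"
  by (simp add: unif_def)

lemma unif_prob: "prob_space unif"
  by (rule prob_spaceI) (simp add: unif_def emeasure_density ennreal_indicator)

lemma unif_AE: "AE t in unif. 0 \<le> t \<and> t \<le> 1"
  unfolding unif_def by (subst AE_density) (auto simp: ennreal_indicator indicator_def)

lemma unif_integral:
  fixes g :: "real \<Rightarrow> real"
  assumes "g \<in> borel_measurable borel"
  shows "(LINT t|unif. g t) = (LINT t:{0..1}|lborel. g t)"
  unfolding unif_def set_lebesgue_integral_def using assms by (subst integral_density) auto

text \<open>The distribution of \<open>\<Sum>k t\<^sub>k v\<^sub>k\<close>, where the \<open>t\<^sub>k\<close> are independent and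
  uniformly distributed on the unit interval.\<close>

primrec law :: "(real^'d::finite) list \<Rightarrow> (real^'d) measure" where
  "law [] = return borel 0"
| "law (v # vs) = distr (unif \<Otimes>\<^sub>M law vs) borel (\<lambda>(t, y). t *\<^sub>R v + y)"

lemma sets_law [simp, measurable_cong]: "sets (law vs) = sets borel"
  by (cases vs) auto

lemma space_law [simp]: "space (law vs) = UNIV"
  using sets_eq_imp_space_eq[OF sets_law[of vs]] by simp

lemma law_step_measurable: "(\<lambda>(t, y). t *\<^sub>R v + y) \<in> borel_measurable (unif \<Otimes>\<^sub>M law vs)"
  by (rule borel_measurable_pair_cong[OF unif_sets sets_law]) measurable

lemma bounded_law_law: "bounded_law (\<Sum>v\<leftarrow>vs. norm v) (law vs)"
proof (induction vs)
  case Nil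
  then show ?case
    by (auto simp: bounded_law_def prob_space_return AE_return)
next
  case (Cons v vs)
  then interpret l: prob_space "law vs" by (simp add: bounded_law_def)
  interpret u: prob_space unif by (rule unif_prob)
  interpret P: pair_prob_space unif "law vs" ..
  note m = law_step_measurable
  have "AE z in unif \<Otimes>\<^sub>M law vs. norm (case z of (t, y) \<Rightarrow> t *\<^sub>R v + y) \<le> norm v + (\<Sum>v\<leftarrow>vs. norm v)"
  proof (rule P.AE_pair_measure)
    show "{z \<in> space (unif \<Otimes>\<^sub>M law vs). norm (case z of (t, y) \<Rightarrow> t *\<^sub>R v + y) \<le> norm v + (\<Sum>v\<leftarrow>vs. norm v)} \<in> sets (unif \<Otimes>\<^sub>M law vs)"
      using measurable_sets[OF measurable_compose[OF m borel_measurable_norm], of "{..norm v + (\<Sum>v\<leftarrow>vs. norm v)}"]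
      by (simp add: vimage_def Int_def conj_commute)
    show "AE t in unif. AE y in law vs. norm (case (t, y) of (t, y) \<Rightarrow> t *\<^sub>R v + y) \<le> norm v + (\<Sum>v\<leftarrow>vs. norm v)"
      using unif_AE
    proof eventually_elim
      case (elim t)
      have tv: "norm (t *\<^sub>R v) \<le> norm v"
        using elim by (simp add: mult_left_le_one_le)
      have "AE y in law vs. norm y \<le> (\<Sum>v\<leftarrow>vs. norm v)"
        using Cons by (simp add: bounded_law_def)
      then show ?case
        by eventually_elim (use norm_triangle_mono[OF tv] in simp)
    qed
  qed
  then show ?case
    unfolding bounded_law_def law.simps
    by (intro conjI P.prob_space_distr) (auto simp: AE_distr_iff[OF m] m)
qed

definition bdd_borel :: "(real^'d::finite \<Rightarrow> real) \<Rightarrow> bool" where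
  "bdd_borel \<phi> \<longleftrightarrow> \<phi> \<in> borel_measurable borel \<and> (\<exists>K. \<forall>x. \<bar>\<phi> x\<bar> \<le> K)"

lemma bdd_borel_measurable [measurable_dest]: "bdd_borel \<phi> \<Longrightarrow> \<phi> \<in> borel_measurable borel"
  by (simp add: bdd_borel_def)

lemma bdd_borel_bump_like: "bump_like \<phi> \<Longrightarrow> bdd_borel \<phi>"
  unfolding bdd_borel_def using bump_likeE by metis

lemma bdd_borel_test: "test_function \<phi> \<Longrightarrow> bdd_borel \<phi>"
  by (intro bdd_borel_bump_like bump_like_test)

definition seg :: "real^'d::finite \<Rightarrow> (real^'d \<Rightarrow> real) \<Rightarrow> real^'d \<Rightarrow> real" where
  "seg v \<phi> x = (LINT t|unif. \<phi> (x + t *\<^sub>R v))"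

lemma bdd_borel_integral:
  fixes g :: "real^'d::finite \<Rightarrow> 'w \<Rightarrow> real^'d"
  assumes \<phi>: "bdd_borel \<phi>" and M: "prob_space M" and g [measurable]: "case_prod g \<in> borel_measurable (borel \<Otimes>\<^sub>M M)"
  shows "bdd_borel (\<lambda>x. LINT w|M. \<phi> (g x w))" "integrable M (\<lambda>w. \<phi> (g x w))"
proof -
  interpret prob_space M by (rule M)
  obtain K where K: "\<And>x. \<bar>\<phi> x\<bar> \<le> K"
    using \<phi> by (auto simp: bdd_borel_def)
  note [measurable] = bdd_borel_measurable[OF \<phi>]
  have i: "integrable M (\<lambda>w. \<phi> (g x w))" for x
    by (rule integrable_const_bound[of _ K]) (use K in auto)
  have "\<bar>LINT w|M. \<phi> (g x w)\<bar> \<le> K" for x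
  proof -
    have "\<bar>LINT w|M. \<phi> (g x w)\<bar> \<le> (LINT w|M. \<bar>\<phi> (g x w)\<bar>)"
      by (rule integral_abs_bound)
    also have "\<dots> \<le> (LINT w|M. K)"
      using i K by (intro integral_mono) auto
    finally show ?thesis by (simp add: prob_space)
  qed
  moreover have "(\<lambda>x. LINT w|M. \<phi> (g x w)) \<in> borel_measurable borel"
    by measurable
  ultimately show "bdd_borel (\<lambda>x. LINT w|M. \<phi> (g x w))"
    by (auto simp: bdd_borel_def)
  show "integrable M (\<lambda>w. \<phi> (g x w))" by (rule i)
qed

lemma bdd_borel_seg:
  assumes "bdd_borel \<phi>"
  shows "bdd_borel (seg v \<phi>)"
proof -
  have "(\<lambda>(x, t). x + t *\<^sub>R v) \<in> borel_measurable (borel \<Otimes>\<^sub>M (borel :: real measure))"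
    by measurable
  then have "(\<lambda>(x, t). x + t *\<^sub>R v) \<in> borel_measurable (borel \<Otimes>\<^sub>M unif)"
    by (rule borel_measurable_pair_cong[OF refl unif_sets])
  from bdd_borel_integral(1)[OF assms unif_prob this]
  show "bdd_borel (seg v \<phi>)"
    by (simp add: seg_def[abs_def])
qed

lemma avg_law_Cons:
  assumes \<phi>: "bdd_borel \<phi>"
  shows "avg (law (v # vs)) \<phi> = avg (law vs) (seg v \<phi>)"
proof
  fix x
  interpret l: prob_space "law vs" using bounded_law_law by (auto simp: bounded_law_def)
  interpret u: prob_space unif by (rule unif_prob)
  interpret P: pair_prob_space unif "law vs" ..
  obtain K where K: "\<And>x. \<bar>\<phi> x\<bar> \<le> K"
    using \<phi> by (auto simp: bdd_borel_def)
  note [measurable] = bdd_borel_measurable[OF \<phi>]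
  have int: "integrable (unif \<Otimes>\<^sub>M law vs) (\<lambda>(t, y). \<phi> (x + (t *\<^sub>R v + y)))"
  proof (rule P.integrable_const_bound[of _ K])
    show "(\<lambda>(t, y). \<phi> (x + (t *\<^sub>R v + y))) \<in> borel_measurable (unif \<Otimes>\<^sub>M law vs)"
      by (rule borel_measurable_pair_cong[OF unif_sets sets_law]) measurable
  qed (use K in auto)
  have "avg (law (v # vs)) \<phi> x = (LINT z|(unif \<Otimes>\<^sub>M law vs). \<phi> (x + (case z of (t, y) \<Rightarrow> t *\<^sub>R v + y)))"
    unfolding avg_def law.simps by (subst integral_distr[OF law_step_measurable]) auto
  also have "\<dots> = (LINT z|(unif \<Otimes>\<^sub>M law vs). (case z of (t, y) \<Rightarrow> \<phi> (x + (t *\<^sub>R v + y))))"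
    by (simp add: split_def)
  also have "\<dots> = (LINT y|law vs. (LINT t|unif. \<phi> (x + (t *\<^sub>R v + y))))"
    using P.integral_snd[of "\<lambda>t y. \<phi> (x + (t *\<^sub>R v + y))"] int by simp
  also have "\<dots> = avg (law vs) (seg v \<phi>) x"
    by (simp add: avg_def seg_def add_ac)
  finally show "avg (law (v # vs)) \<phi> x = avg (law vs) (seg v \<phi>) x" .
qed

text \<open>Replaces a measure built from products by iterated one-dimensional averages. Since these
  commute, concatenating and permuting the vectors become list inductions.\<close>

lemma avg_law_eq_fold_seg:
  "bdd_borel \<phi> \<Longrightarrow> avg (law vs) \<phi> = fold seg vs \<phi>"
proof (induction vs arbitrary: \<phi>)
  case Nil
  then show ?case
    by (auto simp: avg_def[abs_def] integral_return bdd_borel_def)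
next
  case (Cons v vs)
  then show ?case
    using avg_law_Cons[of \<phi> v vs] bdd_borel_seg[of \<phi> v] by simp
qed

lemma bdd_borel_fold_seg: "bdd_borel \<phi> \<Longrightarrow> bdd_borel (fold seg vs \<phi>)"
  by (induction vs arbitrary: \<phi>) (auto simp: bdd_borel_seg)

lemma avg_law_append:
  "bdd_borel \<phi> \<Longrightarrow> avg (law (us @ vs)) \<phi> = avg (law vs) (avg (law us) \<phi>)"
  by (simp add: avg_law_eq_fold_seg bdd_borel_fold_seg)

lemma seg_commute:
  assumes \<phi>: "bdd_borel \<phi>"
  shows "seg v (seg w \<phi>) = seg w (seg v \<phi>)"
proof
  fix x
  interpret u: prob_space unif by (rule unif_prob)
  interpret P: pair_prob_space unif unif ..
  obtain K where K: "\<And>x. \<bar>\<phi> x\<bar> \<le> K"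
    using \<phi> by (auto simp: bdd_borel_def)
  note [measurable] = bdd_borel_measurable[OF \<phi>]
  have int: "integrable (unif \<Otimes>\<^sub>M unif) (\<lambda>(t, y). \<phi> (x + t *\<^sub>R v + y *\<^sub>R w))"
  proof (rule P.integrable_const_bound[of _ K])
    show "(\<lambda>(t, y). \<phi> (x + t *\<^sub>R v + y *\<^sub>R w)) \<in> borel_measurable (unif \<Otimes>\<^sub>M unif)"
      by measurable
  qed (use K in auto)
  show "seg v (seg w \<phi>) x = seg w (seg v \<phi>) x"
    using P.Fubini_integral[of "\<lambda>t y. \<phi> (x + t *\<^sub>R v + y *\<^sub>R w)"] int
    by (simp add: seg_def add_ac)
qed

lemma fold_seg_seg: "bdd_borel \<phi> \<Longrightarrow> fold seg vs (seg w \<phi>) = seg w (fold seg vs \<phi>)"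
  by (induction vs arbitrary: \<phi>) (simp_all add: seg_commute[of _ _ w] bdd_borel_seg)

lemma fold_seg_perm:
  "mset vs = mset ws \<Longrightarrow> bdd_borel \<phi> \<Longrightarrow> fold seg vs \<phi> = fold seg ws \<phi>"
proof (induction vs arbitrary: ws \<phi>)
  case (Cons v vs)
  then have "v \<in> set ws"
    by (metis list.set_intros(1) set_mset_mset)
  then obtain a b where ws: "ws = a @ v # b"
    by (meson split_list)
  with Cons.prems have "mset vs = mset (a @ b)" by simp
  then have "fold seg vs (seg v \<phi>) = fold seg (a @ b) (seg v \<phi>)"
    using Cons.IH bdd_borel_seg[OF Cons.prems(2)] by blast
  then show ?case
    using Cons.prems(2) by (simp add: ws fold_seg_seg)
qed simp

lemma avg_law_perm:
  "mset vs = mset ws \<Longrightarrow> bdd_borel \<phi> \<Longrightarrow> avg (law vs) \<phi> = avg (law ws) \<phi>"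
  using fold_seg_perm[of vs ws \<phi>] by (simp only: avg_law_eq_fold_seg)

text \<open>Averaging along \<open>v\<close> before scaling by \<open>k\<close> is averaging along
  \<open>k *\<^sub>R v\<close> after it. The value \<open>-1\<close> serves the duality, which
  reflects the measure; positive integers serve the Steklov means.\<close>

lemma avg_law_scale:
  assumes "bdd_borel \<phi>"
  shows "(LINT y|law vs. \<phi> (x + k *\<^sub>R y)) = avg (law (map ((*\<^sub>R) k) vs)) \<phi> x"
proof -
  have bb: "bdd_borel (\<lambda>z. \<psi> (x + k *\<^sub>R z))" if "bdd_borel \<psi>" for \<psi>
    using that unfolding bdd_borel_def by auto
  have "fold seg vs (\<lambda>z. \<psi> (x + k *\<^sub>R z)) w = fold seg (map ((*\<^sub>R) k) vs) \<psi> (x + k *\<^sub>R w)"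
    if "bdd_borel \<psi>" for \<psi> w
    using that
  proof (induction vs arbitrary: \<psi>)
    case (Cons v vs)
    have "seg v (\<lambda>z. \<psi> (x + k *\<^sub>R z)) = (\<lambda>z. seg (k *\<^sub>R v) \<psi> (x + k *\<^sub>R z))"
      by (rule ext) (simp add: seg_def scaleR_add_right add_ac mult.commute)
    then show ?case
      using Cons.IH[OF bdd_borel_seg[OF Cons.prems]] by simp
  qed simp
  from this[OF assms, of 0] have "avg (law vs) (\<lambda>z. \<phi> (x + k *\<^sub>R z)) 0 = avg (law (map ((*\<^sub>R) k) vs)) \<phi> x"
    using assms bb by (simp add: avg_law_eq_fold_seg)
  then show ?thesis by (simp add: avg_def)
qed

lemma avg_law_reflect:
  assumes "bdd_borel \<phi>"
  shows "(LINT y|law vs. \<phi> (x - y)) = avg (law (map uminus vs)) \<phi> x"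
proof -
  have "((*\<^sub>R) (-1)) = (uminus :: real^'a \<Rightarrow> real^'a)" by auto
  then show ?thesis
    using avg_law_scale[OF assms, of vs x "-1"] by simp
qed

section \<open>Iterated differences\<close>

definition diff_op :: "real^'d::finite \<Rightarrow> (real^'d \<Rightarrow> real) \<Rightarrow> real^'d \<Rightarrow> real" where
  "diff_op v f x = f (x + v) - f x"

definition mdiff :: "(real^'d::finite) list \<Rightarrow> (real^'d \<Rightarrow> real) \<Rightarrow> real^'d \<Rightarrow> real" where
  "mdiff = fold diff_op"

lemma mdiff_Nil [simp]: "mdiff [] f = f"
  by (simp add: mdiff_def)

lemma mdiff_Cons [simp]: "mdiff (v # vs) f = mdiff vs (diff_op v f)"
  by (simp add: mdiff_def)

lemma mdiff_append: "mdiff (us @ vs) f = mdiff vs (mdiff us f)"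
  by (simp add: mdiff_def)

lemma diff_op_commute: "diff_op v (diff_op w f) = diff_op w (diff_op v f)"
  by (rule ext) (simp add: diff_op_def algebra_simps)

lemma mdiff_diff_op: "mdiff vs (diff_op w f) = diff_op w (mdiff vs f)"
  by (induction vs arbitrary: f) (simp_all add: diff_op_commute[of _ w])

lemma mdiff_perm: "mset vs = mset ws \<Longrightarrow> mdiff vs = mdiff ws"
  unfolding mdiff_def by (rule fold_multiset_equiv) (auto simp: diff_op_commute fun_eq_iff)

lemma diff_op_Lp:
  assumes "1 \<le> p" "f \<in> Lp_space p"
  shows "diff_op v f \<in> Lp_space p" "Lp_norm p (diff_op v f) \<le> 2 * Lp_norm p f"
  using Lp_diff[OF assms(1) Lp_translate(1)[OF assms(2)] assms(2), of v]
    Lp_translate(2)[OF assms(2), of v] assms(1)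
  by (simp_all add: diff_op_def[abs_def])

lemma mdiff_Lp:
  assumes "1 \<le> p" "f \<in> Lp_space p"
  shows "mdiff vs f \<in> Lp_space p \<and> Lp_norm p (mdiff vs f) \<le> 2 ^ length vs * Lp_norm p f"
  using assms(2)
proof (induction vs arbitrary: f)
  case (Cons v vs)
  have "2 ^ length vs * Lp_norm p (diff_op v f) \<le> 2 ^ length vs * (2 * Lp_norm p f)"
    by (intro mult_left_mono diff_op_Lp(2)[OF assms(1) Cons.prems]) simp
  then show ?case
    using Cons.IH[OF diff_op_Lp(1)[OF assms(1) Cons.prems], of v]
    by (auto simp: mult.assoc mult.left_commute[of 2] intro: order_trans)
qed simp

lemma diff_op_borel [measurable]:
  assumes [measurable]: "f \<in> borel_measurable borel"
  shows "diff_op v f \<in> borel_measurable borel"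
  unfolding diff_op_def[abs_def] by measurable

lemma mdiff_borel [measurable]: "f \<in> borel_measurable borel \<Longrightarrow> mdiff vs f \<in> borel_measurable borel"
  by (induction vs arbitrary: f) auto

lemma diff_op_avg:
  assumes "bounded_law R \<mu>" "bdd_borel \<phi>"
  shows "avg \<mu> (diff_op v \<phi>) = diff_op v (avg \<mu> \<phi>)"
proof
  fix x
  obtain K where "\<phi> \<in> borel_measurable borel" "\<And>x. \<bar>\<phi> x\<bar> \<le> K"
    using assms(2) by (auto simp: bdd_borel_def)
  then have "integrable \<mu> (\<lambda>y. \<phi> (z + y))" for z
    by (rule integrable_bounded_law[OF assms(1)])
  from this[of x] this[of "x + v"] show "avg \<mu> (diff_op v \<phi>) x = diff_op v (avg \<mu> \<phi>) x"
    by (simp add: avg_def diff_op_def add_ac)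
qed

lemma bdd_borel_diff_op:
  assumes "bdd_borel \<phi>" shows "bdd_borel (diff_op v \<phi>)"
proof -
  obtain K where K: "\<phi> \<in> borel_measurable borel" "\<And>x. \<bar>\<phi> x\<bar> \<le> K"
    using assms by (auto simp: bdd_borel_def)
  have "\<bar>diff_op v \<phi> x\<bar> \<le> 2 * K" for x
    using K(2)[of x] K(2)[of "x + v"] by (simp add: diff_op_def)
  then show ?thesis
    using K(1) by (auto simp: bdd_borel_def)
qed

lemma bump_like_diff_op:
  assumes "bump_like \<phi>"
  shows "bump_like (diff_op v \<phi>)"
proof -
  obtain K R where K: "\<phi> \<in> borel_measurable borel" "0 \<le> K" "0 \<le> R"
    "\<And>x. \<bar>\<phi> x\<bar> \<le> K" "\<And>x. R < norm x \<Longrightarrow> \<phi> x = 0"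
    using bump_likeE[OF assms] by metis
  have "\<bar>diff_op v \<phi> x\<bar> \<le> (2 * K) * indicator (cball 0 (R + norm v)) x" for x
  proof (cases "norm x \<le> R + norm v")
    case True
    then show ?thesis using K(4)[of x] K(4)[of "x + v"] by (simp add: diff_op_def)
  next
    case False
    then have "R < norm x" "R < norm (x + v)"
      using norm_triangle_ineq4[of "x + v" v] norm_ge_zero[of v] unfolding add_diff_cancel_right' by linarith+
    then show ?thesis
      using K(2) by (simp add: diff_op_def K(5))
  qed
  then show ?thesis
    unfolding bump_like_def using K by (intro conjI exI[of _ "2 * K"] exI[of _ "R + norm v"]) auto
qed

lemma bump_like_mdiff: "bump_like \<phi> \<Longrightarrow> bump_like (mdiff vs \<phi>)"
  by (induction vs arbitrary: \<phi>) (auto simp: bump_like_diff_op)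

text \<open>The fundamental theorem of calculus for
  \<open>t \<mapsto> \<phi> (x + t *\<^sub>R axis i c)\<close> on the unit interval, for
  \<open>c\<close> of either sign.\<close>

lemma seg_partial_deriv:
  assumes \<phi>: "test_function \<phi>"
  shows "c * seg (axis i c) (partial_deriv i \<phi>) x = diff_op (axis i c) \<phi> x"
proof -
  have axis: "axis i c = c *\<^sub>R axis i (1::real)"
    by (simp add: vec_eq_iff axis_def)
  have d: "((\<lambda>t. \<phi> (x + t *\<^sub>R axis i c)) has_vector_derivative c * partial_deriv i \<phi> (x + t *\<^sub>R axis i c)) (at t within S)" for t S
  proof -
    have D: "(\<phi> has_derivative frechet_derivative \<phi> (at z)) (at z)" for z
      using \<phi> smooth_differentiable frechet_derivative_works by (auto simp: test_function_def)
    have "((\<lambda>t. x + t *\<^sub>R axis i c) has_derivative (\<lambda>h. h *\<^sub>R axis i c)) (at t within S)"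
      by (auto intro!: derivative_eq_intros)
    from has_derivative_compose[OF this D]
    have "((\<lambda>t. \<phi> (x + t *\<^sub>R axis i c)) has_derivative
        (\<lambda>h. frechet_derivative \<phi> (at (x + t *\<^sub>R axis i c)) (h *\<^sub>R axis i c))) (at t within S)" .
    moreover have "frechet_derivative \<phi> (at z) (h *\<^sub>R axis i c) = h *\<^sub>R (c * partial_deriv i \<phi> z)" for z h
      using linear_scale[OF has_derivative_linear[OF D], of z] by (simp add: axis partial_deriv_def)
    ultimately show ?thesis
      by (simp add: has_vector_derivative_def)
  qed
  have "continuous_on {0..1} (\<lambda>t. partial_deriv i \<phi> (x + t *\<^sub>R axis i c))"
    by (rule continuous_on_compose2[OF test_function_continuous[OF test_function_partial_deriv[OF \<phi>]]])
       (intro continuous_on_add continuous_on_scaleR continuous_on_const continuous_on_id, simp)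
  then have cont: "continuous_on {0..1} (\<lambda>t. c * partial_deriv i \<phi> (x + t *\<^sub>R axis i c))"
    by (rule continuous_on_mult_left)
  have m [measurable]: "partial_deriv i \<phi> \<in> borel_measurable borel"
    using \<phi> by (intro test_function_borel test_function_partial_deriv)
  have "c * seg (axis i c) (partial_deriv i \<phi>) x = (LINT t|unif. c * partial_deriv i \<phi> (x + t *\<^sub>R axis i c))"
    by (simp add: seg_def)
  also have "\<dots> = (LINT t:{0..1}|lborel. c * partial_deriv i \<phi> (x + t *\<^sub>R axis i c))"
    by (rule unif_integral) measurable
  also have "\<dots> = \<phi> (x + 1 *\<^sub>R axis i c) - \<phi> (x + 0 *\<^sub>R axis i c)"
    unfolding set_lebesgue_integral_def
    by (rule integral_FTC_atLeastAtMost[OF _ d cont]) simp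
  finally show ?thesis by (simp add: diff_op_def)
qed

text \<open>Each further difference becomes \<open>c i\<close> times a segment average of a further
  partial derivative; the factors collect in the product and the segments in \<open>law\<close>.
  Indices may repeat in \<open>L\<close>, so all derivatives of higher order are covered.\<close>

lemma mdiff_eq_avg_partial_derivs:
  assumes \<phi>: "test_function \<phi>"
  shows "mdiff (map (\<lambda>i. axis i (c i)) L) \<phi> =
    (\<lambda>x. (\<Prod>i\<leftarrow>L. c i) * avg (law (map (\<lambda>i. axis i (c i)) L)) (foldr partial_deriv L \<phi>) x)"
proof (induction L)
  case Nil
  then show ?case
    using bdd_borel_test[OF \<phi>] by (simp add: avg_law_eq_fold_seg del: law.simps)
next
  case (Cons i L)
  let ?vs = "map (\<lambda>i. axis i (c i)) L" and ?\<psi> = "foldr partial_deriv L \<phi>"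
  have \<psi>: "test_function ?\<psi>" by (rule test_function_foldr[OF \<phi>])
  have "mdiff (map (\<lambda>i. axis i (c i)) (i # L)) \<phi> = diff_op (axis i (c i)) (mdiff ?vs \<phi>)"
    by (simp add: mdiff_diff_op)
  also have "\<dots> = (\<lambda>x. (\<Prod>i\<leftarrow>L. c i) * diff_op (axis i (c i)) (avg (law ?vs) ?\<psi>) x)"
    unfolding Cons by (rule ext) (simp add: diff_op_def algebra_simps)
  also have "\<dots> = (\<lambda>x. (\<Prod>i\<leftarrow>L. c i) * avg (law ?vs) (diff_op (axis i (c i)) ?\<psi>) x)"
    by (simp add: diff_op_avg[OF bounded_law_law bdd_borel_test[OF \<psi>]])
  also have "\<dots> = (\<lambda>x. (\<Prod>i\<leftarrow>L. c i) * avg (law ?vs) (\<lambda>x. c i * seg (axis i (c i)) (partial_deriv i ?\<psi>) x) x)"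
    by (simp only: seg_partial_deriv[OF \<psi>])
  also have "\<dots> = (\<lambda>x. (\<Prod>i\<leftarrow>(i # L). c i) * avg (law ?vs) (seg (axis i (c i)) (partial_deriv i ?\<psi>)) x)"
    by (simp add: avg_def mult_ac)
  also have "\<dots> = (\<lambda>x. (\<Prod>i\<leftarrow>(i # L). c i) * avg (law (axis i (c i) # ?vs)) (partial_deriv i ?\<psi>) x)"
    by (subst avg_law_Cons[OF bdd_borel_test[OF test_function_partial_deriv[OF \<psi>]]]) simp
  finally show ?case by (simp del: law.simps)
qed

section \<open>Duality for differences and averages\<close>

lemma integrable_Lp_bump_like:
  fixes f :: "real^'d::finite \<Rightarrow> real"
  assumes p: "1 \<le> p" and fm [measurable]: "f \<in> borel_measurable borel" and f: "f \<in> Lp_space p"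
    and \<phi>: "bump_like \<phi>"
  shows "integrable lborel (\<lambda>x. f x * \<phi> x)"
proof -
  obtain K S where \<phi>m: "\<phi> \<in> borel_measurable borel" and K: "0 \<le> K"
    "\<And>x. \<bar>\<phi> x\<bar> \<le> K * indicator (cball 0 S) x"
    using bump_likeE[OF \<phi>] by metis
  have [measurable]: "cball (0::real^'d) S \<in> sets borel" by simp
  have "set_integrable lebesgue (cball 0 S) f"
    using Lp_locally_integrable[OF f p] by (auto simp: locally_integrable_def)
  then have "integrable lborel (\<lambda>x. indicator (cball 0 S) x *\<^sub>R f x)"
    unfolding set_integrable_def by (subst (asm) integrable_lebesgue_lborel) measurable
  then have "integrable lborel (\<lambda>x. K * (indicator (cball 0 S) x *\<^sub>R f x))" by simp
  then show ?thesis
  proof (rule Bochner_Integration.integrable_bound)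
    show "AE x in lborel. norm (f x * \<phi> x) \<le> norm (K * (indicator (cball 0 S) x *\<^sub>R f x))"
    proof (rule AE_I2)
      fix x
      show "norm (f x * \<phi> x) \<le> norm (K * (indicator (cball 0 S) x *\<^sub>R f x))"
        using mult_left_mono[OF K(2)[of x], of "\<bar>f x\<bar>"] K(1) by (simp add: abs_mult mult_ac)
    qed
  qed (use fm \<phi>m in simp)
qed

text \<open>Summation by parts: translating the integral by \<open>v\<close> moves each difference
  to \<open>\<phi>\<close>. No sign appears because the difference with step \<open>- v\<close>
  already carries it.\<close>

lemma mdiff_duality:
  assumes p: "1 \<le> p" and "f \<in> borel_measurable borel" "f \<in> Lp_space p" and \<phi>: "bump_like \<phi>"
  shows "(LINT x|lborel. mdiff vs f x * \<phi> x) = (LINT x|lborel. f x * mdiff (map uminus vs) \<phi> x)"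
  using assms(2,3)
proof (induction vs arbitrary: f)
  case (Cons v vs)
  let ?\<psi> = "mdiff (map uminus vs) \<phi>"
  note [measurable] = Cons.prems(1)
  have \<psi>: "bump_like ?\<psi>" using \<phi> by (rule bump_like_mdiff)
  then have [measurable]: "?\<psi> \<in> borel_measurable borel" by (simp add: bump_like_def)
  have fv: "(\<lambda>x. f (x + v)) \<in> Lp_space p"
    using Lp_translate(1)[OF Cons.prems(2)] p by simp
  have i: "integrable lborel (\<lambda>x. f x * ?\<psi> x)" "integrable lborel (\<lambda>x. f (x + v) * ?\<psi> x)"
      "integrable lborel (\<lambda>x. f x * diff_op (- v) ?\<psi> x)"
    using Cons.prems fv \<psi> p by (auto intro!: integrable_Lp_bump_like[OF p] bump_like_diff_op)
  have i2: "integrable lborel (\<lambda>x. f x * ?\<psi> (x - v))"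
    using Bochner_Integration.integrable_add[OF i(1,3)] by (simp add: diff_op_def algebra_simps)
  have "(LINT x|lborel. mdiff (v # vs) f x * \<phi> x) = (LINT x|lborel. diff_op v f x * ?\<psi> x)"
    using Cons.IH[of "diff_op v f"] diff_op_Lp[OF p Cons.prems(2)] by simp
  also have "\<dots> = (LINT x|lborel. f (x + v) * ?\<psi> x) - (LINT x|lborel. f x * ?\<psi> x)"
    using i by (simp add: diff_op_def left_diff_distrib)
  also have "(LINT x|lborel. f (x + v) * ?\<psi> x) = (LINT x|lborel. f x * ?\<psi> (x - v))"
    using integral_lborel_translate[of "\<lambda>x. f x * ?\<psi> (x - v)" v] by simp
  also have "(LINT x|lborel. f x * ?\<psi> (x - v)) - (LINT x|lborel. f x * ?\<psi> x) = (LINT x|lborel. f x * diff_op (- v) ?\<psi> x)"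
    using i i2 by (simp add: diff_op_def right_diff_distrib)
  finally show ?case by (simp add: mdiff_diff_op)
qed simp

lemma avg_law_duality:
  assumes p: "1 \<le> p" and f: "f \<in> borel_measurable borel" "f \<in> Lp_space p" and \<phi>: "bump_like \<phi>"
  shows "(LINT x|lborel. avg (law vs) f x * \<phi> x) = (LINT x|lborel. f x * avg (law (map uminus vs)) \<phi> x)"
  using avg_duality[OF bounded_law_law p f \<phi>, of vs] avg_law_reflect[OF bdd_borel_bump_like[OF \<phi>]]
  by simp

section \<open>Differences of weakly differentiable functions\<close>

lemma mdiff_cong_AE:
  assumes "AE x in lebesgue. f x = g x"
  shows "AE x in lebesgue. mdiff vs f x = mdiff vs g x"
  using assms
proof (induction vs arbitrary: f g)
  case (Cons v vs)
  have "AE x in lebesgue. diff_op v f x = diff_op v g x"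
    using Cons.prems AE_lebesgue_translate[OF Cons.prems, of v]
    by eventually_elim (simp add: diff_op_def)
  then show ?case
    using Cons.IH by simp
qed simp

lemma is_weak_deriv_cong_AE:
  assumes w: "is_weak_deriv \<beta> g h" and g: "AE x in lebesgue. g x = g' x" and h: "AE x in lebesgue. h x = h' x"
    and l: "locally_integrable g'" "locally_integrable h'"
  shows "is_weak_deriv \<beta> g' h'"
  unfolding is_weak_deriv_def
proof (intro conjI allI impI l)
  fix \<phi> :: "real^'a \<Rightarrow> real" assume \<phi>: "test_function \<phi>"
  have lg: "locally_integrable g" "locally_integrable h"
    using w by (auto simp: is_weak_deriv_def)
  have D: "test_function (classical_D \<beta> \<phi>)"
    by (rule test_function_classical_D[OF \<phi>])
  have "(LINT x|lebesgue. g' x * classical_D \<beta> \<phi> x) = (LINT x|lebesgue. g x * classical_D \<beta> \<phi> x)"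
    by (rule integral_cong_AE[OF borel_measurable_integrable[OF locally_integrable_mult_test[OF l(1) D]]
          borel_measurable_integrable[OF locally_integrable_mult_test[OF lg(1) D]]])
       (use g in eventually_elim, simp)
  moreover have "(LINT x|lebesgue. h' x * \<phi> x) = (LINT x|lebesgue. h x * \<phi> x)"
    by (rule integral_cong_AE[OF borel_measurable_integrable[OF locally_integrable_mult_test[OF l(2) \<phi>]]
          borel_measurable_integrable[OF locally_integrable_mult_test[OF lg(2) \<phi>]]])
       (use h in eventually_elim, simp)
  ultimately show "(LINT x|lebesgue. g' x * classical_D \<beta> \<phi> x) = (-1) ^ mi_abs \<beta> * (LINT x|lebesgue. h' x * \<phi> x)"
    using w \<phi> by (simp add: is_weak_deriv_def)
qed

lemma integral_mult_test_lborel: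
  assumes "g \<in> borel_measurable borel" "test_function \<phi>"
  shows "(LINT x|lebesgue. g x * \<phi> x) = (LINT x|lborel. g x * \<phi> x)"
  using assms test_function_borel by (intro integral_lebesgue_lborel borel_measurable_times) auto

lemma is_weak_derivI:
  assumes p: "1 \<le> p" and g: "g \<in> borel_measurable borel" "g \<in> Lp_space p"
    and h: "h \<in> borel_measurable borel" "h \<in> Lp_space p"
    and eq: "\<And>\<phi>. test_function \<phi> \<Longrightarrow>
      (LINT x|lborel. g x * classical_D \<beta> \<phi> x) = (-1) ^ mi_abs \<beta> * (LINT x|lborel. h x * \<phi> x)"
  shows "is_weak_deriv \<beta> g h"
  unfolding is_weak_deriv_def
  using Lp_locally_integrable[OF g(2) p] Lp_locally_integrable[OF h(2) p] eq
  by (auto simp: integral_mult_test_lborel g h test_function_classical_D)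

lemma is_weak_derivD:
  assumes "is_weak_deriv \<beta> g h" "g \<in> borel_measurable borel" "h \<in> borel_measurable borel" "test_function \<phi>"
  shows "(LINT x|lborel. g x * classical_D \<beta> \<phi> x) = (-1) ^ mi_abs \<beta> * (LINT x|lborel. h x * \<phi> x)"
proof -
  have "(LINT x|lebesgue. g x * classical_D \<beta> \<phi> x) = (-1) ^ mi_abs \<beta> * (LINT x|lebesgue. h x * \<phi> x)"
    using assms(1,4) by (simp add: is_weak_deriv_def)
  then show ?thesis
    unfolding integral_mult_test_lborel[OF assms(2) test_function_classical_D[OF assms(4)]]
      integral_mult_test_lborel[OF assms(3,4)] .
qed

section \<open>Multi-indices as lists of coordinates\<close>

lemma ex_list_of_multi_index:
  fixes \<beta> :: "'d::finite \<Rightarrow> nat"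
  shows "\<exists>L. \<forall>i. count_list L i = \<beta> i"
proof -
  obtain L where "mset L = (\<Sum>i\<in>UNIV. replicate_mset (\<beta> i) i)"
    using ex_mset by blast
  then have "count_list L i = \<beta> i" for i
    by (simp add: count_mset[symmetric] count_sum sum.delta)
  then show ?thesis by blast
qed

text \<open>The very choice made in \<open>classical_D\<close>, so that the two agree by
  unfolding.\<close>

definition mi_list :: "('d::finite \<Rightarrow> nat) \<Rightarrow> 'd list" where
  "mi_list \<beta> = (SOME L. \<forall>i. count_list L i = \<beta> i)"

lemma count_mi_list: "count_list (mi_list \<beta>) i = \<beta> i"
  unfolding mi_list_def by (rule someI2_ex[OF ex_list_of_multi_index]) simp

lemma classical_D_mi_list: "classical_D \<beta> \<phi> = foldr partial_deriv (mi_list \<beta>) \<phi>"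
  by (simp add: classical_D_def mi_list_def)

lemma length_eq_mi_abs:
  fixes L :: "'d::finite list"
  shows "mi_abs (count_list L) = length L"
  unfolding mi_abs_def using sum_count_set[of L UNIV] by simp

lemma length_mi_list: "length (mi_list \<beta>) = mi_abs \<beta>"
proof -
  have "count_list (mi_list \<beta>) = \<beta>" by (rule ext) (rule count_mi_list)
  then show ?thesis
    using length_eq_mi_abs[of "mi_list \<beta>"] by simp
qed

lemma mset_mi_list: "mset (mi_list (count_list L)) = mset L"
  by (rule multiset_eqI) (simp add: count_mset count_mi_list)

text \<open>Both sides are tested against \<open>\<phi>\<close>. Moving the differences to
  \<open>\<phi>\<close> reverses every step, so the product of the \<open>- c i\<close> contributes
  the sign \<open>(-1) ^ mi_abs \<beta>\<close>, which cancels the one in the definition of weak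
  derivatives. The order \<open>mi_list \<beta>\<close> is the one built into
  \<open>classical_D\<close>.\<close>

lemma mdiff_weak_deriv_mi_list:
  fixes g h :: "real^'d::finite \<Rightarrow> real"
  assumes p: "1 \<le> p" and g: "g \<in> borel_measurable borel" "g \<in> Lp_space p"
    and h: "h \<in> borel_measurable borel" "h \<in> Lp_space p" and w: "is_weak_deriv \<beta> g h"
  defines "vs c \<equiv> map (\<lambda>i. axis i (c i)) (mi_list \<beta>)"
  shows "AE x in lebesgue. mdiff (vs c) g x = (\<Prod>i\<leftarrow>mi_list \<beta>. c i) * avg (law (vs c)) h x"
proof (rule AE_eq_if_test_eq)
  let ?P = "\<Prod>i\<leftarrow>mi_list \<beta>. c i"
  have bm: "mdiff (vs c) g \<in> borel_measurable borel" "(\<lambda>x. ?P * avg (law (vs c)) h x) \<in> borel_measurable borel"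
    using g h avg_measurable[OF bounded_law_law h(1), of "vs c"] by auto
  have ah: "avg (law (vs c)) h \<in> Lp_space p"
    by (rule avg_Lp(1)[OF bounded_law_law p h])
  show "locally_integrable (mdiff (vs c) g)" "locally_integrable (\<lambda>x. ?P * avg (law (vs c)) h x)"
    using mdiff_Lp[OF p g(2)] Lp_cmult(1)[OF ah] p by (auto intro!: Lp_locally_integrable)
  fix \<phi> :: "real^'d \<Rightarrow> real" assume \<phi>: "test_function \<phi>"
  have neg: "map uminus (vs c) = vs (\<lambda>i. - c i)"
    by (auto simp: vs_def vec_eq_iff axis_def)
  let ?\<psi> = "avg (law (vs (\<lambda>i. - c i))) \<phi>"
  have \<psi>: "test_function ?\<psi>" by (rule test_function_avg[OF bounded_law_law \<phi>])
  have P: "(\<Prod>i\<leftarrow>L. - c i) = (-1) ^ length L * (\<Prod>i\<leftarrow>L. c i)" for L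
    by (induction L) auto
  have md: "mdiff (vs (\<lambda>i. - c i)) \<phi> = (\<lambda>x. (\<Prod>i\<leftarrow>mi_list \<beta>. - c i) * classical_D \<beta> ?\<psi> x)"
    unfolding vs_def mdiff_eq_avg_partial_derivs[OF \<phi>] classical_D_mi_list[symmetric]
    by (subst classical_D_avg[OF bounded_law_law \<phi>]) simp
  have "(LINT x|lborel. mdiff (vs c) g x * \<phi> x) = (LINT x|lborel. g x * mdiff (vs (\<lambda>i. - c i)) \<phi> x)"
    using mdiff_duality[OF p g bump_like_test[OF \<phi>], of "vs c"] by (simp add: neg)
  also have "\<dots> = (LINT x|lborel. (\<Prod>i\<leftarrow>mi_list \<beta>. - c i) * (g x * classical_D \<beta> ?\<psi> x))"
    by (simp add: md mult_ac)
  also have "\<dots> = (\<Prod>i\<leftarrow>mi_list \<beta>. - c i) * ((-1) ^ mi_abs \<beta> * (LINT x|lborel. h x * ?\<psi> x))"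
    using is_weak_derivD[OF w g(1) h(1) \<psi>] by simp
  also have "\<dots> = ?P * (LINT x|lborel. h x * ?\<psi> x)"
    by (simp add: P length_mi_list flip: power_mult_distrib)
  also have "(LINT x|lborel. h x * ?\<psi> x) = (LINT x|lborel. avg (law (vs c)) h x * \<phi> x)"
    using avg_law_duality[OF p h bump_like_test[OF \<phi>], of "vs c"] by (simp add: neg)
  finally have "(LINT x|lborel. mdiff (vs c) g x * \<phi> x) = (LINT x|lborel. (?P * avg (law (vs c)) h x) * \<phi> x)"
    by (simp add: mult.assoc)
  then show "(LINT x|lebesgue. mdiff (vs c) g x * \<phi> x) = (LINT x|lebesgue. (?P * avg (law (vs c)) h x) * \<phi> x)"
    using bm \<phi> by (simp only: integral_mult_test_lborel)
qed

text \<open>Any order \<open>L\<close> of the coordinates is allowed since differences commute; the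
  average in the identity does not increase the norm.\<close>

lemma mdiff_weak_deriv_bound:
  fixes g h :: "real^'d::finite \<Rightarrow> real"
  assumes p: "1 \<le> p" and g: "g \<in> Lp_space p" and h: "h \<in> Lp_space p"
    and w: "is_weak_deriv (count_list L) g h"
  shows "Lp_norm p (mdiff (map (\<lambda>i. axis i (c i)) L) g) \<le> \<bar>\<Prod>i\<leftarrow>L. c i\<bar> * Lp_norm p h"
proof -
  let ?M = "mi_list (count_list L)"
  obtain g' where g': "g' \<in> borel_measurable borel" "AE x in lebesgue. g x = g' x"
    using borel_version[OF Lp_space_measurable[OF g]] by blast
  obtain h' where h': "h' \<in> borel_measurable borel" "AE x in lebesgue. h x = h' x"
    using borel_version[OF Lp_space_measurable[OF h]] by blast
  have L: "g' \<in> Lp_space p" "h' \<in> Lp_space p" "Lp_norm p h' = Lp_norm p h"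
    using Lp_cong_AE(1)[OF g g'(2)] Lp_cong_AE[OF h h'(2)] by blast+
  have w': "is_weak_deriv (count_list L) g' h'"
    by (rule is_weak_deriv_cong_AE[OF w g'(2) h'(2)]) (intro Lp_locally_integrable[OF _ p] L)+
  have "mset (map (\<lambda>i. axis i (c i)) ?M) = mset (map (\<lambda>i. axis i (c i)) L)"
    by (simp add: mset_mi_list)
  then have pm: "mdiff (map (\<lambda>i. axis i (c i)) ?M) = mdiff (map (\<lambda>i. axis i (c i)) L)"
    by (rule mdiff_perm)
  have pp: "(\<Prod>i\<leftarrow>?M. c i) = (\<Prod>i\<leftarrow>L. c i)"
    by (simp add: prod_mset_prod_list[symmetric] mset_mi_list)
  have a: "avg (law (map (\<lambda>i. axis i (c i)) ?M)) h' \<in> Lp_space p"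
      "Lp_norm p (avg (law (map (\<lambda>i. axis i (c i)) ?M)) h') \<le> Lp_norm p h"
    using avg_Lp[OF bounded_law_law p h'(1) L(2)] L(3) by auto
  have m: "mdiff (map (\<lambda>i. axis i (c i)) L) g \<in> Lp_space p"
    using mdiff_Lp[OF p g] by blast
  have "AE x in lebesgue. mdiff (map (\<lambda>i. axis i (c i)) L) g x =
      (\<Prod>i\<leftarrow>L. c i) * avg (law (map (\<lambda>i. axis i (c i)) ?M)) h' x"
    using mdiff_cong_AE[OF g'(2), of "map (\<lambda>i. axis i (c i)) L"]
      mdiff_weak_deriv_mi_list[OF p g'(1) L(1) h'(1) L(2) w', of c, unfolded pm pp]
    by eventually_elim simp
  then have "Lp_norm p (mdiff (map (\<lambda>i. axis i (c i)) L) g) =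
      Lp_norm p (\<lambda>x. (\<Prod>i\<leftarrow>L. c i) * avg (law (map (\<lambda>i. axis i (c i)) ?M)) h' x)"
    by (rule Lp_cong_AE(2)[OF m, symmetric])
  also have "\<dots> = \<bar>\<Prod>i\<leftarrow>L. c i\<bar> * Lp_norm p (avg (law (map (\<lambda>i. axis i (c i)) ?M)) h')"
    using p by (intro Lp_cmult(2)[OF a(1)]) simp
  also have "\<dots> \<le> \<bar>\<Prod>i\<leftarrow>L. c i\<bar> * Lp_norm p h"
    by (intro mult_left_mono a(2)) simp
  finally show ?thesis .
qed

text \<open>Telescoping: the step \<open>h\<close> is made one coordinate at a time, and the
  intermediate translations leave the norm unchanged.\<close>

lemma diff_op_bound_coordinates:
  fixes u :: "real^'d::finite \<Rightarrow> real"
  assumes p: "1 \<le> p" and u: "u \<in> Lp_space p"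
  shows "Lp_norm p (diff_op h u) \<le> (\<Sum>i\<in>UNIV. Lp_norm p (diff_op (axis i (h $ i)) u))"
proof -
  have coord: "Lp_norm p (diff_op (\<Sum>i\<in>A. axis i (h $ i)) u) \<le> (\<Sum>i\<in>A. Lp_norm p (diff_op (axis i (h $ i)) u))"
    if "finite A" for A
    using that
  proof (induction A rule: finite_induct)
    case empty
    then show ?case by (simp add: diff_op_def[abs_def])
  next
    case (insert a A)
    let ?w = "\<Sum>i\<in>A. axis i (h $ i) :: real^'d"
    have "diff_op (axis a (h $ a) + ?w) u = (\<lambda>x. diff_op (axis a (h $ a)) u (x + ?w) + diff_op ?w u x)"
      by (rule ext) (simp add: diff_op_def add_ac)
    then have "Lp_norm p (diff_op (axis a (h $ a) + ?w) u) \<le>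
        Lp_norm p (\<lambda>x. diff_op (axis a (h $ a)) u (x + ?w)) + Lp_norm p (diff_op ?w u)"
      using Lp_add(2)[OF p Lp_translate(1)[OF diff_op_Lp(1)[OF p u]] diff_op_Lp(1)[OF p u]] p by simp
    then show ?case
      using insert Lp_translate(2)[OF diff_op_Lp(1)[OF p u], of "axis a (h $ a)" ?w] p by simp
  qed
  moreover have "(\<Sum>i\<in>UNIV. axis i (h $ i)) = h"
    by (simp add: vec_eq_iff axis_def sum.delta)
  ultimately show ?thesis
    using coord[OF finite[of UNIV]] by simp
qed

text \<open>Each of the \<open>n\<close> equal steps is split into coordinate steps, which produces
  one term for every list of \<open>n\<close> coordinates.\<close>

lemma mdiff_replicate_bound:
  fixes u :: "real^'d::finite \<Rightarrow> real"
  assumes p: "1 \<le> p" and u: "u \<in> Lp_space p"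
    and K: "\<And>L. length L = n \<Longrightarrow> Lp_norm p (mdiff (map (\<lambda>i. axis i (h $ i)) L) u) \<le> K"
  shows "Lp_norm p (mdiff (replicate n h) u) \<le> real CARD('d) ^ n * K"
  using u K
proof (induction n arbitrary: u)
  case 0
  then show ?case using "0.prems"(2)[of "[]"] by simp
next
  case (Suc n)
  have "Lp_norm p (mdiff (replicate (Suc n) h) u) = Lp_norm p (diff_op h (mdiff (replicate n h) u))"
    by (simp add: mdiff_diff_op)
  also have "\<dots> \<le> (\<Sum>i\<in>UNIV. Lp_norm p (diff_op (axis i (h $ i)) (mdiff (replicate n h) u)))"
    by (rule diff_op_bound_coordinates[OF p]) (use mdiff_Lp[OF p Suc.prems(1)] in blast)
  also have "\<dots> = (\<Sum>i\<in>UNIV. Lp_norm p (mdiff (replicate n h) (diff_op (axis i (h $ i)) u)))"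
    by (simp add: mdiff_diff_op)
  also have "\<dots> \<le> (\<Sum>i\<in>(UNIV::'d set). real CARD('d) ^ n * K)"
  proof (rule sum_mono)
    fix i :: 'd
    show "Lp_norm p (mdiff (replicate n h) (diff_op (axis i (h $ i)) u)) \<le> real CARD('d) ^ n * K"
      using Suc.prems(2)[of "i # _"]
      by (intro Suc.IH diff_op_Lp[OF p Suc.prems(1)]) simp
  qed
  finally show ?case by (simp add: mult_ac)
qed

text \<open>Pascal's rule. It puts the modulus of smoothness into the language of iterated
  differences.\<close>

lemma fin_diff_eq_mdiff: "fin_diff s h f = mdiff (replicate s h) f"
proof (induction s)
  case 0
  show ?case by (rule ext) (simp add: fin_diff_def)
next
  case (Suc s)
  have "fin_diff (Suc s) h f x = fin_diff s h f (x + h) - fin_diff s h f x" for x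
  proof -
    define F where "F n = f (x + real n *\<^sub>R h)" for n
    have 1: "fin_diff s h f x = (\<Sum>\<nu>\<le>s. real (s choose \<nu>) * (-1) ^ \<nu> * F (s - \<nu>))"
      by (simp add: fin_diff_def F_def atLeast0AtMost)
    have 2: "fin_diff s h f (x + h) = (\<Sum>\<nu>\<le>s. real (s choose \<nu>) * (-1) ^ \<nu> * F (Suc s - \<nu>))"
      unfolding fin_diff_def F_def atLeast0AtMost
      by (rule sum.cong) (auto simp: Suc_diff_le algebra_simps of_nat_diff)
    have "fin_diff (Suc s) h f x = (\<Sum>\<nu>\<le>Suc s. real (Suc s choose \<nu>) * (-1) ^ \<nu> * F (Suc s - \<nu>))"
      by (simp add: fin_diff_def F_def atLeast0AtMost)
    also have "\<dots> = F (Suc s) + (\<Sum>\<nu>\<le>s. real (Suc s choose Suc \<nu>) * (-1) ^ Suc \<nu> * F (s - \<nu>))"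
      by (subst sum.atMost_Suc_shift) simp
    also have "(\<Sum>\<nu>\<le>s. real (Suc s choose Suc \<nu>) * (-1) ^ Suc \<nu> * F (s - \<nu>))
       = (\<Sum>\<nu>\<le>s. real (s choose Suc \<nu>) * (-1) ^ Suc \<nu> * F (Suc s - Suc \<nu>)) - (\<Sum>\<nu>\<le>s. real (s choose \<nu>) * (-1) ^ \<nu> * F (s - \<nu>))"
      unfolding sum_subtractf[symmetric] by (rule sum.cong) (simp_all add: algebra_simps)
    also have "F (Suc s) + ((\<Sum>\<nu>\<le>s. real (s choose Suc \<nu>) * (-1) ^ Suc \<nu> * F (Suc s - Suc \<nu>)) - (\<Sum>\<nu>\<le>s. real (s choose \<nu>) * (-1) ^ \<nu> * F (s - \<nu>)))
       = (\<Sum>\<nu>\<le>Suc s. real (s choose \<nu>) * (-1) ^ \<nu> * F (Suc s - \<nu>)) - fin_diff s h f x"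
      unfolding 1 by (subst sum.atMost_Suc_shift) simp
    finally show ?thesis
      by (simp add: 2)
  qed
  then have "fin_diff (Suc s) h f = diff_op h (fin_diff s h f)"
    by (auto simp: diff_op_def)
  then show ?case
    by (simp add: Suc mdiff_diff_op)
qed

lemma finite_multi_indices: "finite {\<beta> :: 'd::finite \<Rightarrow> nat. mi_abs \<beta> = s}"
proof (rule finite_subset)
  show "{\<beta> :: 'd \<Rightarrow> nat. mi_abs \<beta> = s} \<subseteq> {\<beta>. range \<beta> \<subseteq> {..s}}"
    by (auto simp: mi_abs_def intro: member_le_sum)
  have "{\<beta> :: 'd \<Rightarrow> nat. range \<beta> \<subseteq> {..s}} = (UNIV \<rightarrow>\<^sub>E {..s})"
    by (auto simp: PiE_def)
  then show "finite {\<beta> :: 'd \<Rightarrow> nat. range \<beta> \<subseteq> {..s}}"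
    by (simp add: finite_PiE)
qed

lemma Sobolev_Lp: "g \<in> Sobolev p s \<Longrightarrow> g \<in> Lp_space p"
  by (simp add: Sobolev_def)

lemma Sobolev_weak_D:
  assumes "g \<in> Sobolev p s" "mi_abs \<beta> \<le> s"
  shows "is_weak_deriv \<beta> g (weak_D \<beta> g)" "weak_D \<beta> g \<in> Lp_space p"
proof -
  obtain h where "h \<in> Lp_space p" "is_weak_deriv \<beta> g h"
    using assms by (auto simp: Sobolev_def has_weak_deriv_in_Lp_def)
  then show "is_weak_deriv \<beta> g (weak_D \<beta> g)" "weak_D \<beta> g \<in> Lp_space p"
    using weak_D_Lp by blast+
qed

lemma weak_D_le_seminorm:
  assumes "mi_abs \<beta> = s"
  shows "Lp_norm p (weak_D \<beta> g) \<le> Sobolev_seminorm p s g"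
  unfolding Sobolev_seminorm_def
  using assms by (intro member_le_sum[of \<beta> _ "\<lambda>\<beta>. Lp_norm p (weak_D \<beta> g)"] finite_multi_indices) auto

lemma Sobolev_seminorm_nonneg [simp]: "0 \<le> Sobolev_seminorm p s g"
  unfolding Sobolev_seminorm_def by (intro sum_nonneg) auto

lemma fin_diff_Sobolev_bound:
  fixes g :: "real^'d::finite \<Rightarrow> real"
  assumes p: "1 \<le> p" and g: "g \<in> Sobolev p s"
  shows "Lp_norm p (fin_diff s h g) \<le> real CARD('d) ^ s * (norm h ^ s * Sobolev_seminorm p s g)"
  unfolding fin_diff_eq_mdiff
proof (rule mdiff_replicate_bound[OF p Sobolev_Lp[OF g]])
  fix L :: "'d list" assume L: "length L = s"
  then have abs: "mi_abs (count_list L) = s"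
    by (simp add: length_eq_mi_abs)
  have pr: "\<bar>\<Prod>i\<leftarrow>L. h $ i\<bar> \<le> norm h ^ length L"
    by (induction L) (auto simp: abs_mult intro!: mult_mono component_le_norm_cart)
  have "Lp_norm p (mdiff (map (\<lambda>i. axis i (h $ i)) L) g) \<le> \<bar>\<Prod>i\<leftarrow>L. h $ i\<bar> * Lp_norm p (weak_D (count_list L) g)"
    using Sobolev_weak_D[OF g, of "count_list L"] abs Sobolev_Lp[OF g]
    by (intro mdiff_weak_deriv_bound[OF p]) auto
  also have "\<dots> \<le> norm h ^ s * Sobolev_seminorm p s g"
    using pr weak_D_le_seminorm[OF abs] L by (intro mult_mono) auto
  finally show "Lp_norm p (mdiff (map (\<lambda>i. axis i (h $ i)) L) g) \<le> norm h ^ s * Sobolev_seminorm p s g" .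
qed

section \<open>Mixed differences and the modulus of smoothness\<close>

lemma sum_Pow_insert:
  fixes F :: "'a set \<Rightarrow> real"
  assumes "finite A" "a \<notin> A"
  shows "(\<Sum>D\<in>Pow (insert a A). F D) = (\<Sum>D\<in>Pow A. F D) + (\<Sum>D\<in>Pow A. F (insert a D))"
proof -
  have "(\<Sum>D\<in>Pow (insert a A). F D) = (\<Sum>D\<in>Pow A. F D) + (\<Sum>D\<in>insert a ` Pow A. F D)"
    unfolding Pow_insert using assms by (intro sum.union_disjoint) auto
  also have "(\<Sum>D\<in>insert a ` Pow A. F D) = (\<Sum>D\<in>Pow A. F (insert a D))"
    using assms(2) by (subst sum.reindex) (auto simp: inj_on_def)
  finally show ?thesis .
qed

text \<open>\<open>D\<close> is the set of steps that are taken. The sign is that of the number of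
  omitted steps, written with a sum in the exponent because only parity matters.\<close>

lemma mdiff_eq_sum_Pow:
  "distinct js \<Longrightarrow> mdiff (map v js) f x =
    (\<Sum>D\<in>Pow (set js). (-1) ^ (length js + card D) * f (x + (\<Sum>j\<in>D. v j)))"
proof (induction js arbitrary: f)
  case (Cons a js)
  let ?F = "\<lambda>D. (-1) ^ (length js + card D) * f (x + (\<Sum>j\<in>D. v j)) :: real"
  have fin: "finite D" "a \<notin> D" if "D \<in> Pow (set js)" for D
    using that Cons.prems by (auto intro: finite_subset)
  have "mdiff (map v (a # js)) f x = (\<Sum>D\<in>Pow (set js). (-1) ^ (length js + card D) * diff_op (v a) f (x + (\<Sum>j\<in>D. v j)))"
    using Cons by simp
  also have "\<dots> = (\<Sum>D\<in>Pow (set js). - ?F D + (-1) ^ (length js + card D) * f (x + (v a + (\<Sum>j\<in>D. v j))))"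
    by (rule sum.cong) (simp_all add: diff_op_def algebra_simps)
  also have "\<dots> = (\<Sum>D\<in>Pow (set js). - ?F D) + (\<Sum>D\<in>Pow (set js). (-1) ^ (length js + card D) * f (x + (v a + (\<Sum>j\<in>D. v j))))"
    by (rule sum.distrib)
  also have "\<dots> = (\<Sum>D\<in>Pow (set (a # js)). (-1) ^ (length (a # js) + card D) * f (x + (\<Sum>j\<in>D. v j)))"
    unfolding list.set(2)
    by (subst sum_Pow_insert) (use Cons.prems fin in \<open>auto intro!: arg_cong2[where f = "(+)"] sum.cong\<close>)
  finally show ?case .
qed simp

text \<open>The sets \<open>D\<close> and \<open>insert a D\<close> contribute equal values with
  opposite signs.\<close>

lemma sum_Pow_alternating_zero:
  fixes F :: "'a set \<Rightarrow> real"
  assumes "finite A" "a \<in> A" "\<And>D. D \<subseteq> A - {a} \<Longrightarrow> F (insert a D) = F D"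
  shows "(\<Sum>D\<in>Pow A. (-1) ^ card D * F D) = 0"
proof -
  have A: "A = insert a (A - {a})" using assms(2) by auto
  have "(-1) ^ card (insert a D) * F (insert a D) = - ((-1) ^ card D * F D)" if "D \<in> Pow (A - {a})" for D
  proof -
    have "finite D" "a \<notin> D" using that assms(1) by (auto intro: finite_subset)
    then show ?thesis using that assms(3)[of D] by simp
  qed
  then have "(\<Sum>D\<in>Pow (A - {a}). (-1) ^ card (insert a D) * F (insert a D)) = - (\<Sum>D\<in>Pow (A - {a}). (-1) ^ card D * F D)"
    by (simp add: sum_negf[symmetric])
  then show ?thesis
    using sum_Pow_insert[of "A - {a}" a "\<lambda>D. (-1) ^ card D * F D"] assms(1) A by simp
qed

lemma fin_diff_reindex:
  "fin_diff s u f x = (\<Sum>\<mu>\<le>s. real (s choose \<mu>) * (-1) ^ (s - \<mu>) * f (x + real \<mu> *\<^sub>R u))"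
  unfolding fin_diff_def atLeast0AtMost
  by (rule sum.reindex_bij_witness[of _ "\<lambda>\<mu>. s - \<mu>" "\<lambda>\<mu>. s - \<mu>"]) (auto simp flip: binomial_symmetric)

text \<open>Kemperman's identity. When the differences on the right are expanded, the terms at \<open>\<mu>\<close> times
  the step cancel in pairs \<open>D\<close>, \<open>D \<union> {\<mu>}\<close> for \<open>\<mu> \<ge> 1\<close>; only \<open>\<mu> = 0\<close> is left.\<close>

lemma mdiff_eq_sum_fin_diff:
  fixes v :: "nat \<Rightarrow> real^'d::finite"
  shows "mdiff (map v [1..<Suc s]) f x =
    (\<Sum>D\<in>Pow {1..s}. (-1) ^ card D * fin_diff s (- (\<Sum>j\<in>D. v j /\<^sub>R real j)) f (x + (\<Sum>j\<in>D. v j)))"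
proof -
  let ?F = "\<lambda>\<mu> D. f (x + (\<Sum>j\<in>D. (1 - real \<mu> / real j) *\<^sub>R v j))"
  \<comment> \<open>Shift and step are matched so that \<open>v j\<close> gets the coefficient
    \<open>1 - \<mu> / j\<close>. It vanishes for \<open>j = \<mu>\<close>, so the argument is the
    same for \<open>D\<close> and \<open>insert \<mu> D\<close>.\<close>
  have arg: "x + (\<Sum>j\<in>D. v j) + real \<mu> *\<^sub>R (- (\<Sum>j\<in>D. v j /\<^sub>R real j)) = x + (\<Sum>j\<in>D. (1 - real \<mu> / real j) *\<^sub>R v j)" for \<mu> D
    by (simp add: scaleR_sum_right sum_subtractf[symmetric] scaleR_diff_left divide_inverse)
  have z: "(\<Sum>D\<in>Pow {1..s}. (-1) ^ card D * ?F \<mu> D) = 0" if \<mu>: "\<mu> \<in> {1..s}" for \<mu>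
  proof (rule sum_Pow_alternating_zero[OF _ \<mu>])
    fix D assume "D \<subseteq> {1..s} - {\<mu>}"
    then have "finite D" "\<mu> \<notin> D" by (auto intro: finite_subset)
    then show "?F \<mu> (insert \<mu> D) = ?F \<mu> D" using \<mu> by simp
  qed simp
  have "(\<Sum>D\<in>Pow {1..s}. (-1) ^ card D * fin_diff s (- (\<Sum>j\<in>D. v j /\<^sub>R real j)) f (x + (\<Sum>j\<in>D. v j)))
      = (\<Sum>D\<in>Pow {1..s}. \<Sum>\<mu>\<le>s. real (s choose \<mu>) * (-1) ^ (s - \<mu>) * ((-1) ^ card D * ?F \<mu> D))"
    unfolding fin_diff_reindex arg sum_distrib_left by (simp add: mult_ac)
  also have "\<dots> = (\<Sum>\<mu>\<le>s. real (s choose \<mu>) * (-1) ^ (s - \<mu>) * (\<Sum>D\<in>Pow {1..s}. (-1) ^ card D * ?F \<mu> D))"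
    by (subst sum.swap) (simp add: sum_distrib_left)
  also have "\<dots> = (\<Sum>\<mu>\<in>{0}. real (s choose \<mu>) * (-1) ^ (s - \<mu>) * (\<Sum>D\<in>Pow {1..s}. (-1) ^ card D * ?F \<mu> D))"
  proof (rule sum.mono_neutral_right)
    show "\<forall>\<mu>\<in>{..s} - {0}. real (s choose \<mu>) * (-1) ^ (s - \<mu>) * (\<Sum>D\<in>Pow {1..s}. (-1) ^ card D * ?F \<mu> D) = 0"
    proof
      fix \<mu> assume "\<mu> \<in> {..s} - {0}"
      then have "\<mu> \<in> {1..s}" by auto
      from z[OF this] show "real (s choose \<mu>) * (-1) ^ (s - \<mu>) * (\<Sum>D\<in>Pow {1..s}. (-1) ^ card D * ?F \<mu> D) = 0" by simp
    qed
  qed auto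
  also have "\<dots> = (\<Sum>D\<in>Pow {1..s}. (-1) ^ (s + card D) * f (x + (\<Sum>j\<in>D. v j)))"
    by (simp add: sum_distrib_left power_add mult_ac)
  also have "\<dots> = mdiff (map v [1..<Suc s]) f x"
    by (subst mdiff_eq_sum_Pow) (simp_all add: atLeastLessThanSuc_atLeastAtMost del: upt_Suc)
  finally show ?thesis by simp
qed

text \<open>Kemperman's identity has \<open>2 ^ length vs\<close> terms, each a translate of a pure
  difference. Because of the weights \<open>1 / j \<le> 1\<close> their steps are no longer than the
  sum of the given steps, so a mixed difference with small total step is controlled by the
  modulus.\<close>

lemma mdiff_bound_by_fin_diff:
  fixes f :: "real^'d::finite \<Rightarrow> real"
  assumes p: "1 \<le> p" and f: "f \<in> Lp_space p"
    and M: "\<And>u. norm u \<le> (\<Sum>v\<leftarrow>vs. norm v) \<Longrightarrow> Lp_norm p (fin_diff (length vs) u f) \<le> M"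
  shows "Lp_norm p (mdiff vs f) \<le> 2 ^ length vs * M"
proof -
  define s where "s = length vs"
  define v where "v j = vs ! (j - 1)" for j
  have vs: "vs = map v [1..<Suc s]"
    by (rule nth_equalityI) (auto simp: v_def s_def simp del: upt_Suc)
  define u where "u D = - (\<Sum>j\<in>D. v j /\<^sub>R real j)" for D
  have fd: "fin_diff s h f \<in> Lp_space p" for h
    unfolding fin_diff_eq_mdiff using mdiff_Lp[OF p f] by blast
  have u: "norm (u D) \<le> (\<Sum>v\<leftarrow>vs. norm v)" if "D \<in> Pow {1..s}" for D
  proof -
    have "norm (u D) \<le> (\<Sum>j\<in>D. norm (v j /\<^sub>R real j))"
      unfolding u_def norm_minus_cancel by (rule norm_sum)
    also have "\<dots> \<le> (\<Sum>j\<in>D. norm (v j))"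
    proof (rule sum_mono)
      fix j assume "j \<in> D"
      then have "1 \<le> real j" using that by auto
      then have "inverse (real j) \<le> 1" by (simp add: inverse_le_1_iff)
      then show "norm (v j /\<^sub>R real j) \<le> norm (v j)"
        by (simp add: mult_left_le_one_le)
    qed
    also have "\<dots> \<le> (\<Sum>j\<in>{1..s}. norm (v j))"
      using that by (intro sum_mono2) auto
    also have "\<dots> = (\<Sum>v\<leftarrow>vs. norm v)"
      unfolding vs by (simp add: sum_list_distinct_conv_sum_set o_def atLeastLessThanSuc_atLeastAtMost del: upt_Suc)
    finally show ?thesis .
  qed
  have eq: "mdiff vs f = (\<lambda>x. \<Sum>D\<in>Pow {1..s}. (-1) ^ card D * fin_diff s (u D) f (x + (\<Sum>j\<in>D. v j)))"
    unfolding vs u_def by (rule ext) (rule mdiff_eq_sum_fin_diff)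
  have tr: "(\<lambda>x. fin_diff s (u D) f (x + w)) \<in> Lp_space p"
      "Lp_norm p (\<lambda>x. fin_diff s (u D) f (x + w)) = Lp_norm p (fin_diff s (u D) f)" for D w
    using Lp_translate[OF fd] p by auto
  have mem: "(\<lambda>x. (-1) ^ card D * fin_diff s (u D) f (x + (\<Sum>j\<in>D. v j))) \<in> Lp_space p"
     and nrm: "Lp_norm p (\<lambda>x. (-1) ^ card D * fin_diff s (u D) f (x + (\<Sum>j\<in>D. v j))) = Lp_norm p (fin_diff s (u D) f)" for D
    using Lp_cmult[OF tr(1)] tr(2) p by (simp_all add: power_abs)
  have "Lp_norm p (mdiff vs f) \<le> (\<Sum>D\<in>Pow {1..s}. Lp_norm p (\<lambda>x. (-1) ^ card D * fin_diff s (u D) f (x + (\<Sum>j\<in>D. v j))))"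
    unfolding eq using Lp_sum[OF p, of "Pow {1..s}" "\<lambda>D x. (-1) ^ card D * fin_diff s (u D) f (x + (\<Sum>j\<in>D. v j))"] mem
    by auto
  also have "\<dots> \<le> (\<Sum>D\<in>Pow {1..s}. M)"
    unfolding nrm using M u by (intro sum_mono) (simp add: s_def)
  also have "\<dots> = 2 ^ length vs * M"
    by (simp add: card_Pow s_def)
  finally show ?thesis .
qed

lemma bdd_above_modulus:
  assumes "1 \<le> p" "f \<in> Lp_space p"
  shows "bdd_above ((\<lambda>h. Lp_norm p (fin_diff s h f)) ` A)"
proof (rule bdd_aboveI2)
  show "Lp_norm p (fin_diff s h f) \<le> 2 ^ s * Lp_norm p f" for h
    using mdiff_Lp[OF assms, of "replicate s h"] by (simp add: fin_diff_eq_mdiff)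
qed

lemma fin_diff_le_modulus:
  assumes "1 \<le> p" "f \<in> Lp_space p" "norm h < \<delta>"
  shows "Lp_norm p (fin_diff s h f) \<le> modulus p s f \<delta>"
  unfolding modulus_def using assms by (intro cSUP_upper bdd_above_modulus) auto

lemma modulus_le:
  assumes "0 < \<delta>" "\<And>h. norm h < \<delta> \<Longrightarrow> Lp_norm p (fin_diff s h f) \<le> K"
  shows "modulus p s f \<delta> \<le> K"
  unfolding modulus_def using assms by (intro cSUP_least) (auto intro!: exI[of _ 0])

lemma modulus_nonneg:
  assumes "1 \<le> p" "f \<in> Lp_space p" "0 < \<delta>"
  shows "0 \<le> modulus p s f \<delta>"
  using order_trans[OF Lp_norm_nonneg fin_diff_le_modulus[OF assms(1,2), of 0 \<delta> s]] assms(3) by simp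

lemma modulus_Sobolev:
  fixes g :: "real^'d::finite \<Rightarrow> real"
  assumes p: "1 \<le> p" and g: "g \<in> Sobolev p s" and "0 < \<delta>"
  shows "modulus p s g \<delta> \<le> real CARD('d) ^ s * (\<delta> ^ s * Sobolev_seminorm p s g)"
proof (rule modulus_le[OF \<open>0 < \<delta>\<close>])
  fix h :: "real^'d" assume "norm h < \<delta>"
  then have "norm h ^ s * Sobolev_seminorm p s g \<le> \<delta> ^ s * Sobolev_seminorm p s g"
    by (intro mult_right_mono power_mono) auto
  then show "Lp_norm p (fin_diff s h g) \<le> real CARD('d) ^ s * (\<delta> ^ s * Sobolev_seminorm p s g)"
    using fin_diff_Sobolev_bound[OF p g, of h] by (intro order_trans[OF fin_diff_Sobolev_bound[OF p g]] mult_left_mono) auto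
qed

lemma mdiff_add: "mdiff vs (\<lambda>x. f x + g x) = (\<lambda>x. mdiff vs f x + mdiff vs g x)"
proof (induction vs arbitrary: f g)
  case (Cons v vs)
  have "diff_op v (\<lambda>x. f x + g x) = (\<lambda>x. diff_op v f x + diff_op v g x)"
    by (rule ext) (simp add: diff_op_def)
  then show ?case by (simp add: Cons)
qed simp

lemma modulus_triangle:
  assumes p: "1 \<le> p" and f: "f \<in> Lp_space p" and g: "g \<in> Lp_space p" and "0 < \<delta>"
  shows "modulus p s f \<delta> \<le> 2 ^ s * Lp_norm p (\<lambda>x. f x - g x) + modulus p s g \<delta>"
proof (rule modulus_le[OF \<open>0 < \<delta>\<close>])
  fix h :: "real^'a" assume h: "norm h < \<delta>"
  have d: "(\<lambda>x. f x - g x) \<in> Lp_space p" by (rule Lp_diff(1)[OF p f g])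
  note L = mdiff_Lp[OF p d, of "replicate s h"] mdiff_Lp[OF p g, of "replicate s h"]
  have "mdiff (replicate s h) f = (\<lambda>x. mdiff (replicate s h) (\<lambda>x. f x - g x) x + mdiff (replicate s h) g x)"
    using mdiff_add[of "replicate s h" "\<lambda>x. f x - g x" g] by simp
  then show "Lp_norm p (fin_diff s h f) \<le> 2 ^ s * Lp_norm p (\<lambda>x. f x - g x) + modulus p s g \<delta>"
    using Lp_add(2)[OF p conjunct1[OF L(1)] conjunct1[OF L(2)]] conjunct2[OF L(1)]
      fin_diff_le_modulus[OF p g h, of s]
    by (simp add: fin_diff_eq_mdiff)
qed

section \<open>Smoothing\<close>

text \<open>Needed to split the average of a finite difference into averages of translates, since
  the integral is additive only on integrable functions. Exchanging integrals shows that the p-th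
  powers have a finite average for almost every \<open>x\<close>.\<close>

lemma AE_integrable_translates:
  fixes f :: "real^'d::finite \<Rightarrow> real"
  assumes p: "1 \<le> p" and f [measurable]: "f \<in> borel_measurable borel" and fL: "f \<in> Lp_space p"
    and M: "prob_space M" and Y [measurable]: "Y \<in> borel_measurable M"
  shows "AE x in lebesgue. integrable M (\<lambda>w. f (x + Y w))"
proof -
  interpret M: prob_space M by (rule M)
  interpret pair_sigma_finite lborel M ..
  have fst: "fst \<in> borel_measurable (lborel \<Otimes>\<^sub>M M)"
    using measurable_fst[of lborel M] by simp
  have "(\<lambda>z. f (fst z + Y (snd z))) \<in> borel_measurable (lborel \<Otimes>\<^sub>M M)"
    by (rule measurable_compose[OF borel_measurable_add[OF fst measurable_compose[OF measurable_snd Y]] f])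
  then have m [measurable]: "(\<lambda>(x, w). ennreal (\<bar>f (x + Y w)\<bar> powr p)) \<in> borel_measurable (lborel \<Otimes>\<^sub>M M)"
    by (simp add: split_def)
  have "(\<integral>\<^sup>+x. (\<integral>\<^sup>+w. ennreal (\<bar>f (x + Y w)\<bar> powr p) \<partial>M) \<partial>lborel)
      = (\<integral>\<^sup>+w. (\<integral>\<^sup>+x. ennreal (\<bar>f (x + Y w)\<bar> powr p) \<partial>lborel) \<partial>M)"
    by (rule Fubini'[symmetric, OF m])
  also have "\<dots> = (\<integral>\<^sup>+w. ennreal (Lp_norm p f powr p) \<partial>M)"
    using nn_integral_lborel_translate[of "\<lambda>x. ennreal (\<bar>f x\<bar> powr p)"] nn_integral_Lp_norm[OF fL] p
    by (simp add: nn_integral_completion)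
  also have "\<dots> \<noteq> \<infinity>"
    by (simp add: M.emeasure_space_1)
  finally have "AE x in lborel. (\<integral>\<^sup>+w. ennreal (\<bar>f (x + Y w)\<bar> powr p) \<partial>M) \<noteq> \<infinity>"
    by (intro nn_integral_PInf_AE) measurable
  then have "AE x in lborel. integrable M (\<lambda>w. f (x + Y w))"
  proof eventually_elim
    case (elim x)
    note le = abs_le_one_plus_powr[OF p]
    have "integrable M (\<lambda>w. \<bar>f (x + Y w)\<bar> powr p)"
      by (rule integrableI_nonneg) (use elim in \<open>auto simp: less_top\<close>)
    then have "integrable M (\<lambda>w. 1 + \<bar>f (x + Y w)\<bar> powr p)"
      by simp
    then show ?case
      by (rule Bochner_Integration.integrable_bound) (use le in auto)
  qed
  then show ?thesis
    by (rule AE_completion)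
qed

text \<open>The measure of a set is an average of its indicator, so the identity for bounded Borel
  functions determines the measure. In this form it applies to unbounded integrands as well.\<close>

lemma law_scale: "distr (law vs) borel ((*\<^sub>R) k) = law (map ((*\<^sub>R) k) vs)"
proof -
  interpret l: prob_space "law vs" using bounded_law_law by (auto simp: bounded_law_def)
  interpret k: prob_space "law (map ((*\<^sub>R) k) vs)" using bounded_law_law by (auto simp: bounded_law_def)
  have m [measurable]: "(*\<^sub>R) k \<in> borel_measurable (law vs)"
    by (simp add: measurable_cong_sets[OF sets_law refl])
  interpret D: prob_space "distr (law vs) borel ((*\<^sub>R) k)" by (rule l.prob_space_distr[OF m])
  show ?thesis
  proof (rule measure_eqI)
    fix A :: "(real^'a) set" assume "A \<in> sets (distr (law vs) borel ((*\<^sub>R) k))"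
    then have A [measurable]: "A \<in> sets borel" by simp
    have bb: "bdd_borel (indicator A)"
      unfolding bdd_borel_def by (auto intro!: exI[of _ 1] simp: indicator_def)
    have "measure (distr (law vs) borel ((*\<^sub>R) k)) A = (LINT y|distr (law vs) borel ((*\<^sub>R) k). indicator A y)"
      by simp
    also have "\<dots> = (LINT y|law vs. indicator A (0 + k *\<^sub>R y))"
      by (subst integral_distr) auto
    also have "\<dots> = (LINT y|law (map ((*\<^sub>R) k) vs). indicator A y)"
      unfolding avg_law_scale[OF bb] by (simp add: avg_def)
    also have "\<dots> = measure (law (map ((*\<^sub>R) k) vs)) A"
      by simp
    finally show "emeasure (distr (law vs) borel ((*\<^sub>R) k)) A = emeasure (law (map ((*\<^sub>R) k) vs)) A"
      by (simp add: D.emeasure_eq_measure k.emeasure_eq_measure)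
  qed simp
qed

lemma mdiff_avg:
  "bounded_law R \<mu> \<Longrightarrow> bdd_borel \<phi> \<Longrightarrow> mdiff vs (avg \<mu> \<phi>) = avg \<mu> (mdiff vs \<phi>)"
  by (induction vs arbitrary: \<phi>) (simp_all add: diff_op_avg[symmetric] bdd_borel_diff_op)

lemma norm_axis: "norm (axis i c :: real^'d::finite) = \<bar>c\<bar>"
proof -
  have "axis i c = c *\<^sub>R (axis i 1 :: real^'d)"
    by (simp add: vec_eq_iff axis_def)
  then show ?thesis by (simp add: norm_axis_1)
qed

text \<open>Averaging over a segment in direction \<open>i\<close> allows one derivative in direction \<open>i\<close> to be
  replaced by a difference quotient; hence one direction \<open>i\<close> in \<open>J\<close> is used up for each derivative.\<close>

lemma avg_law_weak_deriv:
  fixes f :: "real^'d::finite \<Rightarrow> real"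
  assumes p: "1 \<le> p" and f: "f \<in> borel_measurable borel" "f \<in> Lp_space p" and c: "0 < c"
    and J: "\<And>i. \<beta> i \<le> count_list J i"
  obtains H where "H \<in> Lp_space p" "is_weak_deriv \<beta> (avg (law (map (\<lambda>i. axis i c) J)) f) H"
    "Lp_norm p H \<le> (1 / c) ^ mi_abs \<beta> * Lp_norm p (mdiff (map (\<lambda>i. axis i c) (mi_list \<beta>)) f)"
proof -
  define L where "L = mi_list \<beta>"
  have "mset L \<subseteq># mset J"
    unfolding subseteq_mset_def by (simp add: L_def count_mset count_mi_list J)
  moreover obtain J' where "mset J' = mset J - mset L" using ex_mset by blast
  ultimately have J': "mset J = mset (L @ J')" by simp
  let ?v = "\<lambda>c K. map (\<lambda>i::'d. axis i c) K :: (real^'d) list"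
  have neg: "map uminus (?v c K) = ?v (- c) K" for K
    by (auto simp: vec_eq_iff axis_def)
  \<comment> \<open>The segments in the directions \<open>L\<close> are spent on differences, those
    in \<open>J'\<close> remain as an average.\<close>
  define H0 where "H0 = avg (law (?v c J')) (mdiff (?v c L) f)"
  define q where "q = (1 / c) ^ mi_abs \<beta>"
  have md: "mdiff (?v c L) f \<in> borel_measurable borel" "mdiff (?v c L) f \<in> Lp_space p"
    using f mdiff_Lp[OF p f(2)] by auto
  have H0: "H0 \<in> borel_measurable borel" "H0 \<in> Lp_space p" "Lp_norm p H0 \<le> Lp_norm p (mdiff (?v c L) f)"
    unfolding H0_def using avg_Lp[OF bounded_law_law p md] avg_measurable[OF bounded_law_law md(1)] by auto
  show ?thesis
  proof
    show HL: "(\<lambda>x. q * H0 x) \<in> Lp_space p"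
      using Lp_cmult(1)[OF H0(2)] p by simp
    show "Lp_norm p (\<lambda>x. q * H0 x) \<le> (1 / c) ^ mi_abs \<beta> * Lp_norm p (mdiff (?v c (mi_list \<beta>)) f)"
      using Lp_cmult(2)[OF H0(2), of q] H0(3) p c by (simp add: q_def L_def mult_left_mono)
    show "is_weak_deriv \<beta> (avg (law (?v c J)) f) (\<lambda>x. q * H0 x)"
    proof (rule is_weak_derivI[OF p])
      show "avg (law (?v c J)) f \<in> borel_measurable borel" "avg (law (?v c J)) f \<in> Lp_space p"
        using avg_Lp[OF bounded_law_law p f] avg_measurable[OF bounded_law_law f(1)] by auto
      show "(\<lambda>x. q * H0 x) \<in> borel_measurable borel" using H0(1) by simp
      show "(\<lambda>x. q * H0 x) \<in> Lp_space p" by (rule HL)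
      fix \<phi> :: "real^'d \<Rightarrow> real" assume \<phi>: "test_function \<phi>"
      have D: "test_function (classical_D \<beta> \<phi>)" by (rule test_function_classical_D[OF \<phi>])
      have P: "(\<Prod>i\<leftarrow>K. (- c)) = (- c) ^ length K" for K :: "'d list"
        by (induction K) auto
      have md\<phi>: "mdiff (?v (- c) L) \<phi> = (\<lambda>x. (- c) ^ mi_abs \<beta> * avg (law (?v (- c) L)) (classical_D \<beta> \<phi>) x)"
        unfolding mdiff_eq_avg_partial_derivs[OF \<phi>] P
        by (simp add: L_def classical_D_mi_list length_mi_list)
      have "avg (law (?v (- c) J)) (classical_D \<beta> \<phi>) = avg (law (?v (- c) L @ ?v (- c) J')) (classical_D \<beta> \<phi>)"
        by (rule avg_law_perm) (simp_all add: J' bdd_borel_test[OF D])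
      also have "\<dots> = avg (law (?v (- c) J')) (avg (law (?v (- c) L)) (classical_D \<beta> \<phi>))"
        by (rule avg_law_append[OF bdd_borel_test[OF D]])
      \<comment> \<open>The differences of \<open>\<phi>\<close> with step \<open>- c\<close> are
        \<open>(- c) ^ mi_abs \<beta>\<close> times this average; solving for it leaves
        \<open>q\<close> and exactly the sign required of a weak derivative.\<close>
      also have "avg (law (?v (- c) L)) (classical_D \<beta> \<phi>) = (\<lambda>x. (-1) ^ mi_abs \<beta> * q * mdiff (?v (- c) L) \<phi> x)"
        unfolding md\<phi> q_def using c by (simp add: mult.assoc[symmetric] flip: power_mult_distrib)
      also have "avg (law (?v (- c) J')) (\<lambda>x. (-1) ^ mi_abs \<beta> * q * mdiff (?v (- c) L) \<phi> x)
          = (\<lambda>x. (-1) ^ mi_abs \<beta> * q * avg (law (?v (- c) J')) (mdiff (?v (- c) L) \<phi>) x)"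
        by (simp add: avg_def[abs_def])
      finally have aD: "avg (law (?v (- c) J)) (classical_D \<beta> \<phi>) =
          (\<lambda>x. (-1) ^ mi_abs \<beta> * q * mdiff (?v (- c) L) (avg (law (?v (- c) J')) \<phi>) x)"
        by (simp add: mdiff_avg[OF bounded_law_law bdd_borel_test[OF \<phi>]])
      have "(LINT x|lborel. avg (law (?v c J)) f x * classical_D \<beta> \<phi> x)
          = (LINT x|lborel. f x * avg (law (?v (- c) J)) (classical_D \<beta> \<phi>) x)"
        by (rule avg_law_duality[OF p f bump_like_test[OF D], of "?v c J", unfolded neg])
      also have "\<dots> = (LINT x|lborel. (-1) ^ mi_abs \<beta> * q * (f x * mdiff (?v (- c) L) (avg (law (?v (- c) J')) \<phi>) x))"
        unfolding aD by (simp add: mult_ac)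
      also have "\<dots> = (-1) ^ mi_abs \<beta> * q * (LINT x|lborel. f x * mdiff (?v (- c) L) (avg (law (?v (- c) J')) \<phi>) x)"
        by simp
      also have "(LINT x|lborel. f x * mdiff (?v (- c) L) (avg (law (?v (- c) J')) \<phi>) x)
          = (LINT x|lborel. mdiff (?v c L) f x * avg (law (?v (- c) J')) \<phi> x)"
        by (rule mdiff_duality[OF p f avg_bump_like[OF bounded_law_law bump_like_test[OF \<phi>]], of "?v c L",
              unfolded neg, symmetric])
      also have "\<dots> = (LINT x|lborel. H0 x * \<phi> x)"
        unfolding H0_def
        by (rule avg_law_duality[OF p md bump_like_test[OF \<phi>], of "?v c J'", unfolded neg, symmetric])
      finally show "(LINT x|lborel. avg (law (?v c J)) f x * classical_D \<beta> \<phi> x)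
          = (-1) ^ mi_abs \<beta> * (LINT x|lborel. (q * H0 x) * \<phi> x)"
        by (simp add: mult.assoc)
    qed
  qed
qed

lemma locally_integrable_sum:
  fixes g :: "'k \<Rightarrow> real^'d::finite \<Rightarrow> real"
  assumes "finite A" "\<And>k. k \<in> A \<Longrightarrow> locally_integrable (g k)"
  shows "locally_integrable (\<lambda>x. \<Sum>k\<in>A. c k * g k x)"
  unfolding locally_integrable_def set_integrable_def
proof (intro allI impI)
  fix K :: "(real^'d) set" assume "compact K"
  then have "integrable lebesgue (\<lambda>x. \<Sum>k\<in>A. c k * (indicator K x *\<^sub>R g k x))"
    using assms unfolding locally_integrable_def set_integrable_def
    by (intro Bochner_Integration.integrable_sum Bochner_Integration.integrable_mult_right) auto
  then show "integrable lebesgue (\<lambda>x. indicator K x *\<^sub>R (\<Sum>k\<in>A. c k * g k x))"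
    by (simp add: sum_distrib_left mult.left_commute)
qed

lemma is_weak_deriv_sum:
  fixes g h :: "'k \<Rightarrow> real^'d::finite \<Rightarrow> real"
  assumes A: "finite A" and w: "\<And>k. k \<in> A \<Longrightarrow> is_weak_deriv \<beta> (g k) (h k)"
  shows "is_weak_deriv \<beta> (\<lambda>x. \<Sum>k\<in>A. c k * g k x) (\<lambda>x. \<Sum>k\<in>A. c k * h k x)"
  unfolding is_weak_deriv_def
proof (intro conjI allI impI locally_integrable_sum A)
  show l: "locally_integrable (g k)" "locally_integrable (h k)" if "k \<in> A" for k
    using w[OF that] by (auto simp: is_weak_deriv_def)
  fix \<phi> :: "real^'d \<Rightarrow> real" assume \<phi>: "test_function \<phi>"
  note D = test_function_classical_D[OF \<phi>]
  have "(LINT x|lebesgue. (\<Sum>k\<in>A. c k * g k x) * classical_D \<beta> \<phi> x)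
      = (LINT x|lebesgue. (\<Sum>k\<in>A. c k * (g k x * classical_D \<beta> \<phi> x)))"
    by (simp add: sum_distrib_right mult.assoc)
  also have "\<dots> = (\<Sum>k\<in>A. c k * (LINT x|lebesgue. g k x * classical_D \<beta> \<phi> x))"
    using locally_integrable_mult_test[OF l(1) D] by (subst Bochner_Integration.integral_sum) auto
  also have "\<dots> = (\<Sum>k\<in>A. c k * ((-1) ^ mi_abs \<beta> * (LINT x|lebesgue. h k x * \<phi> x)))"
    using w \<phi> by (intro sum.cong) (auto simp: is_weak_deriv_def)
  also have "\<dots> = (-1) ^ mi_abs \<beta> * (\<Sum>k\<in>A. c k * (LINT x|lebesgue. h k x * \<phi> x))"
    by (simp add: sum_distrib_left mult.left_commute)
  also have "(\<Sum>k\<in>A. c k * (LINT x|lebesgue. h k x * \<phi> x)) = (LINT x|lebesgue. (\<Sum>k\<in>A. c k * (h k x * \<phi> x)))"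
    using locally_integrable_mult_test[OF l(2) \<phi>] by (subst Bochner_Integration.integral_sum) auto
  finally show "(LINT x|lebesgue. (\<Sum>k\<in>A. c k * g k x) * classical_D \<beta> \<phi> x) =
      (-1) ^ mi_abs \<beta> * (LINT x|lebesgue. (\<Sum>k\<in>A. c k * h k x) * \<phi> x)"
    by (simp add: sum_distrib_right mult.assoc)
qed

lemma modulus_cong_AE:
  assumes "1 \<le> p" "f \<in> Lp_space p" "AE x in lebesgue. f x = g x"
  shows "modulus p s g \<delta> = modulus p s f \<delta>"
proof -
  have "Lp_norm p (fin_diff s h g) = Lp_norm p (fin_diff s h f)" for h
    unfolding fin_diff_eq_mdiff
    by (rule Lp_cong_AE(2)[OF _ mdiff_cong_AE[OF assms(3)]]) (use mdiff_Lp[OF assms(1,2)] in blast)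
  then show ?thesis by (simp add: modulus_def)
qed

lemma mi_component_le: "\<beta> i \<le> mi_abs (\<beta> :: 'd::finite \<Rightarrow> nat)"
  unfolding mi_abs_def by (intro member_le_sum) auto

text \<open>With \<open>y\<close> distributed by \<open>law\<close>, \<open>g\<close> is the average
  of the sum over \<open>k = 1..s\<close> of
  \<open>(-1) ^ Suc k * (s choose k) * f (x + k *\<^sub>R y)\<close>. The missing term
  \<open>k = 0\<close> is \<open>f\<close> itself, so \<open>f - g\<close> is, up to sign, an
  average of s-th differences with step \<open>y\<close>. Each summand of \<open>g\<close> is a
  segment average and hence has weak derivatives that are averaged mixed differences of
  \<open>f\<close>.\<close>

lemma Steklov_approximation_borel:
  fixes f :: "real^'d::finite \<Rightarrow> real"
  assumes p: "1 \<le> p" and s: "1 \<le> s" and f: "f \<in> borel_measurable borel" "f \<in> Lp_space p" and \<delta>: "0 < \<delta>"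
  defines "m \<equiv> 2 * real s ^ 2 * real CARD('d)"
  shows "\<exists>g\<in>Sobolev p s. Lp_norm p (\<lambda>x. f x - g x) \<le> modulus p s f \<delta> \<and>
     Sobolev_seminorm p s g \<le> real (card {\<beta> :: 'd \<Rightarrow> nat. mi_abs \<beta> = s}) * (4 ^ s * (m / \<delta>) ^ s * modulus p s f \<delta>)"
proof -
  \<comment> \<open>\<open>m\<close> serves two purposes: the \<open>s * CARD('d)\<close> segments
    of length \<open>h\<close> have total length \<open>\<delta> / (2 * s)\<close>, and
    \<open>s\<close> steps of length at most \<open>s * h\<close> have total length at most
    \<open>\<delta> / (2 * CARD('d))\<close>. Both are below \<open>\<delta>\<close>.\<close>
  define h where "h = \<delta> / m"
  have d1: "1 \<le> real CARD('d)" by (simp add: Suc_le_eq)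
  have s1: "1 \<le> real s" using s by simp
  have m0: "0 < m" unfolding m_def using s1 d1 by simp
  have h: "0 < h" using \<delta> m0 by (simp add: h_def)
  define \<omega> where "\<omega> = modulus p s f \<delta>"
  have \<omega>0: "0 \<le> \<omega>" unfolding \<omega>_def by (rule modulus_nonneg[OF p f(2) \<delta>])
  obtain E :: "'d list" where E: "set E = UNIV" "distinct E"
    using finite_distinct_list[OF finite[of "UNIV :: 'd set"]] by blast
  \<comment> \<open>Every direction occurs \<open>s\<close> times, which suffices for every
    multi-index of order at most \<open>s\<close>.\<close>
  define J where "J = concat (replicate s E)"
  have cJ: "count_list J i = s" for i
  proof -
    have "count_list E i = 1"
      using E distinct_count_atmost_1[of E] by (simp flip: count_mset)
    then have "count_list (concat (replicate n E)) i = n" for n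
      by (induction n) simp_all
    then show ?thesis by (simp add: J_def)
  qed
  have lJ: "length J = s * CARD('d)"
    using E by (simp add: J_def length_concat sum_list_replicate distinct_card[symmetric])
  let ?v = "\<lambda>c K. map (\<lambda>i::'d. axis i c) K :: (real^'d) list"
  have nv: "(\<Sum>v\<leftarrow>?v c K. norm v) = real (length K) * \<bar>c\<bar>" for c and K
    by (induction K) (auto simp: norm_axis algebra_simps)
  let ?\<mu> = "law (?v h J)"
  define c where "c k = (-1) ^ Suc k * real (s choose k)" for k
  define g where "g x = (\<Sum>k\<in>{1..s}. c k * avg (law (?v (real k * h) J)) f x)" for x
  have sc: "law (?v (real k * h) J) = distr ?\<mu> borel ((*\<^sub>R) (real k))" for k
    unfolding law_scale by (rule arg_cong[of _ _ law]) (auto simp: vec_eq_iff axis_def)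
  have mk: "(*\<^sub>R) (real k) \<in> borel_measurable ?\<mu>" for k
    by (simp add: measurable_cong_sets[OF sets_law refl])
  have avk: "avg (law (?v (real k * h) J)) f x = (LINT y|?\<mu>. f (x + real k *\<^sub>R y))" for k x
    unfolding sc avg_def using f by (subst integral_distr[OF mk]) auto
  have P: "prob_space ?\<mu>" using bounded_law_law by (auto simp: bounded_law_def)
  then interpret \<mu>: prob_space ?\<mu> .
  have gb: "g \<in> borel_measurable borel"
    unfolding g_def using avg_measurable[OF bounded_law_law f(1)] by measurable
  have gL: "g \<in> Lp_space p"
    unfolding g_def
    using Lp_sum[OF p, of "{1..s}" "\<lambda>k x. c k * avg (law (?v (real k * h) J)) f x"]
      Lp_cmult(1)[OF avg_Lp(1)[OF bounded_law_law p f]] p by auto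
  have weak: "\<exists>H\<in>Lp_space p. is_weak_deriv \<beta> g H \<and>
      Lp_norm p H \<le> (\<Sum>k\<in>{1..s}. \<bar>c k\<bar> * ((1 / (real k * h)) ^ mi_abs \<beta> * Lp_norm p (mdiff (?v (real k * h) (mi_list \<beta>)) f)))"
    if \<beta>: "mi_abs \<beta> \<le> s" for \<beta>
  proof -
    have "\<exists>H. H \<in> Lp_space p \<and> is_weak_deriv \<beta> (avg (law (?v (real k * h) J)) f) H \<and>
      Lp_norm p H \<le> (1 / (real k * h)) ^ mi_abs \<beta> * Lp_norm p (mdiff (?v (real k * h) (mi_list \<beta>)) f)"
      if "k \<in> {1..s}" for k
    proof -
      have "0 < real k * h" using that h by simp
      moreover have "\<beta> i \<le> count_list J i" for i
        using \<beta> mi_component_le[of \<beta> i] by (simp add: cJ)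
      ultimately show ?thesis
        using avg_law_weak_deriv[OF p f, of "real k * h" \<beta> J] by metis
    qed
    then obtain H where H: "H k \<in> Lp_space p" "is_weak_deriv \<beta> (avg (law (?v (real k * h) J)) f) (H k)"
      "Lp_norm p (H k) \<le> (1 / (real k * h)) ^ mi_abs \<beta> * Lp_norm p (mdiff (?v (real k * h) (mi_list \<beta>)) f)"
      if "k \<in> {1..s}" for k by metis
    have cH: "(\<lambda>x. c k * H k x) \<in> Lp_space p" "Lp_norm p (\<lambda>x. c k * H k x) = \<bar>c k\<bar> * Lp_norm p (H k)"
      if "k \<in> {1..s}" for k
      using Lp_cmult[OF H(1)[OF that]] p by auto
    have S: "(\<lambda>x. \<Sum>k\<in>{1..s}. c k * H k x) \<in> Lp_space p"
      "Lp_norm p (\<lambda>x. \<Sum>k\<in>{1..s}. c k * H k x) \<le> (\<Sum>k\<in>{1..s}. Lp_norm p (\<lambda>x. c k * H k x))"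
      using Lp_sum[OF p, of "{1..s}" "\<lambda>k x. c k * H k x"] cH(1) by auto
    have "is_weak_deriv \<beta> g (\<lambda>x. \<Sum>k\<in>{1..s}. c k * H k x)"
      unfolding g_def[abs_def] by (rule is_weak_deriv_sum) (use H(2) in auto)
    moreover have "(\<Sum>k\<in>{1..s}. Lp_norm p (\<lambda>x. c k * H k x)) \<le>
        (\<Sum>k\<in>{1..s}. \<bar>c k\<bar> * ((1 / (real k * h)) ^ mi_abs \<beta> * Lp_norm p (mdiff (?v (real k * h) (mi_list \<beta>)) f)))"
      using H(3) by (intro sum_mono) (simp add: cH(2) mult_left_mono)
    ultimately show ?thesis using S by (meson order_trans)
  qed
  have gS: "g \<in> Sobolev p s"
    using gL weak by (auto simp: Sobolev_def has_weak_deriv_in_Lp_def)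
  have semi: "Lp_norm p (weak_D \<beta> g) \<le> 4 ^ s * (m / \<delta>) ^ s * \<omega>" if \<beta>: "mi_abs \<beta> = s" for \<beta>
  proof -
    obtain H where H: "H \<in> Lp_space p" "is_weak_deriv \<beta> g H"
      "Lp_norm p H \<le> (\<Sum>k\<in>{1..s}. \<bar>c k\<bar> * ((1 / (real k * h)) ^ s * Lp_norm p (mdiff (?v (real k * h) (mi_list \<beta>)) f)))"
      using weak[of \<beta>] \<beta> by auto
    have "(\<Sum>k\<in>{1..s}. \<bar>c k\<bar> * ((1 / (real k * h)) ^ s * Lp_norm p (mdiff (?v (real k * h) (mi_list \<beta>)) f)))
        \<le> (\<Sum>k\<in>{1..s}. real (s choose k) * ((1 / h) ^ s * (2 ^ s * \<omega>)))"
    proof (rule sum_mono)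
      fix k assume k: "k \<in> {1..s}"
      have kh: "real k * h \<le> real s * h" using k h by (intro mult_right_mono) auto
      have "real s * (real k * h) \<le> real s * (real s * h)"
        using kh by (intro mult_left_mono) auto
      also have "\<dots> = \<delta> / (2 * real CARD('d))"
        using s1 by (simp add: h_def m_def power2_eq_square)
      also have "\<dots> < \<delta>"
      proof -
        have "1 < 2 * real CARD('d)" using d1 by linarith
        then show ?thesis using \<delta> by (simp add: pos_divide_less_eq)
      qed
      finally have lt: "(\<Sum>v\<leftarrow>?v (real k * h) (mi_list \<beta>). norm v) < \<delta>"
        using h unfolding nv by (simp add: length_mi_list \<beta>)
      have "Lp_norm p (mdiff (?v (real k * h) (mi_list \<beta>)) f) \<le> 2 ^ length (?v (real k * h) (mi_list \<beta>)) * \<omega>"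
      proof (rule mdiff_bound_by_fin_diff[OF p f(2)])
        fix u :: "real^'d" assume "norm u \<le> (\<Sum>v\<leftarrow>?v (real k * h) (mi_list \<beta>). norm v)"
        then have "norm u < \<delta>" using lt by simp
        then show "Lp_norm p (fin_diff (length (?v (real k * h) (mi_list \<beta>))) u f) \<le> \<omega>"
          using fin_diff_le_modulus[OF p f(2)] by (simp add: \<omega>_def length_mi_list \<beta>)
      qed
      then have 1: "Lp_norm p (mdiff (?v (real k * h) (mi_list \<beta>)) f) \<le> 2 ^ s * \<omega>"
        by (simp add: length_mi_list \<beta>)
      have "h \<le> real k * h" using k h by simp
      then have 2: "(1 / (real k * h)) ^ s \<le> (1 / h) ^ s"
        using h by (intro power_mono divide_left_mono mult_pos_pos) auto
      have "\<bar>c k\<bar> = real (s choose k)"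
        by (simp add: c_def abs_mult)
      then show "\<bar>c k\<bar> * ((1 / (real k * h)) ^ s * Lp_norm p (mdiff (?v (real k * h) (mi_list \<beta>)) f))
        \<le> real (s choose k) * ((1 / h) ^ s * (2 ^ s * \<omega>))"
        using 1 2 h by (auto intro!: mult_left_mono mult_mono)
    qed
    also have "\<dots> = (\<Sum>k\<in>{1..s}. real (s choose k)) * ((1 / h) ^ s * (2 ^ s * \<omega>))"
      by (simp add: sum_distrib_right)
    \<comment> \<open>The binomial coefficients sum to at most \<open>2 ^ s\<close>; with the
      \<open>2 ^ s\<close> from the mixed differences this gives \<open>4 ^ s\<close>.\<close>
    also have "\<dots> \<le> 2 ^ s * ((1 / h) ^ s * (2 ^ s * \<omega>))"
    proof (rule mult_right_mono)
      have "(\<Sum>k\<in>{1..s}. real (s choose k)) \<le> (\<Sum>k\<in>{..s}. real (s choose k))"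
        by (rule sum_mono2) auto
      also have "\<dots> = real (\<Sum>k\<le>s. s choose k)" by simp
      also have "\<dots> = 2 ^ s" by (simp only: choose_row_sum) simp
      finally show "(\<Sum>k\<in>{1..s}. real (s choose k)) \<le> 2 ^ s" .
      show "0 \<le> (1 / h) ^ s * (2 ^ s * \<omega>)" using h \<omega>0 by simp
    qed
    also have "\<dots> = (2 * 2) ^ s * (m / \<delta>) ^ s * \<omega>"
      unfolding h_def power_mult_distrib by simp
    finally have "Lp_norm p H \<le> 4 ^ s * (m / \<delta>) ^ s * \<omega>"
      using H(3) by simp
    then show ?thesis
      using weak_D_Lp(3)[OF H(2,1)] by simp
  qed
  have "Sobolev_seminorm p s g \<le> (\<Sum>\<beta>\<in>{\<beta> :: 'd \<Rightarrow> nat. mi_abs \<beta> = s}. 4 ^ s * (m / \<delta>) ^ s * \<omega>)"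
    unfolding Sobolev_seminorm_def using semi by (intro sum_mono) auto
  then have semi': "Sobolev_seminorm p s g \<le> real (card {\<beta> :: 'd \<Rightarrow> nat. mi_abs \<beta> = s}) * (4 ^ s * (m / \<delta>) ^ s * \<omega>)"
    by simp
  have Y: "(\<lambda>y. real k *\<^sub>R y) \<in> borel_measurable ?\<mu>" for k by (rule mk)
  have "AE x in lebesgue. \<forall>k\<in>{..s}. integrable ?\<mu> (\<lambda>y. f (x + real k *\<^sub>R y))"
    by (intro AE_finite_allI) (auto intro: AE_integrable_translates[OF p f P Y])
  then have fg: "AE x in lebesgue. (-1) ^ s * (LINT y|?\<mu>. fin_diff s y f x) = f x - g x"
  proof eventually_elim
    case (elim x)
    have "(LINT y|?\<mu>. fin_diff s y f x) = (\<Sum>k\<le>s. real (s choose k) * (-1) ^ (s - k) * (LINT y|?\<mu>. f (x + real k *\<^sub>R y)))"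
      unfolding fin_diff_reindex using elim by (subst Bochner_Integration.integral_sum) auto
    then have "(-1) ^ s * (LINT y|?\<mu>. fin_diff s y f x) = (\<Sum>k\<le>s. ((-1) ^ s * (-1) ^ (s - k)) * (real (s choose k) * (LINT y|?\<mu>. f (x + real k *\<^sub>R y))))"
      by (simp add: sum_distrib_left mult_ac)
    also have "\<dots> = (\<Sum>k\<le>s. (-1) ^ k * (real (s choose k) * (LINT y|?\<mu>. f (x + real k *\<^sub>R y))))"
    proof (rule sum.cong)
      fix k assume "k \<in> {..s}"
      then have "(-1 :: real) ^ s * (-1) ^ (s - k) = (-1) ^ k"
        by (auto simp: power_add[symmetric] minus_one_power_iff)
      then show "((-1) ^ s * (-1) ^ (s - k)) * (real (s choose k) * (LINT y|?\<mu>. f (x + real k *\<^sub>R y)))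
        = (-1) ^ k * (real (s choose k) * (LINT y|?\<mu>. f (x + real k *\<^sub>R y)))" by simp
    qed simp
    also have "\<dots> = f x + (\<Sum>k\<in>{1..s}. (-1) ^ k * (real (s choose k) * (LINT y|?\<mu>. f (x + real k *\<^sub>R y))))"
      by (subst sum.atMost_shift[of _ s]) (simp add: \<mu>.prob_space[unfolded space_law] sum.atLeast1_atMost_eq)
    also have "\<dots> = f x - g x"
      unfolding g_def avk by (simp add: c_def sum_negf[symmetric] mult.assoc)
    finally show ?case .
  qed
  have "(\<lambda>(x, y). fin_diff s y f x) \<in> borel_measurable (borel \<Otimes>\<^sub>M borel)"
    unfolding fin_diff_def using f(1) by measurable
  then have meas: "case_prod (\<lambda>x y. fin_diff s y f x) \<in> borel_measurable (lborel \<Otimes>\<^sub>M ?\<mu>)"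
    using borel_measurable_pair_cong[OF sets_lborel sets_law] by blast
  have bd: "AE y in ?\<mu>. (\<lambda>x. fin_diff s y f x) \<in> Lp_space p \<and> Lp_norm p (\<lambda>x. fin_diff s y f x) \<le> \<omega>"
  proof -
    have "AE y in ?\<mu>. norm y \<le> (\<Sum>v\<leftarrow>?v h J. norm v)"
      using bounded_law_law[of "?v h J"] by (simp add: bounded_law_def)
    then show ?thesis
    proof eventually_elim
      case (elim y)
      have "(\<Sum>v\<leftarrow>?v h J. norm v) = \<delta> / (2 * real s)"
        unfolding nv lJ using h s1 d1 \<delta> by (simp add: h_def m_def power2_eq_square)
      also have "\<dots> < \<delta>" using \<delta> s1 by (simp add: field_simps)
      finally have "norm y < \<delta>" using elim by simp
      then show ?case
        using fin_diff_le_modulus[OF p f(2), of y \<delta> s] mdiff_Lp[OF p f(2), of "replicate s y"]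
        by (auto simp: \<omega>_def fin_diff_eq_mdiff)
    qed
  qed
  note av = Lp_average[OF P p meas \<omega>0 bd]
  have "Lp_norm p (\<lambda>x. f x - g x) = Lp_norm p (\<lambda>x. (-1) ^ s * (LINT y|?\<mu>. fin_diff s y f x))"
    using Lp_cong_AE(2)[OF Lp_cmult(1)[OF av(1)] fg] p by simp
  also have "\<dots> \<le> \<omega>"
    using Lp_cmult(2)[OF av(1), of "(-1) ^ s"] av(2) p by (simp add: power_abs)
  finally show ?thesis
    using gS semi' by (auto simp: \<omega>_def intro!: bexI[of _ g])
qed

text \<open>Multiplication by \<open>\<delta> ^ s\<close> cancels the scale in
  \<open>(m / \<delta>) ^ s\<close>, so the constant depends on \<open>s\<close> and the dimension
  only.\<close>

lemma Steklov_approximation: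
  fixes p :: real
  assumes p: "1 \<le> p" and s: "1 \<le> s"
  obtains C where "0 < C" "\<And>(f :: real^'d::finite \<Rightarrow> real) \<delta>. f \<in> Lp_space p \<Longrightarrow> 0 < \<delta> \<Longrightarrow>
    \<exists>g\<in>Sobolev p s. Lp_norm p (\<lambda>x. f x - g x) \<le> modulus p s f \<delta> \<and>
      \<delta> ^ s * Sobolev_seminorm p s g \<le> C * modulus p s f \<delta>"
proof -
  define m where "m = 2 * real s ^ 2 * real CARD('d)"
  define C where "C = real (card {\<beta> :: 'd \<Rightarrow> nat. mi_abs \<beta> = s}) * (4 ^ s * m ^ s)"
  have C0: "0 \<le> C" by (simp add: C_def m_def)
  show ?thesis
  proof
    show "0 < C + 1" using C0 by simp
    fix f :: "real^'d \<Rightarrow> real" and \<delta> :: real assume f: "f \<in> Lp_space p" and \<delta>: "0 < \<delta>"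
    obtain f' where f': "f' \<in> borel_measurable borel" "AE x in lebesgue. f x = f' x"
      using borel_version[OF Lp_space_measurable[OF f]] by blast
    have f'L: "f' \<in> Lp_space p" by (rule Lp_cong_AE(1)[OF f f'(2)])
    have \<omega>: "modulus p s f' \<delta> = modulus p s f \<delta>" by (rule modulus_cong_AE[OF p f f'(2)])
    have \<omega>0: "0 \<le> modulus p s f \<delta>" by (rule modulus_nonneg[OF p f \<delta>])
    obtain g where g: "g \<in> Sobolev p s" "Lp_norm p (\<lambda>x. f' x - g x) \<le> modulus p s f \<delta>"
      "Sobolev_seminorm p s g \<le> real (card {\<beta> :: 'd \<Rightarrow> nat. mi_abs \<beta> = s}) * (4 ^ s * (m / \<delta>) ^ s * modulus p s f \<delta>)"
      using Steklov_approximation_borel[OF p s f'(1) f'L \<delta>] unfolding \<omega> m_def by blast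
    have fg: "(\<lambda>x. f x - g x) \<in> Lp_space p"
      by (rule Lp_diff(1)[OF p f Sobolev_Lp[OF g(1)]])
    have "Lp_norm p (\<lambda>x. f' x - g x) = Lp_norm p (\<lambda>x. f x - g x)"
      by (rule Lp_cong_AE(2)[OF fg]) (use f'(2) in eventually_elim, simp)
    moreover have "\<delta> ^ s * Sobolev_seminorm p s g \<le> C * modulus p s f \<delta>"
    proof -
      have "\<delta> ^ s * Sobolev_seminorm p s g \<le> \<delta> ^ s * (real (card {\<beta> :: 'd \<Rightarrow> nat. mi_abs \<beta> = s}) * (4 ^ s * (m / \<delta>) ^ s * modulus p s f \<delta>))"
        using g(3) \<delta> by (intro mult_left_mono) auto
      also have "\<dots> = C * modulus p s f \<delta>"
        using \<delta> by (simp add: C_def power_divide)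
      finally show ?thesis .
    qed
    moreover have "C * modulus p s f \<delta> \<le> (C + 1) * modulus p s f \<delta>"
      using \<omega>0 by (intro mult_right_mono) auto
    ultimately show "\<exists>g\<in>Sobolev p s. Lp_norm p (\<lambda>x. f x - g x) \<le> modulus p s f \<delta> \<and>
      \<delta> ^ s * Sobolev_seminorm p s g \<le> (C + 1) * modulus p s f \<delta>"
      using g by (intro bexI[of _ g]) auto
  qed
qed

section \<open>The seminorm of functions with bounded higher derivatives\<close>

lemma count_list_singleton: "count_list [i] = mi_unit i"
  by (auto simp: mi_unit_def)

text \<open>For a derivative \<open>F\<close> of order \<open>s\<close>, the mixed difference of
  \<open>g\<close> with step \<open>h\<close> is \<open>h ^ s\<close> times an average of
  \<open>F\<close>. The bound on the first derivatives of \<open>F\<close> keeps this average within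
  half the norm of \<open>F\<close>, so \<open>F\<close> has at most twice the norm of its average,
  and that is controlled by the modulus of \<open>g\<close>.\<close>

lemma seminorm_le_modulus:
  fixes g :: "real^'d::finite \<Rightarrow> real"
  assumes p: "1 \<le> p" and s: "1 \<le> s" and \<sigma>: "0 < \<sigma>" and g: "g \<in> Sobolev p s" and b: "0 < b" "B \<le> b"
    and db: "\<And>\<beta> i. mi_abs \<beta> = s \<Longrightarrow> has_weak_deriv_in_Lp p (mi_unit i) (weak_D \<beta> g) \<and>
      Lp_norm p (weak_D (mi_unit i) (weak_D \<beta> g)) \<le> B * \<sigma> * Lp_norm p (weak_D \<beta> g)"
  defines "m \<equiv> 2 * real s * real CARD('d) * (b + 1)"
  shows "(1 / \<sigma>) ^ s * Sobolev_seminorm p s g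
    \<le> real (card {\<beta> :: 'd \<Rightarrow> nat. mi_abs \<beta> = s}) * (2 * 2 ^ s * m ^ s) * modulus p s g (1 / \<sigma>)"
proof -
  define h where "h = 1 / (m * \<sigma>)"
  have d1: "1 \<le> real CARD('d)" by (simp add: Suc_le_eq)
  have s1: "1 \<le> real s" using s by simp
  have m0: "0 < m" unfolding m_def using s1 d1 b by (intro mult_pos_pos) auto
  have h: "0 < h" using \<sigma> m0 by (simp add: h_def)
  define \<omega> where "\<omega> = modulus p s g (1 / \<sigma>)"
  let ?v = "\<lambda>c K. map (\<lambda>i::'d. axis i c) K :: (real^'d) list"
  have nv: "(\<Sum>v\<leftarrow>?v c K. norm v) = real (length K) * \<bar>c\<bar>" for c and K
    by (induction K) (auto simp: norm_axis algebra_simps)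
  \<comment> \<open>The equation that determines \<open>m\<close>. As
    \<open>2 * CARD('d) * (b + 1) > 1\<close>, it yields \<open>real s * h < 1 / \<sigma>\<close>,
    so all steps are admissible in the modulus; as \<open>b \<le> b + 1\<close>, it yields the
    factor 1/2 in the comparison of \<open>F\<close> with its average.\<close>
  have sh: "real s * h * (2 * real CARD('d) * (b + 1) * \<sigma>) = 1"
    using s1 \<sigma> b d1 by (simp add: h_def m_def)
  have main: "(1 / \<sigma>) ^ s * Lp_norm p (weak_D \<beta> g) \<le> (2 * 2 ^ s * m ^ s) * \<omega>" if \<beta>: "mi_abs \<beta> = s" for \<beta>
  proof -
    define F where "F = weak_D \<beta> g"
    have F: "is_weak_deriv \<beta> g F" "F \<in> Lp_space p"
      unfolding F_def using Sobolev_weak_D[OF g, of \<beta>] \<beta> by auto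
    have gL: "g \<in> Lp_space p" by (rule Sobolev_Lp[OF g])
    obtain g' where g': "g' \<in> borel_measurable borel" "AE x in lebesgue. g x = g' x"
      using borel_version[OF Lp_space_measurable[OF gL]] by blast
    obtain F' where F': "F' \<in> borel_measurable borel" "AE x in lebesgue. F x = F' x"
      using borel_version[OF Lp_space_measurable[OF F(2)]] by blast
    have g'L: "g' \<in> Lp_space p" by (rule Lp_cong_AE(1)[OF gL g'(2)])
    have F'L: "F' \<in> Lp_space p" by (rule Lp_cong_AE(1)[OF F(2) F'(2)])
    have F'n: "Lp_norm p F' = Lp_norm p F" by (rule Lp_cong_AE(2)[OF F(2) F'(2)])
    have w': "is_weak_deriv \<beta> g' F'"
      by (rule is_weak_deriv_cong_AE[OF F(1) g'(2) F'(2)]) (intro Lp_locally_integrable[OF _ p] g'L F'L)+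
    let ?vs = "?v h (mi_list \<beta>)"
    let ?\<mu> = "law ?vs"
    have sumv: "(\<Sum>v\<leftarrow>?vs. norm v) = real s * h"
      unfolding nv using h by (simp add: length_mi_list \<beta>)
    have P: "prob_space ?\<mu>" using bounded_law_law by (auto simp: bounded_law_def)
    then interpret \<mu>: prob_space ?\<mu> .
    have Pr: "(\<Prod>i\<leftarrow>K. h) = h ^ length K" for K :: "'d list"
      by (induction K) auto
    have avL: "avg ?\<mu> F' \<in> Lp_space p" by (rule avg_Lp(1)[OF bounded_law_law p F'(1) F'L])
    have ae: "AE x in lebesgue. mdiff ?vs g' x = h ^ s * avg ?\<mu> F' x"
      using mdiff_weak_deriv_mi_list[OF p g'(1) g'L F'(1) F'L w', of "\<lambda>_. h"] unfolding Pr
      by (simp add: length_mi_list \<beta>)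
    have mL: "mdiff ?vs g' \<in> Lp_space p" using mdiff_Lp[OF p g'L] by blast
    have "h ^ s * Lp_norm p (avg ?\<mu> F') = Lp_norm p (\<lambda>x. h ^ s * avg ?\<mu> F' x)"
      using Lp_cmult(2)[OF avL, of "h ^ s"] p h by simp
    also have "\<dots> = Lp_norm p (mdiff ?vs g')"
      by (rule Lp_cong_AE(2)[OF mL ae])
    also have "\<dots> \<le> 2 ^ length ?vs * \<omega>"
    proof (rule mdiff_bound_by_fin_diff[OF p g'L])
      fix u :: "real^'d" assume u: "norm u \<le> (\<Sum>v\<leftarrow>?vs. norm v)"
      have "1 < 2 * real CARD('d) * (b + 1)"
        using d1 b mult_mono[of 1 "real CARD('d)" 1 "b + 1"] by simp
      then have "real s * h * \<sigma> < real s * h * \<sigma> * (2 * real CARD('d) * (b + 1))"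
        using s1 h \<sigma> by simp
      also have "\<dots> = 1" using sh by (simp add: mult_ac)
      finally have "real s * h < 1 / \<sigma>" using \<sigma> by (simp add: field_simps)
      then have "norm u < 1 / \<sigma>" using u sumv by simp
      then have "Lp_norm p (fin_diff s u g') \<le> modulus p s g' (1 / \<sigma>)"
        by (rule fin_diff_le_modulus[OF p g'L])
      then show "Lp_norm p (fin_diff (length ?vs) u g') \<le> \<omega>"
        using modulus_cong_AE[OF p gL g'(2)] by (simp add: \<omega>_def length_mi_list \<beta>)
    qed
    finally have A: "h ^ s * Lp_norm p (avg ?\<mu> F') \<le> 2 ^ s * \<omega>"
      by (simp add: length_mi_list \<beta>)
    have Y: "(\<lambda>y. y) \<in> borel_measurable ?\<mu>"
      by (simp add: measurable_cong_sets[OF sets_law refl])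
    have diffae: "AE x in lebesgue. (LINT y|?\<mu>. diff_op y F' x) = avg ?\<mu> F' x - F' x"
      using AE_integrable_translates[OF p F'(1) F'L P Y]
      by eventually_elim (simp add: diff_op_def avg_def \<mu>.prob_space[unfolded space_law])
    have "(\<lambda>(x, y). diff_op y F' x) \<in> borel_measurable (borel \<Otimes>\<^sub>M borel)"
      unfolding diff_op_def using F'(1) by measurable
    then have meas: "case_prod (\<lambda>x y. diff_op y F' x) \<in> borel_measurable (lborel \<Otimes>\<^sub>M ?\<mu>)"
      using borel_measurable_pair_cong[OF sets_lborel sets_law] by blast
    have coord: "Lp_norm p (diff_op (axis i t) F') \<le> \<bar>t\<bar> * (b * \<sigma> * Lp_norm p F)" for i t
    proof -
      obtain H where H: "H \<in> Lp_space p" "is_weak_deriv (mi_unit i) F H"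
        using db[OF \<beta>, of i] by (auto simp: has_weak_deriv_in_Lp_def F_def)
      have Hn: "Lp_norm p H \<le> b * \<sigma> * Lp_norm p F"
      proof -
        have "Lp_norm p H \<le> B * \<sigma> * Lp_norm p F"
          using db[OF \<beta>, of i] weak_D_Lp(3)[OF H(2,1)] by (simp add: F_def)
        also have "\<dots> \<le> b * \<sigma> * Lp_norm p F"
          using b \<sigma> by (intro mult_right_mono) auto
        finally show ?thesis .
      qed
      have "Lp_norm p (diff_op (axis i t) F') = Lp_norm p (mdiff (map (\<lambda>i. axis i t) [i]) F)"
        using Lp_cong_AE(2)[OF _ mdiff_cong_AE[OF F'(2), of "map (\<lambda>i. axis i t) [i]"]] diff_op_Lp(1)[OF p F(2)] by simp
      also have "\<dots> \<le> \<bar>\<Prod>i\<leftarrow>[i]. t\<bar> * Lp_norm p H"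
        by (rule mdiff_weak_deriv_bound[OF p F(2) H(1)]) (use H(2) in \<open>simp only: count_list_singleton\<close>)
      also have "\<dots> \<le> \<bar>t\<bar> * (b * \<sigma> * Lp_norm p F)"
        using Hn by (simp add: mult_left_mono)
      finally show ?thesis .
    qed
    have bd: "AE y in ?\<mu>. (\<lambda>x. diff_op y F' x) \<in> Lp_space p \<and> Lp_norm p (\<lambda>x. diff_op y F' x) \<le> Lp_norm p F / 2"
    proof -
      have "AE y in ?\<mu>. norm y \<le> real s * h"
        using bounded_law_law[of ?vs] unfolding sumv by (simp add: bounded_law_def)
      then show ?thesis
      proof eventually_elim
        case (elim y)
        have "Lp_norm p (diff_op y F') \<le> (\<Sum>i\<in>UNIV. Lp_norm p (diff_op (axis i (y $ i)) F'))"
          by (rule diff_op_bound_coordinates[OF p F'L])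
        also have "\<dots> \<le> (\<Sum>i\<in>(UNIV :: 'd set). (real s * h) * (b * \<sigma> * Lp_norm p F))"
        proof (rule sum_mono)
          fix i :: 'd
          have "\<bar>y $ i\<bar> \<le> real s * h" using component_le_norm_cart[of y i] elim by linarith
          then show "Lp_norm p (diff_op (axis i (y $ i)) F') \<le> (real s * h) * (b * \<sigma> * Lp_norm p F)"
            using b \<sigma> by (intro order_trans[OF coord] mult_right_mono) auto
        qed
        also have "\<dots> = (real s * h * real CARD('d) * b * \<sigma>) * Lp_norm p F"
          by simp
        also have "\<dots> \<le> (1 / 2) * Lp_norm p F"
        proof (rule mult_right_mono)
          have "real s * h * real CARD('d) * b * \<sigma> \<le> real s * h * real CARD('d) * (b + 1) * \<sigma>"
            using h \<sigma> s1 d1 by (intro mult_right_mono mult_left_mono) auto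
          also have "\<dots> = 1 / 2" using sh by (simp add: mult_ac)
          finally show "real s * h * real CARD('d) * b * \<sigma> \<le> 1 / 2" .
        qed simp
        finally show ?case
          using diff_op_Lp(1)[OF p F'L] by simp
      qed
    qed
    have F0: "0 \<le> Lp_norm p F / 2" by simp
    note av = Lp_average[OF P p meas F0 bd]
    have dL: "(\<lambda>x. avg ?\<mu> F' x - F' x) \<in> Lp_space p" "Lp_norm p (\<lambda>x. avg ?\<mu> F' x - F' x) \<le> Lp_norm p F / 2"
      using Lp_cong_AE(1)[OF av(1) diffae] Lp_cong_AE(2)[OF av(1) diffae] av(2) by auto
    have "Lp_norm p F' \<le> Lp_norm p (avg ?\<mu> F') + Lp_norm p (\<lambda>x. avg ?\<mu> F' x - F' x)"
      using Lp_diff(2)[OF p avL dL(1)] by simp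
    then have "Lp_norm p F \<le> 2 * Lp_norm p (avg ?\<mu> F')"
      using dL(2) F'n by simp
    then have "h ^ s * Lp_norm p F \<le> h ^ s * (2 * Lp_norm p (avg ?\<mu> F'))"
      using h by (intro mult_left_mono) auto
    then have "h ^ s * Lp_norm p F \<le> 2 * (2 ^ s * \<omega>)"
      using A by simp
    then have "m ^ s * (h ^ s * Lp_norm p F) \<le> m ^ s * (2 * (2 ^ s * \<omega>))"
      using m0 by (intro mult_left_mono) auto
    also have "\<dots> = (2 * 2 ^ s * m ^ s) * \<omega>" by simp
    also have "m ^ s * (h ^ s * Lp_norm p F) = (m * h) ^ s * Lp_norm p F"
      by (simp add: power_mult_distrib mult.assoc)
    also have "m * h = 1 / \<sigma>"
      using m0 by (simp add: h_def)
    finally show ?thesis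
      by (simp add: F_def)
  qed
  have "(1 / \<sigma>) ^ s * Sobolev_seminorm p s g = (\<Sum>\<beta> | mi_abs \<beta> = s. (1 / \<sigma>) ^ s * Lp_norm p (weak_D \<beta> g))"
    by (simp add: Sobolev_seminorm_def sum_distrib_left)
  also have "\<dots> \<le> (\<Sum>\<beta>\<in>{\<beta> :: 'd \<Rightarrow> nat. mi_abs \<beta> = s}. (2 * 2 ^ s * m ^ s) * \<omega>)"
    using main by (intro sum_mono) auto
  finally show ?thesis by (simp add: \<omega>_def)
qed

section \<open>Ball averages\<close>

text \<open>An image of the unit ball, so that negative \<open>\<rho>\<close> make sense: the two
  sides of a central difference then have the same average, because the ball is symmetric.\<close>

definition ball_law :: "real \<Rightarrow> (real^'d::finite) measure" where
  "ball_law \<rho> = distr (uniform_measure lborel (ball 0 1)) borel ((*\<^sub>R) \<rho>)"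

lemma unit_ball_measure: "0 < measure lborel (ball (0::real^'d::finite) 1)"
  using content_ball_pos[of 1 "0::real^'d"] by simp

lemma unit_ball_emeasure: "emeasure lborel (ball (0::real^'d::finite) 1) = ennreal (measure lborel (ball (0::real^'d) 1))"
  using emeasure_lborel_ball_finite[of "0::real^'d" 1] by (intro emeasure_eq_ennreal_measure) auto

lemma prob_unit_ball: "prob_space (uniform_measure lborel (ball (0::real^'d::finite) 1))"
  using unit_ball_measure[where 'd = 'd] emeasure_lborel_ball_finite[of "0::real^'d" 1]
  by (intro prob_space_uniform_measure) (auto simp: unit_ball_emeasure)

lemma AE_unit_ball: "AE y in uniform_measure lborel (ball (0::real^'d::finite) 1). norm y \<le> 1"
  by (rule AE_uniform_measureI) (auto intro!: AE_I2)

lemma sets_ball_law [simp, measurable_cong]: "sets (ball_law \<rho>) = sets borel"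
  by (simp add: ball_law_def)

lemma space_ball_law [simp]: "space (ball_law \<rho>) = UNIV"
  by (simp add: ball_law_def)

lemma scaleR_measurable_uniform:
  "(*\<^sub>R) k \<in> borel_measurable (uniform_measure lborel (A :: (real^'d::finite) set))"
proof -
  have "sets (uniform_measure lborel A) = sets borel" by simp
  moreover have "(*\<^sub>R) k \<in> borel_measurable (borel :: (real^'d) measure)" by measurable
  ultimately show ?thesis using measurable_cong_sets[OF _ refl] by blast
qed

lemma bounded_law_ball_law: "bounded_law \<bar>\<rho>\<bar> (ball_law \<rho> :: (real^'d::finite) measure)"
proof -
  interpret u: prob_space "uniform_measure lborel (ball (0::real^'d) 1)" by (rule prob_unit_ball)
  note m = scaleR_measurable_uniform[of \<rho> "ball (0::real^'d) 1"]
  have "AE y in uniform_measure lborel (ball (0::real^'d) 1). norm (\<rho> *\<^sub>R y) \<le> \<bar>\<rho>\<bar>"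
    using AE_unit_ball by eventually_elim (simp add: mult_left_le)
  then show ?thesis
    unfolding bounded_law_def ball_law_def using u.prob_space_distr[OF m]
    by (auto simp: AE_distr_iff[OF m])
qed

lemma uniform_unit_ball_density:
  "uniform_measure lborel (ball (0::real^'d::finite) 1) =
    density lborel (\<lambda>y. ennreal (indicator (ball 0 1) y / measure lborel (ball (0::real^'d) 1)))"
  unfolding uniform_measure_def unit_ball_emeasure using unit_ball_measure[where 'd = 'd]
  by (intro arg_cong[of _ _ "density lborel"] ext) (simp add: divide_ennreal flip: ennreal_indicator)

lemma uniform_unit_ball_integral:
  fixes f :: "real^'d::finite \<Rightarrow> real"
  assumes [measurable]: "f \<in> borel_measurable borel"
  shows "(LINT y|uniform_measure lborel (ball 0 1). f y)
    = (LINT y|lborel. indicator (ball 0 1) y * f y) / measure lborel (ball (0::real^'d) 1)"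
proof -
  let ?v = "measure lborel (ball (0::real^'d) 1)"
  have "uniform_measure lborel (ball (0::real^'d) 1) = density lborel (\<lambda>y. ennreal (indicator (ball 0 1) y / ?v))"
    by (rule uniform_unit_ball_density)
  also have "(LINT y|\<dots>. f y) = (LINT y|lborel. (indicator (ball 0 1) y / ?v) *\<^sub>R f y)"
  proof (rule integral_density)
    have "(indicator (ball (0::real^'d) 1) :: real^'d \<Rightarrow> real) \<in> borel_measurable borel"
      by (intro borel_measurable_indicator) simp
    then show "(\<lambda>y. indicator (ball (0::real^'d) 1) y / ?v) \<in> borel_measurable lborel"
      by simp
  qed (use unit_ball_measure[where 'd = 'd] in auto)
  also have "\<dots> = (LINT y|lborel. indicator (ball 0 1) y * f y) / ?v"
    by simp
  finally show ?thesis .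
qed

text \<open>The affine change of variables produces \<open>\<bar>\<rho>\<bar> ^ CARD('d)\<close>,
  which the volume of the ball cancels.\<close>

lemma ball_avg_eq_avg:
  fixes f :: "real^'d::finite \<Rightarrow> real"
  assumes f [measurable]: "f \<in> borel_measurable borel" and \<rho>: "\<rho> \<noteq> 0"
  shows "ball_avg \<bar>\<rho>\<bar> f x = avg (ball_law \<rho>) f x"
proof -
  let ?v = "measure lborel (ball (0::real^'d) 1)"
  have ind: "indicator (ball x \<bar>\<rho>\<bar>) (x + \<rho> *\<^sub>R y) = (indicator (ball 0 1) y :: real)" for y
    using \<rho> by (auto simp: indicator_def dist_norm)
  have g: "(\<lambda>z. indicator (ball x \<bar>\<rho>\<bar>) z * f z) \<in> borel_measurable borel"
    by (intro borel_measurable_times borel_measurable_indicator f) simp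
  have "(LINT z|lborel. indicator (ball x \<bar>\<rho>\<bar>) z * f z)
      = (LINT z|density (distr lborel borel (\<lambda>y. x + \<rho> *\<^sub>R y)) (\<lambda>_. ennreal (\<bar>\<rho>\<bar> ^ DIM(real^'d))). indicator (ball x \<bar>\<rho>\<bar>) z * f z)"
    using lborel_affine[OF \<rho>, of x] by simp
  also have "\<dots> = (LINT z|distr lborel borel (\<lambda>y. x + \<rho> *\<^sub>R y). \<bar>\<rho>\<bar> ^ DIM(real^'d) *\<^sub>R (indicator (ball x \<bar>\<rho>\<bar>) z * f z))"
    using g by (intro integral_density) auto
  also have "\<dots> = (LINT y|lborel. \<bar>\<rho>\<bar> ^ DIM(real^'d) *\<^sub>R (indicator (ball x \<bar>\<rho>\<bar>) (x + \<rho> *\<^sub>R y) * f (x + \<rho> *\<^sub>R y)))"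
    using g by (intro integral_distr) auto
  also have "\<dots> = \<bar>\<rho>\<bar> ^ CARD('d) * (LINT y|lborel. indicator (ball 0 1) y * f (x + \<rho> *\<^sub>R y))"
    by (simp add: ind)
  finally have A: "(LINT z|lborel. indicator (ball x \<bar>\<rho>\<bar>) z * f z)
      = \<bar>\<rho>\<bar> ^ CARD('d) * (LINT y|lborel. indicator (ball 0 1) y * f (x + \<rho> *\<^sub>R y))" .
  have V: "measure lebesgue (ball (0::real^'d) \<bar>\<rho>\<bar>) = \<bar>\<rho>\<bar> ^ CARD('d) * ?v"
    using content_ball_conv_unit_ball[of "\<bar>\<rho>\<bar>" "0::real^'d"] by simp
  have "(LINT y:ball x \<bar>\<rho>\<bar>|lebesgue. f y) = (LINT z|lborel. indicator (ball x \<bar>\<rho>\<bar>) z * f z)"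
    unfolding set_lebesgue_integral_def using g by (subst integral_lebesgue_lborel) auto
  then have "ball_avg \<bar>\<rho>\<bar> f x = (LINT y|lborel. indicator (ball 0 1) y * f (x + \<rho> *\<^sub>R y)) / ?v"
    using \<rho> unfolding ball_avg_def V A by simp
  also have "\<dots> = (LINT y|uniform_measure lborel (ball 0 1). f (x + \<rho> *\<^sub>R y))"
    by (subst uniform_unit_ball_integral) measurable
  also have "\<dots> = avg (ball_law \<rho>) f x"
    unfolding avg_def ball_law_def by (subst integral_distr[OF scaleR_measurable_uniform]) auto
  finally show ?thesis .
qed

text \<open>The conclusion holds at every point, so that a function may be replaced by its Borel
  version even when its average is evaluated at sampling points.\<close>

lemma ball_avg_cong_AE:
  fixes f g :: "real^'d::finite \<Rightarrow> real"
  assumes "f \<in> borel_measurable lebesgue" "AE x in lebesgue. f x = g x"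
  shows "ball_avg \<delta> f = ball_avg \<delta> g"
proof
  fix x
  have fg: "f \<in> borel_measurable lebesgue" "g \<in> borel_measurable lebesgue"
    using assms borel_measurable_AE by blast+
  have m: "(\<lambda>y. indicator (ball x \<delta>) y *\<^sub>R h y) \<in> borel_measurable lebesgue"
    if "h \<in> borel_measurable lebesgue" for h :: "real^'d \<Rightarrow> real"
    using that by (intro borel_measurable_scaleR borel_measurable_indicator) auto
  have "(LINT y:ball x \<delta>|lebesgue. f y) = (LINT y:ball x \<delta>|lebesgue. g y)"
    unfolding set_lebesgue_integral_def
    by (rule integral_cong_AE[OF m[OF fg(1)] m[OF fg(2)]]) (use assms(2) in eventually_elim, simp)
  then show "ball_avg \<delta> f x = ball_avg \<delta> g x"
    by (simp add: ball_avg_def)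
qed

lemma avg_op_cong_AE:
  assumes "f \<in> borel_measurable lebesgue" "AE x in lebesgue. f x = g x"
  shows "avg_op \<delta> r f = avg_op \<delta> r g"
  unfolding avg_op_def ball_avg_cong_AE[OF assms] ..

definition avg_coeff :: "nat \<Rightarrow> nat \<Rightarrow> real" where
  "avg_coeff r j = - (2 / real ((2 * r) choose r)) * ((-1) ^ j * real ((2 * r) choose (r - j)))"

lemma avg_op_eq_sum_ball_avg: "avg_op \<delta> r f x = (\<Sum>j=1..r. avg_coeff r j * ball_avg (\<delta> * real j / real r) f x)"
  unfolding avg_op_def avg_coeff_def sum_distrib_left by (simp add: mult_ac)

lemma avg_op_eq_sum_avg:
  fixes f :: "real^'d::finite \<Rightarrow> real"
  assumes f: "f \<in> borel_measurable borel" and \<delta>: "0 < \<delta>"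
  shows "avg_op \<delta> r f x = (\<Sum>j=1..r. avg_coeff r j * avg (ball_law (\<delta> * real j / real r)) f x)"
  unfolding avg_op_eq_sum_ball_avg
proof (rule sum.cong)
  fix j assume j: "j \<in> {1..r}"
  then have t: "0 < \<delta> * real j / real r" using \<delta> by simp
  then have "ball_avg \<bar>\<delta> * real j / real r\<bar> f x = avg (ball_law (\<delta> * real j / real r)) f x"
    by (intro ball_avg_eq_avg[OF f]) (rule less_imp_neq[symmetric])
  then show "avg_coeff r j * ball_avg (\<delta> * real j / real r) f x = avg_coeff r j * avg (ball_law (\<delta> * real j / real r)) f x"
    unfolding abs_of_pos[OF t] by (rule arg_cong)
qed simp

text \<open>Bounds the averaging operator in the Lebesgue norm and in the Sobolev seminorm, since
  each single ball average is a contraction for both.\<close>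

definition avg_bound :: "nat \<Rightarrow> real" where
  "avg_bound r = (\<Sum>j=1..r. \<bar>avg_coeff r j\<bar>)"

lemma avg_bound_nonneg [simp]: "0 \<le> avg_bound r"
  unfolding avg_bound_def by (intro sum_nonneg) auto

lemma avg_combination_Lp:
  fixes f :: "real^'d::finite \<Rightarrow> real"
  assumes p: "1 \<le> p" and f: "f \<in> borel_measurable borel" "f \<in> Lp_space p" and K: "Lp_norm p f \<le> K"
  shows "(\<lambda>x. \<Sum>j=1..r. avg_coeff r j * avg (ball_law (\<rho> j)) f x) \<in> Lp_space p \<and>
    Lp_norm p (\<lambda>x. \<Sum>j=1..r. avg_coeff r j * avg (ball_law (\<rho> j)) f x) \<le> avg_bound r * K"
proof -
  note a = avg_Lp[OF bounded_law_ball_law p f]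
  have c: "(\<lambda>x. avg_coeff r j * avg (ball_law (\<rho> j)) f x) \<in> Lp_space p"
    "Lp_norm p (\<lambda>x. avg_coeff r j * avg (ball_law (\<rho> j)) f x) = \<bar>avg_coeff r j\<bar> * Lp_norm p (avg (ball_law (\<rho> j)) f)" for j
    using Lp_cmult[OF a(1)] p by auto
  have "(\<Sum>j=1..r. Lp_norm p (\<lambda>x. avg_coeff r j * avg (ball_law (\<rho> j)) f x)) \<le> (\<Sum>j=1..r. \<bar>avg_coeff r j\<bar> * K)"
    unfolding c(2) using a(2) K by (intro sum_mono mult_left_mono) (auto intro: order_trans)
  also have "\<dots> = avg_bound r * K" by (simp add: avg_bound_def sum_distrib_right)
  finally show ?thesis
    using Lp_sum[OF p, of "{1..r}" "\<lambda>j x. avg_coeff r j * avg (ball_law (\<rho> j)) f x"] c(1) by auto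
qed

lemma avg_op_Lp:
  fixes f :: "real^'d::finite \<Rightarrow> real"
  assumes p: "1 \<le> p" and f: "f \<in> Lp_space p" and \<delta>: "0 < \<delta>"
  shows "avg_op \<delta> r f \<in> Lp_space p" "Lp_norm p (avg_op \<delta> r f) \<le> avg_bound r * Lp_norm p f"
proof -
  obtain f' where f': "f' \<in> borel_measurable borel" "AE x in lebesgue. f x = f' x"
    using borel_version[OF Lp_space_measurable[OF f]] by blast
  have L: "f' \<in> Lp_space p" by (rule Lp_cong_AE(1)[OF f f'(2)])
  have n: "Lp_norm p f' = Lp_norm p f" by (rule Lp_cong_AE(2)[OF f f'(2)])
  have eq: "avg_op \<delta> r f = (\<lambda>x. \<Sum>j=1..r. avg_coeff r j * avg (ball_law (\<delta> * real j / real r)) f' x)"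
    unfolding avg_op_cong_AE[OF Lp_space_measurable[OF f] f'(2)] by (rule ext) (rule avg_op_eq_sum_avg[OF f'(1) \<delta>])
  show "avg_op \<delta> r f \<in> Lp_space p" "Lp_norm p (avg_op \<delta> r f) \<le> avg_bound r * Lp_norm p f"
    unfolding eq using avg_combination_Lp[OF p f'(1) L, of "Lp_norm p f" r "\<lambda>j. \<delta> * real j / real r"] n by auto
qed

lemma bounded_law_reflect:
  assumes "bounded_law R \<mu>"
  shows "bounded_law R (distr \<mu> borel uminus)"
proof -
  interpret prob_space \<mu> using assms by (simp add: bounded_law_def)
  have m: "uminus \<in> borel_measurable \<mu>"
    using assms by (simp add: bounded_law_def measurable_cong_sets[of \<mu> borel])
  show ?thesis
    using assms prob_space_distr[OF m] by (auto simp: bounded_law_def AE_distr_iff[OF m])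
qed

lemma avg_reflect:
  assumes "bounded_law R \<mu>" "\<phi> \<in> borel_measurable borel"
  shows "(LINT y|\<mu>. \<phi> (x - y)) = avg (distr \<mu> borel uminus) \<phi> x"
proof -
  have m: "uminus \<in> borel_measurable \<mu>"
    using assms by (simp add: bounded_law_def measurable_cong_sets[of \<mu> borel])
  show ?thesis
    unfolding avg_def using assms(2) by (subst integral_distr[OF m]) auto
qed

text \<open>By duality this is the commutation of \<open>classical_D\<close> with the average over
  the reflected measure.\<close>

lemma avg_weak_deriv:
  fixes g h :: "real^'d::finite \<Rightarrow> real"
  assumes p: "1 \<le> p" and g: "g \<in> borel_measurable borel" "g \<in> Lp_space p"
    and h: "h \<in> borel_measurable borel" "h \<in> Lp_space p" and w: "is_weak_deriv \<beta> g h"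
    and \<mu>: "bounded_law R \<mu>"
  shows "is_weak_deriv \<beta> (avg \<mu> g) (avg \<mu> h)"
proof (rule is_weak_derivI[OF p])
  show "avg \<mu> g \<in> borel_measurable borel" "avg \<mu> h \<in> borel_measurable borel"
    using avg_measurable[OF \<mu>] g h by auto
  show "avg \<mu> g \<in> Lp_space p" "avg \<mu> h \<in> Lp_space p"
    using avg_Lp(1)[OF \<mu> p g] avg_Lp(1)[OF \<mu> p h] by auto
  fix \<phi> :: "real^'d \<Rightarrow> real" assume \<phi>: "test_function \<phi>"
  let ?\<nu> = "distr \<mu> borel uminus"
  note \<nu> = bounded_law_reflect[OF \<mu>]
  have D: "test_function (classical_D \<beta> \<phi>)" by (rule test_function_classical_D[OF \<phi>])
  have "(LINT x|lborel. avg \<mu> g x * classical_D \<beta> \<phi> x) = (LINT x|lborel. g x * classical_D \<beta> (avg ?\<nu> \<phi>) x)"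
    using avg_duality[OF \<mu> p g bump_like_test[OF D]]
    by (simp add: avg_reflect[OF \<mu> test_function_borel[OF D]] classical_D_avg[OF \<nu> \<phi>])
  also have "\<dots> = (-1) ^ mi_abs \<beta> * (LINT x|lborel. h x * avg ?\<nu> \<phi> x)"
    by (rule is_weak_derivD[OF w g(1) h(1) test_function_avg[OF \<nu> \<phi>]])
  also have "(LINT x|lborel. h x * avg ?\<nu> \<phi> x) = (LINT x|lborel. avg \<mu> h x * \<phi> x)"
    using avg_duality[OF \<mu> p h bump_like_test[OF \<phi>]]
    by (simp add: avg_reflect[OF \<mu> test_function_borel[OF \<phi>]])
  finally show "(LINT x|lborel. avg \<mu> g x * classical_D \<beta> \<phi> x) = (-1) ^ mi_abs \<beta> * (LINT x|lborel. avg \<mu> h x * \<phi> x)" .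
qed

lemma avg_op_Sobolev:
  fixes g :: "real^'d::finite \<Rightarrow> real"
  assumes p: "1 \<le> p" and g: "g \<in> Sobolev p s" and \<delta>: "0 < \<delta>"
  shows "avg_op \<delta> r g \<in> Sobolev p s"
    "Sobolev_seminorm p s (avg_op \<delta> r g) \<le> avg_bound r * Sobolev_seminorm p s g"
proof -
  have gL: "g \<in> Lp_space p" by (rule Sobolev_Lp[OF g])
  have main: "\<exists>H\<in>Lp_space p. is_weak_deriv \<beta> (avg_op \<delta> r g) H \<and> Lp_norm p H \<le> avg_bound r * Lp_norm p (weak_D \<beta> g)"
    if \<beta>: "mi_abs \<beta> \<le> s" for \<beta>
  proof -
    note W = Sobolev_weak_D[OF g \<beta>]
    obtain g' where g': "g' \<in> borel_measurable borel" "AE x in lebesgue. g x = g' x"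
      using borel_version[OF Lp_space_measurable[OF gL]] by blast
    obtain h where h: "h \<in> borel_measurable borel" "AE x in lebesgue. weak_D \<beta> g x = h x"
      using borel_version[OF Lp_space_measurable[OF W(2)]] by blast
    have L: "g' \<in> Lp_space p" "h \<in> Lp_space p"
      by (rule Lp_cong_AE(1)[OF gL g'(2)], rule Lp_cong_AE(1)[OF W(2) h(2)])
    have n: "Lp_norm p h = Lp_norm p (weak_D \<beta> g)" by (rule Lp_cong_AE(2)[OF W(2) h(2)])
    have w: "is_weak_deriv \<beta> g' h"
      by (rule is_weak_deriv_cong_AE[OF W(1) g'(2) h(2)]) (intro Lp_locally_integrable[OF _ p] L)+
    have eq: "avg_op \<delta> r g = (\<lambda>x. \<Sum>j=1..r. avg_coeff r j * avg (ball_law (\<delta> * real j / real r)) g' x)"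
      unfolding avg_op_cong_AE[OF Lp_space_measurable[OF gL] g'(2)] by (rule ext) (rule avg_op_eq_sum_avg[OF g'(1) \<delta>])
    show ?thesis
      unfolding eq
      using avg_combination_Lp[OF p h(1) L(2) order_refl, of r "\<lambda>j. \<delta> * real j / real r"] n
      by (intro bexI[of _ "\<lambda>x. \<Sum>j=1..r. avg_coeff r j * avg (ball_law (\<delta> * real j / real r)) h x"] conjI
          is_weak_deriv_sum avg_weak_deriv[OF p g'(1) L(1) h(1) L(2) w bounded_law_ball_law]) auto
  qed
  show "avg_op \<delta> r g \<in> Sobolev p s"
    using main avg_op_Lp(1)[OF p gL \<delta>] by (auto simp: Sobolev_def has_weak_deriv_in_Lp_def)
  have "Lp_norm p (weak_D \<beta> (avg_op \<delta> r g)) \<le> avg_bound r * Lp_norm p (weak_D \<beta> g)" if "mi_abs \<beta> = s" for \<beta>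
    using main[of \<beta>] weak_D_Lp(3)[of \<beta> "avg_op \<delta> r g" _ p] that by auto
  then show "Sobolev_seminorm p s (avg_op \<delta> r g) \<le> avg_bound r * Sobolev_seminorm p s g"
    unfolding Sobolev_seminorm_def sum_distrib_left by (intro sum_mono) auto
qed

text \<open>The indicators of the moving balls converge off the sphere around \<open>x\<close>, a
  null set. Dropping the first \<open>N\<close> terms puts all centres within distance 1, so
  \<open>cball x (\<delta> + 1)\<close> supplies a dominating function.\<close>

lemma ball_avg_continuous:
  fixes g :: "real^'d::finite \<Rightarrow> real"
  assumes g: "locally_integrable g" and \<delta>: "0 < \<delta>"
  shows "continuous_on UNIV (ball_avg \<delta> g)"
proof -
  have "isCont (\<lambda>x. LINT y:ball x \<delta>|lebesgue. g y) x" for x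
    unfolding continuous_at_sequentially comp_def
  proof (intro allI impI)
    fix u :: "nat \<Rightarrow> real^'d" assume u: "u \<longlonglongrightarrow> x"
    obtain N where N: "\<forall>n\<ge>N. dist (u n) x < 1"
      using u unfolding LIMSEQ_def by (meson zero_less_one)
    have ci: "integrable lebesgue (\<lambda>y. indicator (cball x (\<delta> + 1)) y *\<^sub>R g y)"
      using g unfolding locally_integrable_def set_integrable_def by auto
    have bi: "integrable lebesgue (\<lambda>y. indicator (ball z \<delta>) y *\<^sub>R g y)" for z
    proof -
      have "set_integrable lebesgue (cball z \<delta>) g"
        using g unfolding locally_integrable_def by auto
      then have "set_integrable lebesgue (ball z \<delta>) g"
        by (rule set_integrable_subset) auto
      then show ?thesis by (simp add: set_integrable_def)
    qed
    have "(\<lambda>n. LINT y|lebesgue. indicator (ball (u (n + N)) \<delta>) y *\<^sub>R g y) \<longlonglongrightarrow> (LINT y|lebesgue. indicator (ball x \<delta>) y *\<^sub>R g y)"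
    proof (rule integral_dominated_convergence)
      show "integrable lebesgue (\<lambda>y. \<bar>indicator (cball x (\<delta> + 1)) y *\<^sub>R g y\<bar>)"
        using ci by (rule integrable_abs)
      show "(\<lambda>y. indicator (ball x \<delta>) y *\<^sub>R g y) \<in> borel_measurable lebesgue"
        using bi by (rule borel_measurable_integrable)
      show "(\<lambda>y. indicator (ball (u (n + N)) \<delta>) y *\<^sub>R g y) \<in> borel_measurable lebesgue" for n
        using bi by (rule borel_measurable_integrable)
      show "AE y in lebesgue. norm (indicator (ball (u (n + N)) \<delta>) y *\<^sub>R g y) \<le> \<bar>indicator (cball x (\<delta> + 1)) y *\<^sub>R g y\<bar>" for n
      proof (rule AE_I2)
        fix y
        have "y \<in> cball x (\<delta> + 1)" if "y \<in> ball (u (n + N)) \<delta>"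
          using that N[rule_format, of "n + N"] dist_triangle[of x y "u (n + N)"] by (simp add: dist_commute)
        then show "norm (indicator (ball (u (n + N)) \<delta>) y *\<^sub>R g y) \<le> \<bar>indicator (cball x (\<delta> + 1)) y *\<^sub>R g y\<bar>"
          by (cases "y \<in> ball (u (n + N)) \<delta>") auto
      qed
      have "negligible (sphere x \<delta>)" by (rule negligible_sphere)
      then have "AE y in lebesgue. y \<notin> sphere x \<delta>"
        by (intro AE_not_in) (simp add: negligible_iff_null_sets)
      then show "AE y in lebesgue. (\<lambda>n. indicator (ball (u (n + N)) \<delta>) y *\<^sub>R g y) \<longlonglongrightarrow> indicator (ball x \<delta>) y *\<^sub>R g y"
      proof eventually_elim
        case (elim y)
        have d: "(\<lambda>n. dist (u (n + N)) y) \<longlonglongrightarrow> dist x y"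
          using LIMSEQ_ignore_initial_segment[OF u] by (intro tendsto_dist) auto
        have "eventually (\<lambda>n. indicator (ball x \<delta>) y *\<^sub>R g y = indicator (ball (u (n + N)) \<delta>) y *\<^sub>R g y) sequentially"
        proof (cases "dist x y < \<delta>")
          case True
          from order_tendstoD(2)[OF d True] show ?thesis
            by eventually_elim (use True in simp)
        next
          case False
          with elim have "\<delta> < dist x y" by simp
          from order_tendstoD(1)[OF d this] show ?thesis
            by eventually_elim (use False in simp)
        qed
        then show ?case
          by (rule Lim_transform_eventually[OF tendsto_const])
      qed
    qed
    then show "(\<lambda>n. LINT y:ball (u n) \<delta>|lebesgue. g y) \<longlonglongrightarrow> (LINT y:ball x \<delta>|lebesgue. g y)"
      unfolding set_lebesgue_integral_def by (rule LIMSEQ_offset)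
  qed
  then show ?thesis
    unfolding ball_avg_def[abs_def] by (intro continuous_intros continuous_at_imp_continuous_on) auto
qed

lemma avg_op_continuous:
  fixes g :: "real^'d::finite \<Rightarrow> real"
  assumes p: "1 \<le> p" and g: "g \<in> Lp_space p" and \<delta>: "0 < \<delta>"
  shows "continuous_on UNIV (avg_op \<delta> r g)"
  unfolding avg_op_eq_sum_ball_avg[abs_def]
  by (intro continuous_on_sum continuous_on_mult_left ball_avg_continuous Lp_locally_integrable[OF g p])
    (use \<delta> in auto)

section \<open>Samples of ball averages\<close>

text \<open>Jensen's inequality on the ball of radius \<open>\<rho>\<close>. The integral is then
  extended to radius \<open>\<delta>\<close>, so that all radii occurring in \<open>avg_op\<close>
  are estimated by integrals over one and the same ball.\<close>

lemma ball_avg_powr_bound: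
  fixes g :: "real^'d::finite \<Rightarrow> real"
  assumes p: "1 \<le> p" and g: "g \<in> borel_measurable borel" "g \<in> Lp_space p"
    and \<rho>: "0 < \<rho>" "\<rho> \<le> \<delta>"
  shows "\<bar>ball_avg \<rho> g x\<bar> powr p \<le> (LINT y|lborel. indicator (ball x \<delta>) y * \<bar>g y\<bar> powr p)
    / (\<rho> ^ CARD('d) * measure lborel (ball (0::real^'d) 1))"
proof -
  note [measurable] = g(1)
  have i: "integrable lborel (\<lambda>y. \<bar>g y\<bar> powr p)"
    using g by (simp add: Lp_space_def integrable_lebesgue_lborel)
  have ii: "integrable lborel (\<lambda>y. indicator (ball z t) y * \<bar>g y\<bar> powr p)" for z t
    using integrable_mult_indicator[OF _ i, of "ball z t"] by simp
  interpret b: prob_space "ball_law \<rho> :: (real^'d) measure"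
    using bounded_law_ball_law by (auto simp: bounded_law_def)
  have "(\<lambda>y. g (x + y)) \<in> borel_measurable borel" by measurable
  then have gm: "(\<lambda>y. g (x + y)) \<in> borel_measurable (ball_law \<rho>)"
    using measurable_cong_sets[OF sets_ball_law refl] by blast
  have V: "measure lebesgue (ball (0::real^'d) \<rho>) = \<rho> ^ CARD('d) * measure lborel (ball (0::real^'d) 1)"
    using content_ball_conv_unit_ball[of \<rho> "0::real^'d"] \<rho> by simp
  have V0: "0 < \<rho> ^ CARD('d) * measure lborel (ball (0::real^'d) 1)"
    using \<rho> unit_ball_measure[where 'd = 'd] by simp
  have pm: "(\<lambda>y. \<bar>g y\<bar> powr p) \<in> borel_measurable borel" by measurable
  have "ball_avg \<rho> g x = avg (ball_law \<rho>) g x"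
    using ball_avg_eq_avg[OF g(1), of \<rho> x] \<rho> by simp
  then have "ennreal (\<bar>ball_avg \<rho> g x\<bar> powr p) \<le> (\<integral>\<^sup>+y. ennreal (\<bar>g (x + y)\<bar> powr p) \<partial>ball_law \<rho>)"
    using b.nn_Jensen_powr[OF p gm] by (simp add: avg_def)
  also have "\<dots> = ennreal (LINT y|ball_law \<rho>. \<bar>g (x + y)\<bar> powr p)"
  proof (rule nn_integral_eq_integral)
    note m1 = scaleR_measurable_uniform[of \<rho> "ball (0::real^'d) 1"]
    have "integrable lborel (\<lambda>y. \<bar>g (x + \<rho> *\<^sub>R y)\<bar> powr p)"
    proof -
      have "integrable (density (distr lborel borel (\<lambda>y. x + \<rho> *\<^sub>R y)) (\<lambda>_. ennreal (\<bar>\<rho>\<bar> ^ DIM(real^'d)))) (\<lambda>y. \<bar>g y\<bar> powr p)"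
        using i lborel_affine[of \<rho> x] \<rho> by simp
      then have "integrable (distr lborel borel (\<lambda>y. x + \<rho> *\<^sub>R y)) (\<lambda>y. \<bar>\<rho>\<bar> ^ DIM(real^'d) *\<^sub>R \<bar>g y\<bar> powr p)"
        by (subst (asm) integrable_density) auto
      then show ?thesis
        using \<rho> by (subst (asm) integrable_distr_eq) auto
    qed
    from integrable_mult_indicator[OF _ this, of "ball 0 1"]
    have "integrable lborel (\<lambda>y. (indicator (ball 0 1) y / measure lborel (ball (0::real^'d) 1)) *\<^sub>R \<bar>g (x + \<rho> *\<^sub>R y)\<bar> powr p)"
      by simp
    moreover have "(indicator (ball (0::real^'d) 1) :: real^'d \<Rightarrow> real) \<in> borel_measurable borel"
      by (intro borel_measurable_indicator) simp
    then have "(\<lambda>y. indicator (ball (0::real^'d) 1) y / measure lborel (ball (0::real^'d) 1)) \<in> borel_measurable lborel"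
      by simp
    ultimately have "integrable (density lborel (\<lambda>y. ennreal (indicator (ball 0 1) y / measure lborel (ball (0::real^'d) 1)))) (\<lambda>y. \<bar>g (x + \<rho> *\<^sub>R y)\<bar> powr p)"
      using unit_ball_measure[where 'd = 'd] by (subst integrable_density) auto
    moreover note uniform_unit_ball_density[where 'd = 'd]
    ultimately show "integrable (ball_law \<rho>) (\<lambda>y. \<bar>g (x + y)\<bar> powr p)"
      unfolding ball_law_def by (subst integrable_distr_eq[OF m1]) auto
  qed auto
  also have "(LINT y|ball_law \<rho>. \<bar>g (x + y)\<bar> powr p) = ball_avg \<rho> (\<lambda>y. \<bar>g y\<bar> powr p) x"
    using ball_avg_eq_avg[OF pm, of \<rho> x] \<rho> by (simp add: avg_def)
  finally have "\<bar>ball_avg \<rho> g x\<bar> powr p \<le> ball_avg \<rho> (\<lambda>y. \<bar>g y\<bar> powr p) x"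
  proof (subst (asm) ennreal_le_iff)
    show "0 \<le> ball_avg \<rho> (\<lambda>y. \<bar>g y\<bar> powr p) x"
      unfolding ball_avg_def set_lebesgue_integral_def by (intro mult_nonneg_nonneg integral_nonneg_AE) auto
  qed
  also have "\<dots> = (LINT y|lborel. indicator (ball x \<rho>) y * \<bar>g y\<bar> powr p) / (\<rho> ^ CARD('d) * measure lborel (ball (0::real^'d) 1))"
    unfolding ball_avg_def V set_lebesgue_integral_def
    by (subst integral_lebesgue_lborel) (auto intro!: borel_measurable_times borel_measurable_indicator pm)
  also have "\<dots> \<le> (LINT y|lborel. indicator (ball x \<delta>) y * \<bar>g y\<bar> powr p) / (\<rho> ^ CARD('d) * measure lborel (ball (0::real^'d) 1))"
    using V0 \<rho> by (intro divide_right_mono integral_mono ii mult_right_mono) (auto simp: indicator_def)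
  finally show ?thesis .
qed

text \<open>The balls of radius \<open>\<gamma> / \<sigma>\<close> around the sampling points are disjoint.\<close>

lemma avg_op_lp:
  fixes g :: "real^'d::finite \<Rightarrow> real"
  assumes p: "1 \<le> p" and r: "1 \<le> r" and gL: "g \<in> Lp_space p" and \<gamma>: "0 < \<gamma>" and \<sigma>: "0 < \<sigma>"
    and sep: "separated \<gamma> \<sigma> X"
  shows "avg_op (\<gamma> / \<sigma>) r g \<in> lp_space p X"
    "lp_norm p \<sigma> X (avg_op (\<gamma> / \<sigma>) r g) \<le>
      avg_bound r * ((real r / \<gamma>) ^ CARD('d) / measure lborel (ball (0::real^'d) 1)) powr (1 / p) * Lp_norm p g"
proof -
  define v where "v = measure lborel (ball (0::real^'d) 1)"
  have v: "0 < v" unfolding v_def by (rule unit_ball_measure)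
  define \<delta> where "\<delta> = \<gamma> / \<sigma>"
  have \<delta>: "0 < \<delta>" using \<gamma> \<sigma> by (simp add: \<delta>_def)
  obtain g' where g': "g' \<in> borel_measurable borel" "AE x in lebesgue. g x = g' x"
    using borel_version[OF Lp_space_measurable[OF gL]] by blast
  have g'L: "g' \<in> Lp_space p" by (rule Lp_cong_AE(1)[OF gL g'(2)])
  have g'n: "Lp_norm p g' = Lp_norm p g" by (rule Lp_cong_AE(2)[OF gL g'(2)])
  note [measurable] = g'(1)
  define I where "I x = (LINT y|lborel. indicator (ball x \<delta>) y * \<bar>g' y\<bar> powr p)" for x
  have I0: "0 \<le> I x" for x unfolding I_def by (intro integral_nonneg_AE) auto
  have i: "integrable lborel (\<lambda>y. \<bar>g' y\<bar> powr p)"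
    using g'(1) g'L by (simp add: Lp_space_def integrable_lebesgue_lborel)
  have ii: "integrable lborel (\<lambda>y. indicator (ball z t) y * \<bar>g' y\<bar> powr p)" for z t
    using integrable_mult_indicator[OF _ i, of "ball z t"] by simp
  have iN: "(LINT y|lborel. \<bar>g' y\<bar> powr p) = Lp_norm p g powr p"
    using Lp_norm_powr[of p g'] p g'(1) by (simp add: g'n integral_lebesgue_lborel)
  \<comment> \<open>The ball with the smallest radius occurring in \<open>avg_op\<close>, namely
    \<open>\<delta> / r\<close>, has volume \<open>1 / q\<close>.\<close>
  define q where "q = (real r / \<delta>) ^ CARD('d) / v"
  have q0: "0 \<le> q" using \<delta> v by (simp add: q_def)
  have pt: "\<bar>avg_op \<delta> r g x\<bar> powr p \<le> avg_bound r powr p * (q * I x)" for x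
  proof -
    have b: "\<bar>ball_avg (\<delta> * real j / real r) g' x\<bar> \<le> (q * I x) powr (1 / p)" if j: "j \<in> {1..r}" for j
    proof -
      let ?\<rho> = "\<delta> * real j / real r"
      have \<rho>: "0 < ?\<rho>" "?\<rho> \<le> \<delta>" "\<delta> / real r \<le> ?\<rho>"
        using j \<delta> r by (auto simp: field_simps)
      have "\<bar>ball_avg ?\<rho> g' x\<bar> powr p \<le> I x / (?\<rho> ^ CARD('d) * v)"
        unfolding I_def v_def by (rule ball_avg_powr_bound[OF p g'(1) g'L \<rho>(1,2)])
      also have "\<dots> \<le> I x / ((\<delta> / real r) ^ CARD('d) * v)"
        using \<rho> v \<delta> r I0 by (intro divide_left_mono mult_right_mono power_mono mult_pos_pos) auto
      also have "\<dots> = q * I x"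
        using \<delta> r by (simp add: q_def power_divide)
      finally have "(\<bar>ball_avg ?\<rho> g' x\<bar> powr p) powr (1 / p) \<le> (q * I x) powr (1 / p)"
        using p by (intro powr_mono2) auto
      then show ?thesis using p by (simp add: powr_powr)
    qed
    have "\<bar>avg_op \<delta> r g x\<bar> = \<bar>\<Sum>j=1..r. avg_coeff r j * ball_avg (\<delta> * real j / real r) g' x\<bar>"
      unfolding avg_op_cong_AE[OF Lp_space_measurable[OF gL] g'(2)] avg_op_eq_sum_ball_avg ..
    also have "\<dots> \<le> (\<Sum>j=1..r. \<bar>avg_coeff r j\<bar> * \<bar>ball_avg (\<delta> * real j / real r) g' x\<bar>)"
      unfolding abs_mult[symmetric] by (rule sum_abs)
    also have "\<dots> \<le> (\<Sum>j=1..r. \<bar>avg_coeff r j\<bar> * (q * I x) powr (1 / p))"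
      using b by (intro sum_mono mult_left_mono) auto
    also have "\<dots> = avg_bound r * (q * I x) powr (1 / p)"
      by (simp add: avg_bound_def sum_distrib_right)
    finally have "\<bar>avg_op \<delta> r g x\<bar> powr p \<le> (avg_bound r * (q * I x) powr (1 / p)) powr p"
      using p by (intro powr_mono2) auto
    also have "\<dots> = avg_bound r powr p * (q * I x)"
      using p q0 I0 by (simp add: powr_mult powr_powr)
    finally show ?thesis .
  qed
  define T where "T = avg_bound r powr p * (q * Lp_norm p g powr p)"
  have fin: "(\<Sum>\<xi>\<in>F. \<bar>avg_op \<delta> r g \<xi>\<bar> powr p) \<le> T" if F: "finite F" "F \<subseteq> X" for F
  proof -
    have one: "(\<Sum>\<xi>\<in>F. indicator (ball \<xi> \<delta>) y) \<le> (1::real)" for y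
    proof (cases "\<exists>\<xi>\<in>F. y \<in> ball \<xi> \<delta>")
      case True
      then obtain \<xi> where \<xi>: "\<xi> \<in> F" "y \<in> ball \<xi> \<delta>" by blast
      have "y \<notin> ball \<eta> \<delta>" if "\<eta> \<in> F - {\<xi>}" for \<eta>
      proof
        assume "y \<in> ball \<eta> \<delta>"
        then have "dist \<xi> \<eta> < 2 * \<delta>"
          using \<xi> dist_triangle2[of \<xi> \<eta> y] by (simp add: dist_commute)
        moreover have "norm (\<xi> - \<eta>) > 2 * \<gamma> / \<sigma>"
        proof -
          have "\<xi> \<in> X" "\<eta> \<in> X" "\<xi> \<noteq> \<eta>" using \<xi> that F(2) by auto
          then show ?thesis using sep unfolding separated_def by blast
        qed
        ultimately show False by (simp add: dist_norm \<delta>_def)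
      qed
      then have "(\<Sum>\<eta>\<in>F - {\<xi>}. indicator (ball \<eta> \<delta>) y) = (0::real)"
        by (intro sum.neutral) (auto simp: indicator_def)
      then show ?thesis
        using sum.remove[OF F(1) \<xi>(1), of "\<lambda>\<xi>. indicator (ball \<xi> \<delta>) y :: real"] by (simp add: indicator_def)
    next
      case False
      then have "(\<Sum>\<xi>\<in>F. indicator (ball \<xi> \<delta>) y) = (0::real)"
        by (intro sum.neutral) (auto simp: indicator_def)
      then show ?thesis by simp
    qed
    have "(\<Sum>\<xi>\<in>F. I \<xi>) = (LINT y|lborel. (\<Sum>\<xi>\<in>F. indicator (ball \<xi> \<delta>) y * \<bar>g' y\<bar> powr p))"
      unfolding I_def using ii by (subst Bochner_Integration.integral_sum) auto
    also have "\<dots> \<le> (LINT y|lborel. \<bar>g' y\<bar> powr p)"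
    proof (rule integral_mono)
      fix y
      show "(\<Sum>\<xi>\<in>F. indicator (ball \<xi> \<delta>) y * \<bar>g' y\<bar> powr p) \<le> \<bar>g' y\<bar> powr p"
        unfolding sum_distrib_right[symmetric] using mult_right_mono[OF one, of "\<bar>g' y\<bar> powr p" y] by simp
    qed (use i ii in auto)
    finally have "(\<Sum>\<xi>\<in>F. I \<xi>) \<le> Lp_norm p g powr p" by (simp add: iN)
    then have "avg_bound r powr p * (q * (\<Sum>\<xi>\<in>F. I \<xi>)) \<le> T"
      unfolding T_def using q0 by (intro mult_left_mono) auto
    moreover have "(\<Sum>\<xi>\<in>F. \<bar>avg_op \<delta> r g \<xi>\<bar> powr p) \<le> (\<Sum>\<xi>\<in>F. avg_bound r powr p * (q * I \<xi>))"
      by (intro sum_mono pt)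
    ultimately show ?thesis by (simp add: sum_distrib_left)
  qed
  have summ: "(\<lambda>\<xi>. \<bar>avg_op \<delta> r g \<xi>\<bar> powr p) summable_on X"
    using fin by (intro nonneg_bdd_above_summable_on bdd_aboveI2[of _ _ T]) auto
  then show "avg_op (\<gamma> / \<sigma>) r g \<in> lp_space p X"
    by (simp add: lp_space_def \<delta>_def)
  have "(\<Sum>\<^sub>\<infinity>\<xi>\<in>X. \<bar>avg_op \<delta> r g \<xi>\<bar> powr p) \<le> T"
    using summ fin by (intro infsum_le_finite_sums) auto
  then have "lp_norm p \<sigma> X (avg_op \<delta> r g) \<le> (\<sigma> powr (- real CARD('d)) * T) powr (1 / p)"
    unfolding lp_norm_def using p
    by (intro powr_mono2 mult_left_mono mult_nonneg_nonneg infsum_nonneg) auto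
  \<comment> \<open>The power of \<open>\<sigma>\<close> hidden in \<open>q\<close> through
    \<open>\<delta> = \<gamma> / \<sigma>\<close> cancels the weight of the sampled norm; this is
    why the bound is uniform in \<open>\<sigma>\<close>.\<close>
  also have "\<sigma> powr (- real CARD('d)) * T = avg_bound r powr p * (((real r / \<gamma>) ^ CARD('d) / v) * Lp_norm p g powr p)"
    using \<sigma> \<gamma> by (simp add: T_def q_def \<delta>_def powr_minus powr_realpow power_divide power_mult_distrib field_simps)
  also have "\<dots> powr (1 / p) = avg_bound r * (((real r / \<gamma>) ^ CARD('d) / v) powr (1 / p) * Lp_norm p g)"
  proof -
    have aux: "(a powr p * (w * n powr p)) powr (1 / p) = a * (w powr (1 / p) * n)" if "0 \<le> a" "0 \<le> w" "0 \<le> n" for a w n :: real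
      using that p by (simp add: powr_mult powr_powr)
    show ?thesis by (rule aux) (use v \<gamma> in auto)
  qed
  finally show "lp_norm p \<sigma> X (avg_op (\<gamma> / \<sigma>) r g) \<le>
      avg_bound r * ((real r / \<gamma>) ^ CARD('d) / measure lborel (ball (0::real^'d) 1)) powr (1 / p) * Lp_norm p g"
    by (simp add: \<delta>_def v_def mult.assoc)
qed

section \<open>Averages as central differences\<close>

text \<open>Symmetry of the binomial coefficients pairs the nodes at \<open>r - j\<close> and
  \<open>r + j\<close>; the result has the coefficients of \<open>avg_op\<close>, up to the
  normalising factor.\<close>

lemma fin_diff_centred:
  "fin_diff (2 * r) u f (x - real r *\<^sub>R u) =
    real ((2 * r) choose r) * (-1) ^ r * f x +
    (\<Sum>j=1..r. real ((2 * r) choose (r - j)) * (-1) ^ (r + j) * (f (x + real j *\<^sub>R u) + f (x - real j *\<^sub>R u)))"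
proof -
  define F where "F \<mu> = real ((2 * r) choose \<mu>) * (-1) ^ \<mu> * f (x + (real \<mu> - real r) *\<^sub>R u)" for \<mu>
  have "fin_diff (2 * r) u f (x - real r *\<^sub>R u) = (\<Sum>\<mu>\<le>2 * r. F \<mu>)"
    unfolding fin_diff_reindex F_def
    by (rule sum.cong) (auto simp: algebra_simps minus_one_power_iff)
  also have "{..2 * r} = {..<r} \<union> ({r} \<union> {r<..2 * r})" by auto
  also have "(\<Sum>\<mu>\<in>\<dots>. F \<mu>) = (\<Sum>\<mu><r. F \<mu>) + (F r + (\<Sum>\<mu>\<in>{r<..2 * r}. F \<mu>))"
    by (subst sum.union_disjoint, simp, simp, force, subst sum.union_disjoint) auto
  also have "(\<Sum>\<mu><r. F \<mu>) = (\<Sum>j=1..r. real ((2 * r) choose (r - j)) * (-1) ^ (r + j) * f (x - real j *\<^sub>R u))"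
    unfolding F_def
    by (rule sum.reindex_bij_witness[of _ "\<lambda>j. r - j" "\<lambda>\<mu>. r - \<mu>"])
       (auto simp: algebra_simps of_nat_diff minus_one_power_iff)
  also have "(\<Sum>\<mu>\<in>{r<..2 * r}. F \<mu>) = (\<Sum>j=1..r. real ((2 * r) choose (r - j)) * (-1) ^ (r + j) * f (x + real j *\<^sub>R u))"
  proof (rule sum.reindex_bij_witness[of _ "\<lambda>j. r + j" "\<lambda>\<mu>. \<mu> - r"])
    fix \<mu> assume \<mu>: "\<mu> \<in> {r<..2 * r}"
    then have "(2 * r) choose \<mu> = (2 * r) choose (2 * r - \<mu>)" by (intro binomial_symmetric) simp
    also have "2 * r - \<mu> = r - (\<mu> - r)" using \<mu> by auto
    finally show "real ((2 * r) choose (r - (\<mu> - r))) * (-1) ^ (r + (\<mu> - r)) * f (x + real (\<mu> - r) *\<^sub>R u) = F \<mu>"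
      using \<mu> by (simp add: F_def of_nat_diff)
  qed auto
  finally show ?thesis
    by (simp add: F_def sum.distrib[symmetric] algebra_simps)
qed

text \<open>The central difference with step \<open>(\<delta> / r) *\<^sub>R y\<close> is averaged
  over \<open>y\<close> in the unit ball. The terms with plus and minus sign have the same average,
  which explains the factor 2 in \<open>avg_op\<close>, and the middle term gives \<open>g\<close>
  after division by the central binomial coefficient.\<close>

lemma avg_op_approximation:
  fixes g :: "real^'d::finite \<Rightarrow> real"
  assumes p: "1 \<le> p" and r: "1 \<le> r" and s: "s \<le> 2 * r" and g: "g \<in> Sobolev p s" and \<delta>: "0 < \<delta>"
  shows "Lp_norm p (\<lambda>x. g x - avg_op \<delta> r g x) \<le> 4 ^ r * real CARD('d) ^ s * (\<delta> ^ s * Sobolev_seminorm p s g)"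
proof -
  have gL: "g \<in> Lp_space p" by (rule Sobolev_Lp[OF g])
  obtain g' where g': "g' \<in> borel_measurable borel" "AE x in lebesgue. g x = g' x"
    using borel_version[OF Lp_space_measurable[OF gL]] by blast
  have g'L: "g' \<in> Lp_space p" by (rule Lp_cong_AE(1)[OF gL g'(2)])
  note [measurable] = g'(1)
  define \<rho> where "\<rho> = \<delta> / real r"
  have \<rho>: "0 < \<rho>" "\<rho> \<le> \<delta>" using \<delta> r by (auto simp: \<rho>_def field_simps)
  let ?U = "uniform_measure lborel (ball (0::real^'d) 1)"
  interpret U: prob_space ?U by (rule prob_unit_ball)
  define c where "c = real ((2 * r) choose r)"
  have c: "1 \<le> c" by (simp add: c_def Suc_le_eq)
  define H where "H x y = fin_diff (2 * r) (\<rho> *\<^sub>R y) g' (x - real r *\<^sub>R (\<rho> *\<^sub>R y))" for x y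
  have Y: "(\<lambda>y. k *\<^sub>R y) \<in> borel_measurable ?U" for k
    by (rule scaleR_measurable_uniform)
  have bl: "(LINT y|?U. g' (x + k *\<^sub>R y)) = ball_avg \<bar>k\<bar> g' x" if "k \<noteq> 0" for k x
    using ball_avg_eq_avg[OF g'(1) that, of x] unfolding avg_def ball_law_def
    by (subst (asm) integral_distr[OF scaleR_measurable_uniform]) auto
  have ai: "AE x in lebesgue. integrable ?U (\<lambda>y. g' (x + k *\<^sub>R y))" for k
    by (rule AE_integrable_translates[OF p g'(1) g'L prob_unit_ball Y])
  have "AE x in lebesgue. \<forall>j\<in>{1..r}. integrable ?U (\<lambda>y. g' (x + (real j * \<rho>) *\<^sub>R y)) \<and> integrable ?U (\<lambda>y. g' (x + (- (real j * \<rho>)) *\<^sub>R y))"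
    by (intro AE_finite_allI AE_conjI ai) auto
  then have ae: "AE x in lebesgue. ((-1) ^ r / c) * (LINT y|?U. H x y) = g x - avg_op \<delta> r g x"
    using g'(2)
  proof eventually_elim
    case (elim x)
    then have i1: "integrable ?U (\<lambda>y. g' (x + (real j * \<rho>) *\<^sub>R y))" and i2: "integrable ?U (\<lambda>y. g' (x - (real j * \<rho>) *\<^sub>R y))"
      if "j \<in> {1..r}" for j using that by auto
    have "(LINT y|?U. H x y) = c * (-1) ^ r * g' x +
       (\<Sum>j=1..r. real ((2 * r) choose (r - j)) * (-1) ^ (r + j) * ((LINT y|?U. g' (x + (real j * \<rho>) *\<^sub>R y)) + (LINT y|?U. g' (x - (real j * \<rho>) *\<^sub>R y))))"
    proof -
      have iS: "integrable ?U (\<lambda>y. real ((2 * r) choose (r - j)) * (-1) ^ (r + j) * (g' (x + (real j * \<rho>) *\<^sub>R y) + g' (x - (real j * \<rho>) *\<^sub>R y)))"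
        if "j \<in> {1..r}" for j
        by (intro Bochner_Integration.integrable_mult_right Bochner_Integration.integrable_add i1 i2 that)
      have "(LINT y|?U. (\<Sum>j=1..r. real ((2 * r) choose (r - j)) * (-1) ^ (r + j) * (g' (x + (real j * \<rho>) *\<^sub>R y) + g' (x - (real j * \<rho>) *\<^sub>R y))))
        = (\<Sum>j=1..r. real ((2 * r) choose (r - j)) * (-1) ^ (r + j) * ((LINT y|?U. g' (x + (real j * \<rho>) *\<^sub>R y)) + (LINT y|?U. g' (x - (real j * \<rho>) *\<^sub>R y))))"
        by (subst Bochner_Integration.integral_sum[OF iS]) (auto intro!: sum.cong simp: i1 i2)
      moreover have "integrable ?U (\<lambda>y. \<Sum>j=1..r. real ((2 * r) choose (r - j)) * (-1) ^ (r + j) * (g' (x + (real j * \<rho>) *\<^sub>R y) + g' (x - (real j * \<rho>) *\<^sub>R y)))"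
        using iS by (rule Bochner_Integration.integrable_sum)
      ultimately show ?thesis
        unfolding H_def fin_diff_centred c_def[symmetric] unfolding scaleR_scaleR
        by (simp add: U.prob_space[simplified])
    qed
    also have "(\<Sum>j=1..r. real ((2 * r) choose (r - j)) * (-1) ^ (r + j) * ((LINT y|?U. g' (x + (real j * \<rho>) *\<^sub>R y)) + (LINT y|?U. g' (x - (real j * \<rho>) *\<^sub>R y))))
       = (\<Sum>j=1..r. real ((2 * r) choose (r - j)) * (-1) ^ (r + j) * (2 * ball_avg (\<delta> * real j / real r) g' x))"
    proof (rule sum.cong)
      fix j assume j: "j \<in> {1..r}"
      then have "real j * \<rho> \<noteq> 0" using \<rho> by simp
      moreover have "\<bar>real j * \<rho>\<bar> = \<delta> * real j / real r" using \<delta> by (simp add: \<rho>_def)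
      ultimately have "(LINT y|?U. g' (x + (real j * \<rho>) *\<^sub>R y)) = ball_avg (\<delta> * real j / real r) g' x"
          "(LINT y|?U. g' (x - (real j * \<rho>) *\<^sub>R y)) = ball_avg (\<delta> * real j / real r) g' x"
        using bl[of "real j * \<rho>" x] bl[of "- (real j * \<rho>)" x] by auto
      then show "real ((2 * r) choose (r - j)) * (-1) ^ (r + j) * ((LINT y|?U. g' (x + (real j * \<rho>) *\<^sub>R y)) + (LINT y|?U. g' (x - (real j * \<rho>) *\<^sub>R y)))
        = real ((2 * r) choose (r - j)) * (-1) ^ (r + j) * (2 * ball_avg (\<delta> * real j / real r) g' x)"
        by simp
    qed simp
    finally have "((-1) ^ r / c) * (LINT y|?U. H x y) = g' x + ((-1) ^ r / c) *
       (\<Sum>j=1..r. real ((2 * r) choose (r - j)) * (-1) ^ (r + j) * (2 * ball_avg (\<delta> * real j / real r) g' x))"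
      using c by (simp add: distrib_left flip: power_mult_distrib)
    also have "((-1) ^ r / c) * (\<Sum>j=1..r. real ((2 * r) choose (r - j)) * (-1) ^ (r + j) * (2 * ball_avg (\<delta> * real j / real r) g' x)) = - avg_op \<delta> r g' x"
      unfolding avg_op_def c_def[symmetric] sum_distrib_left
      unfolding sum_negf[symmetric]
    proof (rule sum.cong)
      fix j
      have "(-1 :: real) ^ r * (-1) ^ (r + j) = (-1) ^ j"
        by (simp add: power_add mult.assoc[symmetric] flip: power_mult_distrib)
      then show "(-1) ^ r / c * (real ((2 * r) choose (r - j)) * (-1) ^ (r + j) * (2 * ball_avg (\<delta> * real j / real r) g' x))
          = - (- (2 / c) * ((-1) ^ j * real ((2 * r) choose (r - j)) * ball_avg (\<delta> * real j / real r) g' x))"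
        by (simp add: field_simps)
    qed simp
    finally show ?case
      using elim(2) avg_op_cong_AE[OF Lp_space_measurable[OF gL] g'(2), of \<delta> r] by simp
  qed
  define K where "K = 2 ^ (2 * r) * (real CARD('d) ^ s * (\<delta> ^ s * Sobolev_seminorm p s g))"
  have K0: "0 \<le> K" unfolding K_def using \<delta> by simp
  have "(\<lambda>(x, y). H x y) \<in> borel_measurable (borel \<Otimes>\<^sub>M borel)"
    unfolding H_def fin_diff_def by measurable
  then have meas: "case_prod H \<in> borel_measurable (lborel \<Otimes>\<^sub>M ?U)"
    using borel_measurable_pair_cong[OF sets_lborel, of ?U] by simp
  have bd: "AE y in ?U. (\<lambda>x. H x y) \<in> Lp_space p \<and> Lp_norm p (\<lambda>x. H x y) \<le> K"
    using AE_unit_ball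
  proof eventually_elim
    case (elim y)
    let ?u = "\<rho> *\<^sub>R y"
    have fL: "fin_diff n ?u g' \<in> Lp_space p" "fin_diff n ?u g \<in> Lp_space p" for n
      unfolding fin_diff_eq_mdiff using mdiff_Lp[OF p g'L] mdiff_Lp[OF p gL] by blast+
    have "norm ?u \<le> \<delta>" using elim \<rho> mult_mono[of \<rho> \<delta> "norm y" 1] by simp
    then have "norm ?u ^ s * Sobolev_seminorm p s g \<le> \<delta> ^ s * Sobolev_seminorm p s g"
      by (intro mult_right_mono power_mono) auto
    then have b: "Lp_norm p (fin_diff s ?u g) \<le> real CARD('d) ^ s * (\<delta> ^ s * Sobolev_seminorm p s g)"
      by (intro order_trans[OF fin_diff_Sobolev_bound[OF p g]] mult_left_mono) auto
    \<comment> \<open>Here \<open>s \<le> 2 * r\<close> enters: \<open>s\<close> of the differences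
      are estimated by derivatives, each of the others costs a factor 2.\<close>
    have rep: "replicate (2 * r) ?u = replicate s ?u @ replicate (2 * r - s) ?u"
      using s by (simp add: replicate_add[symmetric])
    have "Lp_norm p (fin_diff (2 * r) ?u g') = Lp_norm p (fin_diff (2 * r) ?u g)"
      unfolding fin_diff_eq_mdiff
      by (rule Lp_cong_AE(2)[OF _ mdiff_cong_AE[OF g'(2)]]) (use fL in \<open>simp add: fin_diff_eq_mdiff\<close>)
    also have "\<dots> = Lp_norm p (mdiff (replicate (2 * r - s) ?u) (fin_diff s ?u g))"
      unfolding fin_diff_eq_mdiff rep mdiff_append ..
    also have "\<dots> \<le> 2 ^ (2 * r - s) * Lp_norm p (fin_diff s ?u g)"
      using mdiff_Lp[OF p fL(2), of "replicate (2 * r - s) ?u" s] by simp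
    also have "\<dots> \<le> K"
      unfolding K_def using b \<delta> by (intro mult_mono power_increasing) auto
    finally have "Lp_norm p (fin_diff (2 * r) ?u g') \<le> K" .
    then show ?case
      using Lp_translate[OF fL(1), of "2 * r" "- (real r *\<^sub>R ?u)"] p by (simp add: H_def)
  qed
  note av = Lp_average[OF prob_unit_ball p meas K0 bd]
  have "Lp_norm p (\<lambda>x. g x - avg_op \<delta> r g x) = Lp_norm p (\<lambda>x. ((-1) ^ r / c) * (LINT y|?U. H x y))"
    by (rule Lp_cong_AE(2)[OF Lp_cmult(1)[OF av(1)] ae]) (use p in simp)
  also have "\<dots> = (1 / c) * Lp_norm p (\<lambda>x. LINT y|?U. H x y)"
    using Lp_cmult(2)[OF av(1), of "(-1) ^ r / c"] p c by (simp add: power_abs)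
  also have "\<dots> \<le> 1 * K"
    using av(2) c by (intro mult_mono) auto
  finally show ?thesis
    by (simp add: K_def power_mult mult.assoc)
qed

section \<open>Sampling operators\<close>

lemma lp_norm_nonneg [simp]: "0 \<le> lp_norm p \<sigma> X f"
  by (simp add: lp_norm_def)

lemma lp_space_diff:
  assumes p: "1 \<le> p" and f: "f \<in> lp_space p X" and g: "g \<in> lp_space p X"
  shows "(\<lambda>x. f x - g x) \<in> lp_space p X"
proof -
  have le: "\<bar>a - b\<bar> powr p \<le> 2 powr p * (\<bar>a\<bar> powr p + \<bar>b\<bar> powr p)" for a b :: real
  proof -
    have "\<bar>a - b\<bar> powr p \<le> (2 * max \<bar>a\<bar> \<bar>b\<bar>) powr p"
      using p by (intro powr_mono2) auto
    also have "\<dots> = 2 powr p * max \<bar>a\<bar> \<bar>b\<bar> powr p"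
      by (simp add: powr_mult)
    also have "\<dots> \<le> 2 powr p * (\<bar>a\<bar> powr p + \<bar>b\<bar> powr p)"
      by (intro mult_left_mono) (auto simp: max_def)
    finally show ?thesis .
  qed
  have "(\<lambda>\<xi>. 2 powr p * (\<bar>f \<xi>\<bar> powr p + \<bar>g \<xi>\<bar> powr p)) summable_on X"
    using f g by (intro summable_on_cmult_right summable_on_add) (auto simp: lp_space_def)
  then show ?thesis
    unfolding lp_space_def using le
    by (auto intro: summable_on_comparison_test)
qed

text \<open>Infinite sums are additive only where both families are summable, so linearity of the
  sampling operator is available almost everywhere, which is enough for norms.\<close>

lemma sampling_op_diff_AE:
  fixes f g :: "real^'d::finite \<Rightarrow> real"
  assumes "sampling_converges p X \<psi>" "f \<in> Lp_space p \<inter> lp_space p X" "g \<in> Lp_space p \<inter> lp_space p X"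
  shows "AE x in lebesgue. sampling_op X \<psi> (\<lambda>x. f x - g x) x = sampling_op X \<psi> f x - sampling_op X \<psi> g x"
proof -
  have "AE x in lebesgue. (\<lambda>\<xi>. f \<xi> * \<psi> \<xi> x) summable_on X" "AE x in lebesgue. (\<lambda>\<xi>. g \<xi> * \<psi> \<xi> x) summable_on X"
    using assms by (auto simp: sampling_converges_def)
  then show ?thesis
  proof eventually_elim
    case (elim x)
    have "(\<Sum>\<^sub>\<infinity>\<xi>\<in>X. f \<xi> * \<psi> \<xi> x + - (g \<xi> * \<psi> \<xi> x))
        = (\<Sum>\<^sub>\<infinity>\<xi>\<in>X. f \<xi> * \<psi> \<xi> x) + (\<Sum>\<^sub>\<infinity>\<xi>\<in>X. - (g \<xi> * \<psi> \<xi> x))"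
      using elim by (intro infsum_add) (simp_all add: summable_on_uminus)
    then show ?case
      by (simp add: sampling_op_def left_diff_distrib infsum_uminus)
  qed
qed

text \<open>One fixed scale. The constants defined inside do not involve \<open>\<sigma>\<close>,
  \<open>X\<close> or \<open>\<psi>\<close>, which gives estimates uniform over all scales.\<close>

locale sampling_scale =
  fixes p \<gamma> \<kappa>1 \<kappa>2 \<kappa>3 \<sigma> :: real and r s :: nat
    and X :: "(real^'d::finite) set" and \<psi> :: "real^'d \<Rightarrow> real^'d \<Rightarrow> real"
  assumes p: "1 \<le> p" and r: "1 \<le> r" and s: "1 \<le> s" and sr: "s \<le> 2 * r"
    and \<gamma>: "0 < \<gamma>" "\<gamma> \<le> 1" and \<kappa>1: "0 < \<kappa>1" and \<kappa>2: "0 < \<kappa>2" and \<kappa>3: "0 < \<kappa>3"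
    and \<sigma>: "0 < \<sigma>"
    and sep: "separated \<gamma> \<sigma> X" and conv: "sampling_converges p X \<psi>"
    and A1: "cond_A1 \<kappa>1 p \<sigma> X \<psi>" and A2: "cond_A2 \<kappa>2 p \<sigma> X \<psi>"
    and SE: "Sobolev_estimate \<kappa>3 p s \<sigma> X \<psi>"
begin

abbreviation "G \<equiv> sampling_op X \<psi>"
abbreviation "\<A> \<equiv> avg_op (\<gamma> / \<sigma>) r"
abbreviation "N \<equiv> Lp_norm p"
abbreviation "K f g \<equiv> N (\<lambda>x. f x - g x) + (1 / \<sigma>) ^ s * Sobolev_seminorm p s g"

text \<open>\<open>a\<close> bounds \<open>\<A>\<close> in the Lebesgue norm and in the Sobolev
  seminorm, \<open>b\<close> bounds its samples by the Lebesgue norm, and \<open>e\<close> is the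
  constant for its error on Sobolev functions.\<close>

definition a :: real where "a = avg_bound r"
definition b :: real where
  "b = avg_bound r * ((real r / \<gamma>) ^ CARD('d) / measure lborel (ball (0::real^'d) 1)) powr (1 / p)"
definition e :: real where "e = 4 ^ r * real CARD('d) ^ s"

lemma ab_nonneg: "0 \<le> a" "0 \<le> b" "0 \<le> e"
  by (simp_all add: a_def b_def e_def)

lemma \<delta>: "0 < \<gamma> / \<sigma>"
  using \<gamma> \<sigma> by simp

lemma sigma_powr: "\<sigma> powr (- real s) = (1 / \<sigma>) ^ s"
  using \<sigma> by (simp add: powr_minus powr_realpow power_one_over inverse_eq_divide)

lemma K_nonneg: "0 \<le> (1 / \<sigma>) ^ s * Sobolev_seminorm p s g"
  using \<sigma> by simp

lemma avg_op_diff: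
  fixes f g :: "real^'d \<Rightarrow> real"
  assumes f: "f \<in> Lp_space p" and g: "g \<in> Lp_space p"
  shows "\<A> (\<lambda>x. f x - g x) = (\<lambda>x. \<A> f x - \<A> g x)"
proof
  fix x :: "real^'d"
  have i: "set_integrable lebesgue (ball x t) h" if "h \<in> Lp_space p" for h t
  proof -
    have "set_integrable lebesgue (cball x t) h"
      using Lp_locally_integrable[OF that p] by (auto simp: locally_integrable_def)
    then show ?thesis by (rule set_integrable_subset) auto
  qed
  have "ball_avg t (\<lambda>x. f x - g x) x = ball_avg t f x - ball_avg t g x" for t
    unfolding ball_avg_def by (subst set_integral_diff(2)[OF i[OF f] i[OF g]]) (simp add: algebra_simps diff_divide_distrib)
  then show "\<A> (\<lambda>x. f x - g x) x = \<A> f x - \<A> g x"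
    by (simp add: avg_op_eq_sum_ball_avg right_diff_distrib sum_subtractf)
qed

lemma avg_mem: "f \<in> Lp_space p \<Longrightarrow> \<A> f \<in> Lp_space p \<inter> lp_space p X"
  using avg_op_Lp(1)[OF p _ \<delta>] avg_op_lp(1)[OF p r _ \<gamma>(1) \<sigma> sep] by blast

lemma diff_avg_bound:
  fixes f g :: "real^'d \<Rightarrow> real"
  assumes f: "f \<in> Lp_space p" and g: "g \<in> Sobolev p s"
  shows "(\<lambda>x. f x - \<A> f x) \<in> Lp_space p" "N (\<lambda>x. f x - \<A> f x) \<le> (1 + a + e) * K f g"
proof -
  note gL = Sobolev_Lp[OF g]
  note fA = avg_op_Lp(1)[OF p f \<delta>, of r] and gA = avg_op_Lp(1)[OF p gL \<delta>, of r]
  note d = Lp_diff(1)[OF p f gL]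
  show "(\<lambda>x. f x - \<A> f x) \<in> Lp_space p"
    by (rule Lp_diff(1)[OF p f fA])
  have eq: "(\<lambda>x. f x - \<A> f x) = (\<lambda>x. ((f x - g x) - \<A> (\<lambda>x. f x - g x) x) + (g x - \<A> g x))"
    by (simp add: avg_op_diff[OF f gL])
  note dA = avg_op_Lp[OF p d \<delta>, of r]
  have 1: "N (\<lambda>x. (f x - g x) - \<A> (\<lambda>x. f x - g x) x) \<le> N (\<lambda>x. f x - g x) + a * N (\<lambda>x. f x - g x)"
    using Lp_diff(2)[OF p d dA(1)] dA(2) by (simp add: a_def)
  \<comment> \<open>By \<open>\<gamma> \<le> 1\<close> the error at the scale of averaging is
    absorbed by the weight of the seminorm in \<open>K\<close>.\<close>
  have "(\<gamma> / \<sigma>) ^ s \<le> (1 / \<sigma>) ^ s"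
    using \<gamma> \<sigma> by (intro power_mono divide_right_mono) auto
  then have "(\<gamma> / \<sigma>) ^ s * Sobolev_seminorm p s g \<le> (1 / \<sigma>) ^ s * Sobolev_seminorm p s g"
    by (rule mult_right_mono) simp
  then have 2: "N (\<lambda>x. g x - \<A> g x) \<le> e * ((1 / \<sigma>) ^ s * Sobolev_seminorm p s g)"
    using ab_nonneg(3) by (intro order_trans[OF avg_op_approximation[OF p r sr g \<delta>]]) (simp add: e_def mult_left_mono)
  have "N (\<lambda>x. f x - \<A> f x) \<le> (N (\<lambda>x. f x - g x) + a * N (\<lambda>x. f x - g x)) + e * ((1 / \<sigma>) ^ s * Sobolev_seminorm p s g)"
    unfolding eq using Lp_add(2)[OF p Lp_diff(1)[OF p d dA(1)] Lp_diff(1)[OF p gL gA]] 1 2 by linarith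
  also have "\<dots> \<le> (1 + a + e) * K f g"
    using mult_nonneg_nonneg[OF ab_nonneg(3) Lp_norm_nonneg[of p "\<lambda>x. f x - g x"]] K_nonneg[of g]
      mult_nonneg_nonneg[OF ab_nonneg(1) K_nonneg[of g]]
    by (simp add: algebra_simps)
  finally show "N (\<lambda>x. f x - \<A> f x) \<le> (1 + a + e) * K f g" .
qed

lemma avg_sampling_bound:
  fixes f g :: "real^'d \<Rightarrow> real"
  assumes f: "f \<in> Lp_space p" and g: "g \<in> Sobolev p s"
  shows "(\<lambda>x. \<A> f x - G (\<A> f) x) \<in> Lp_space p"
    "N (\<lambda>x. \<A> f x - G (\<A> f) x) \<le> (a + \<kappa>1 * b + \<kappa>3 * a) * K f g"
proof -
  note gL = Sobolev_Lp[OF g]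
  note d = Lp_diff(1)[OF p f gL]
  note fA = avg_mem[OF f] and gA = avg_mem[OF gL] and dA = avg_mem[OF d]
  let ?D = "\<A> (\<lambda>x. f x - g x)"
  have D: "?D = (\<lambda>x. \<A> f x - \<A> g x)" by (rule avg_op_diff[OF f gL])
  have GL: "G h \<in> Lp_space p" if "h \<in> Lp_space p \<inter> lp_space p X" for h
    using A1 that by (auto simp: cond_A1_def)
  show mem: "(\<lambda>x. \<A> f x - G (\<A> f) x) \<in> Lp_space p"
    using fA GL[OF fA] by (intro Lp_diff(1)[OF p]) auto
  have gm: "(\<lambda>x. \<A> g x - G (\<A> g) x) \<in> Lp_space p"
    and "N (\<lambda>x. \<A> g x - G (\<A> g) x) \<le> \<kappa>3 * (1 / \<sigma>) ^ s * Sobolev_seminorm p s (\<A> g)"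
    using SE avg_op_Sobolev(1)[OF p g \<delta>, of r] avg_op_continuous[OF p gL \<delta>, of r]
    by (auto simp: Sobolev_estimate_def sigma_powr)
  note this(2)
  also have "\<kappa>3 * (1 / \<sigma>) ^ s * Sobolev_seminorm p s (\<A> g) \<le> \<kappa>3 * (1 / \<sigma>) ^ s * (a * Sobolev_seminorm p s g)"
    using avg_op_Sobolev(2)[OF p g \<delta>, of r] \<kappa>3 \<sigma> by (intro mult_left_mono) (auto simp: a_def)
  finally have 1: "N (\<lambda>x. \<A> g x - G (\<A> g) x) \<le> \<kappa>3 * a * ((1 / \<sigma>) ^ s * Sobolev_seminorm p s g)"
    by (simp add: mult_ac)
  have 2: "N ?D \<le> a * N (\<lambda>x. f x - g x)"
    using avg_op_Lp(2)[OF p d \<delta>, of r] by (simp add: a_def)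
  have "N (G ?D) \<le> \<kappa>1 * lp_norm p \<sigma> X ?D"
    using A1 dA by (auto simp: cond_A1_def)
  also have "\<dots> \<le> \<kappa>1 * (b * N (\<lambda>x. f x - g x))"
    using avg_op_lp(2)[OF p r d \<gamma>(1) \<sigma> sep] \<kappa>1 by (intro mult_left_mono) (auto simp: b_def)
  finally have 3: "N (G ?D) \<le> \<kappa>1 * b * N (\<lambda>x. f x - g x)" by simp
  have DL: "?D \<in> Lp_space p" using dA by simp
  have E: "(\<lambda>x. ?D x - G ?D x) \<in> Lp_space p" "N (\<lambda>x. ?D x - G ?D x) \<le> N ?D + N (G ?D)"
    by (rule Lp_diff(1)[OF p DL GL[OF dA]], rule Lp_diff(2)[OF p DL GL[OF dA]])
  note S = Lp_add[OF p E(1) gm]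
  have ae: "AE x in lebesgue. (?D x - G ?D x) + (\<A> g x - G (\<A> g) x) = \<A> f x - G (\<A> f) x"
    using sampling_op_diff_AE[OF conv fA gA] unfolding D by eventually_elim simp
  have "N (\<lambda>x. \<A> f x - G (\<A> f) x) = N (\<lambda>x. (?D x - G ?D x) + (\<A> g x - G (\<A> g) x))"
    by (rule Lp_cong_AE(2)[OF S(1) ae])
  also have "\<dots> \<le> (a * N (\<lambda>x. f x - g x) + \<kappa>1 * b * N (\<lambda>x. f x - g x)) + \<kappa>3 * a * ((1 / \<sigma>) ^ s * Sobolev_seminorm p s g)"
    using S(2) E(2) 1 2 3 by linarith
  also have "\<dots> \<le> (a + \<kappa>1 * b + \<kappa>3 * a) * K f g"
  proof -
    have "0 \<le> \<kappa>3 * a * N (\<lambda>x. f x - g x)" "0 \<le> (a + \<kappa>1 * b) * ((1 / \<sigma>) ^ s * Sobolev_seminorm p s g)"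
      using ab_nonneg \<kappa>1 \<kappa>3 K_nonneg[of g] by (auto intro!: mult_nonneg_nonneg add_nonneg_nonneg)
    then show ?thesis by (simp add: algebra_simps)
  qed
  finally show "N (\<lambda>x. \<A> f x - G (\<A> f) x) \<le> (a + \<kappa>1 * b + \<kappa>3 * a) * K f g" .
qed

definition c where "c = (1 + a + e) + (a + \<kappa>1 * b + \<kappa>3 * a)"

lemma c_nonneg: "0 \<le> c"
  using ab_nonneg \<kappa>1 \<kappa>3 by (simp add: c_def)

lemma sampling_diff:
  fixes f g :: "real^'d \<Rightarrow> real"
  assumes f: "f \<in> Lp_space p \<inter> lp_space p X" and g: "g \<in> Sobolev p s"
  shows "(\<lambda>x. f x - G (\<A> f) x) \<in> Lp_space p" "N (\<lambda>x. f x - G (\<A> f) x) \<le> c * K f g"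
proof -
  have fL: "f \<in> Lp_space p" using f by simp
  note A = diff_avg_bound[OF fL g] and B = avg_sampling_bound[OF fL g]
  have "(\<lambda>x. f x - G (\<A> f) x) = (\<lambda>x. (f x - \<A> f x) + (\<A> f x - G (\<A> f) x))" by simp
  then show "(\<lambda>x. f x - G (\<A> f) x) \<in> Lp_space p" "N (\<lambda>x. f x - G (\<A> f) x) \<le> c * K f g"
    using Lp_add[OF p A(1) B(1)] A(2) B(2) by (simp_all add: c_def distrib_right)
qed

lemma sampling_avg_diff:
  fixes f :: "real^'d \<Rightarrow> real"
  assumes f: "f \<in> Lp_space p \<inter> lp_space p X"
  shows "(\<lambda>x. \<A> f x - f x) \<in> Lp_space p \<inter> lp_space p X"
    "AE x in lebesgue. G (\<lambda>x. \<A> f x - f x) x = G (\<A> f) x - G f x"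
proof -
  note fA = avg_mem[of f]
  show "(\<lambda>x. \<A> f x - f x) \<in> Lp_space p \<inter> lp_space p X"
    using f fA Lp_diff(1)[OF p, of "\<A> f" f] lp_space_diff[OF p, of "\<A> f" X f] by auto
  show "AE x in lebesgue. G (\<lambda>x. \<A> f x - f x) x = G (\<A> f) x - G f x"
    using sampling_op_diff_AE[OF conv fA f] f by simp
qed

text \<open>\<open>(A\<^sub>2)\<close> is applied to \<open>\<A> f - f\<close>, whose sampling is
  almost everywhere \<open>(f - G f) - (f - G (\<A> f))\<close>. The first part is a summand of
  \<open>K f (G f)\<close>, the second is estimated by \<open>c\<close>.\<close>

lemma sampled_difference_bound:
  fixes f :: "real^'d \<Rightarrow> real"
  assumes f: "f \<in> Lp_space p \<inter> lp_space p X" and Gf: "G f \<in> Sobolev p s"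
  shows "\<kappa>2 * lp_norm p \<sigma> X (\<lambda>x. \<A> f x - f x) \<le> (1 + c) * K f (G f)"
proof -
  have fL: "f \<in> Lp_space p" using f by simp
  note S = sampling_diff[OF f Gf] and D = sampling_avg_diff[OF f]
  have dL: "(\<lambda>x. f x - G f x) \<in> Lp_space p"
    by (rule Lp_diff(1)[OF p fL Sobolev_Lp[OF Gf]])
  have ae: "AE x in lebesgue. (f x - G f x) - (f x - G (\<A> f) x) = G (\<lambda>x. \<A> f x - f x) x"
    using D(2) by eventually_elim simp
  have "\<kappa>2 * lp_norm p \<sigma> X (\<lambda>x. \<A> f x - f x) \<le> N (G (\<lambda>x. \<A> f x - f x))"
    using A2 D(1) by (auto simp: cond_A2_def)
  also have "\<dots> = N (\<lambda>x. (f x - G f x) - (f x - G (\<A> f) x))"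
    by (rule Lp_cong_AE(2)[OF Lp_diff(1)[OF p dL S(1)] ae])
  also have "\<dots> \<le> N (\<lambda>x. f x - G f x) + c * K f (G f)"
    using Lp_diff(2)[OF p dL S(1)] S(2) by linarith
  also have "\<dots> \<le> (1 + c) * K f (G f)"
    using K_nonneg[of "G f"] by (simp add: distrib_right)
  finally show ?thesis .
qed

text \<open>The error \<open>f - G f\<close> is almost everywhere \<open>f - G (\<A> f)\<close> plus
  the sampling of \<open>\<A> f - f\<close>, to which \<open>(A\<^sub>1)\<close> applies.\<close>

lemma approximation_bound:
  fixes f g :: "real^'d \<Rightarrow> real"
  assumes f: "f \<in> Lp_space p \<inter> lp_space p X" and g: "g \<in> Sobolev p s"
  shows "N (\<lambda>x. f x - G f x) \<le> c * K f g + \<kappa>1 * lp_norm p \<sigma> X (\<lambda>x. \<A> f x - f x)"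
proof -
  note S = sampling_diff[OF f g] and D = sampling_avg_diff[OF f]
  have GD: "G (\<lambda>x. \<A> f x - f x) \<in> Lp_space p"
    "N (G (\<lambda>x. \<A> f x - f x)) \<le> \<kappa>1 * lp_norm p \<sigma> X (\<lambda>x. \<A> f x - f x)"
    using A1 D(1) by (auto simp: cond_A1_def)
  have ae: "AE x in lebesgue. (f x - G (\<A> f) x) + G (\<lambda>x. \<A> f x - f x) x = f x - G f x"
    using D(2) by eventually_elim simp
  have "N (\<lambda>x. f x - G f x) = N (\<lambda>x. (f x - G (\<A> f) x) + G (\<lambda>x. \<A> f x - f x) x)"
    by (rule Lp_cong_AE(2)[OF Lp_add(1)[OF p S(1) GD(1)] ae])
  also have "\<dots> \<le> c * K f g + \<kappa>1 * lp_norm p \<sigma> X (\<lambda>x. \<A> f x - f x)"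
    using Lp_add(2)[OF p S(1) GD(1)] S(2) GD(2) by linarith
  finally show ?thesis .
qed

lemma modulus_bound:
  fixes f g :: "real^'d \<Rightarrow> real"
  assumes f: "f \<in> Lp_space p" and g: "g \<in> Sobolev p s"
  shows "modulus p s f (1 / \<sigma>) \<le> (2 ^ s + real CARD('d) ^ s) * K f g"
proof -
  have "modulus p s f (1 / \<sigma>) \<le> 2 ^ s * N (\<lambda>x. f x - g x) + modulus p s g (1 / \<sigma>)"
    by (rule modulus_triangle[OF p f Sobolev_Lp[OF g]]) (use \<sigma> in simp)
  also have "modulus p s g (1 / \<sigma>) \<le> real CARD('d) ^ s * ((1 / \<sigma>) ^ s * Sobolev_seminorm p s g)"
    by (rule modulus_Sobolev[OF p g]) (use \<sigma> in simp)
  also have "2 ^ s * N (\<lambda>x. f x - g x) + real CARD('d) ^ s * ((1 / \<sigma>) ^ s * Sobolev_seminorm p s g)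
      \<le> (2 ^ s + real CARD('d) ^ s) * K f g"
  proof -
    have "0 \<le> real CARD('d) ^ s * N (\<lambda>x. f x - g x)" "0 \<le> 2 ^ s * ((1 / \<sigma>) ^ s * Sobolev_seminorm p s g)"
      using K_nonneg[of g] by (auto intro!: mult_nonneg_nonneg)
    then show ?thesis by (simp add: algebra_simps)
  qed
  finally show ?thesis by simp
qed

end

theorem theorem4p8:
  fixes p \<gamma> \<kappa>1 \<kappa>2 \<kappa>3 B :: real
    and r s :: nat
    and X :: "real \<Rightarrow> (real^'d::finite) set"
    and \<psi> :: "real \<Rightarrow> real^'d \<Rightarrow> real^'d \<Rightarrow> real"
    and \<Phi> :: "real \<Rightarrow> (real^'d \<Rightarrow> real) set"
  assumes "1 \<le> p" and "1 \<le> r" and "1 \<le> s" and "s \<le> 2 * r"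
    and "0 < \<gamma>" and "\<gamma> \<le> 1"
    and "0 < \<kappa>1" and "0 < \<kappa>2" and "0 < \<kappa>3"
    and "\<And>\<sigma>. 0 < \<sigma> \<Longrightarrow> separated \<gamma> \<sigma> (X \<sigma>)"
    and "\<And>\<sigma>. 0 < \<sigma> \<Longrightarrow> sampling_converges p (X \<sigma>) (\<psi> \<sigma>)"
    and "\<And>\<sigma>. 0 < \<sigma> \<Longrightarrow> cond_A1 \<kappa>1 p \<sigma> (X \<sigma>) (\<psi> \<sigma>)"
    and "\<And>\<sigma>. 0 < \<sigma> \<Longrightarrow> cond_A2 \<kappa>2 p \<sigma> (X \<sigma>) (\<psi> \<sigma>)"
    and "\<And>\<sigma>. 0 < \<sigma> \<Longrightarrow> Sobolev_estimate \<kappa>3 p s \<sigma> (X \<sigma>) (\<psi> \<sigma>)"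
    and "approx_family p s \<Phi>"
    and "\<And>\<sigma>. 0 < \<sigma> \<Longrightarrow> deriv_bound B p s \<sigma> (\<Phi> \<sigma>)"
  shows "\<exists>C1>0. \<exists>C2>0. \<forall>\<sigma>>0. \<forall>f \<in> Lp_space p \<inter> lp_space p (X \<sigma>).
    sampling_op (X \<sigma>) (\<psi> \<sigma>) f \<in> \<Phi> \<sigma> \<inter> Sobolev p s \<longrightarrow>
      (let G = sampling_op (X \<sigma>) (\<psi> \<sigma>);
           smooth_part = lp_norm p \<sigma> (X \<sigma>) (\<lambda>x. avg_op (\<gamma> / \<sigma>) r f x - f x)
                           + modulus p s f (1 / \<sigma>);
           approx_part = Lp_norm p (\<lambda>x. f x - G f x)
                           + \<sigma> powr (- real s) * Sobolev_seminorm p s (G f)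
       in C1 * approx_part \<le> smooth_part \<and> smooth_part \<le> C2 * approx_part)"
proof -
  have scale: "sampling_scale p \<gamma> \<kappa>1 \<kappa>2 \<kappa>3 \<sigma> r s (X \<sigma>) (\<psi> \<sigma>)" if "0 < \<sigma>" for \<sigma>
    using assms that by unfold_locales auto
  obtain CS where CS: "0 < CS" "\<And>(f :: real^'d \<Rightarrow> real) \<delta>. f \<in> Lp_space p \<Longrightarrow> 0 < \<delta> \<Longrightarrow>
    \<exists>g\<in>Sobolev p s. Lp_norm p (\<lambda>x. f x - g x) \<le> modulus p s f \<delta> \<and>
      \<delta> ^ s * Sobolev_seminorm p s g \<le> CS * modulus p s f \<delta>"
    using Steklov_approximation[OF assms(1,3)] by blast
  \<comment> \<open>\<open>seminorm_le_modulus\<close> asks for a positive bound, whereas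
    \<open>B\<close> may be any real number.\<close>
  define b' where "b' = max B 0 + 1"
  define M where "M = real (card {\<beta> :: 'd \<Rightarrow> nat. mi_abs \<beta> = s}) *
    (2 * 2 ^ s * (2 * real s * real CARD('d) * (b' + 1)) ^ s)"
  have M0: "0 \<le> M" by (simp add: M_def b'_def)
  \<comment> \<open>Outside the locale \<open>c\<close> takes no argument for the scale, so one
    \<open>Q\<close> serves all \<open>\<sigma>\<close>; the instance at 1 is used only for its
    sign.\<close>
  define Q where "Q = sampling_scale.c TYPE('d) p \<gamma> \<kappa>1 \<kappa>3 r s"
  have Q0: "0 \<le> Q" using sampling_scale.c_nonneg[OF scale[of 1]] by (simp add: Q_def)
  \<comment> \<open>The sum of the constants of \<open>sampled_difference_bound\<close> and
    \<open>modulus_bound\<close>, both with \<open>G f\<close> as competitor.\<close>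
  define U where "U = (1 + Q) / \<kappa>2 + (2 ^ s + real CARD('d) ^ s)"
  \<comment> \<open>The norm of \<open>f - G f\<close> is at most
    \<open>Q * (1 + CS) + \<kappa>1\<close> times the sum of sampled term and modulus. The weighted
    seminorm of \<open>G f\<close> is at most \<open>M\<close> times its modulus, which in turn is
    at most \<open>2 ^ s\<close> times that norm plus the modulus of \<open>f\<close>.
    \<open>V\<close> collects both.\<close>
  define V where "V = (1 + M * 2 ^ s) * (Q * (1 + CS) + \<kappa>1) + M"
  have U0: "0 < U" unfolding U_def using Q0 assms(8) by (intro add_nonneg_pos) auto
  have V0: "0 < V" unfolding V_def using Q0 M0 CS(1) assms(7)
    by (intro add_pos_nonneg mult_pos_pos add_nonneg_pos) auto
  show ?thesis
  proof (unfold Let_def, rule exI[of _ "1 / V"], rule conjI, use V0 in simp,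
      rule exI[of _ U], rule conjI, rule U0, intro allI impI ballI conjI)
    fix \<sigma> :: real and f :: "real^'d \<Rightarrow> real"
    assume \<sigma>: "0 < \<sigma>" and f: "f \<in> Lp_space p \<inter> lp_space p (X \<sigma>)"
      and mem: "sampling_op (X \<sigma>) (\<psi> \<sigma>) f \<in> \<Phi> \<sigma> \<inter> Sobolev p s"
    interpret sampling_scale p \<gamma> \<kappa>1 \<kappa>2 \<kappa>3 \<sigma> r s "X \<sigma>" "\<psi> \<sigma>" by (rule scale[OF \<sigma>])
    have fL: "f \<in> Lp_space p" using f by simp
    have Gf: "G f \<in> Sobolev p s" using mem by simp
    define L where "L = lp_norm p \<sigma> (X \<sigma>) (\<lambda>x. \<A> f x - f x)"
    define w where "w = modulus p s f (1 / \<sigma>)"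
    have L0: "0 \<le> L" by (simp add: L_def)
    have w0: "0 \<le> w" unfolding w_def by (rule modulus_nonneg[OF p fL]) (use \<sigma> in simp)
    have KG0: "0 \<le> K f (G f)" using K_nonneg[of "G f"] by simp
    have "L \<le> ((1 + Q) / \<kappa>2) * K f (G f)"
      using sampled_difference_bound[OF f Gf] \<kappa>2 unfolding L_def[symmetric] Q_def[symmetric]
      by (simp add: pos_le_divide_eq mult.commute)
    then have "L + w \<le> U * K f (G f)"
      using modulus_bound[OF fL Gf] unfolding w_def[symmetric] U_def by (simp only: distrib_right)
    then show "lp_norm p \<sigma> (X \<sigma>) (\<lambda>x. \<A> f x - f x) + modulus p s f (1 / \<sigma>)
        \<le> U * (N (\<lambda>x. f x - G f x) + \<sigma> powr (- real s) * Sobolev_seminorm p s (G f))"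
      by (simp add: L_def w_def sigma_powr)
    obtain g where g: "g \<in> Sobolev p s" "N (\<lambda>x. f x - g x) \<le> w" "(1 / \<sigma>) ^ s * Sobolev_seminorm p s g \<le> CS * w"
      using CS(2)[OF fL, of "1 / \<sigma>"] \<sigma> unfolding w_def by auto
    have "K f g \<le> (1 + CS) * w" using g(2,3) by (simp add: distrib_right)
    then have "Q * K f g \<le> Q * ((1 + CS) * w)" by (rule mult_left_mono) (rule Q0)
    then have n: "N (\<lambda>x. f x - G f x) \<le> Q * (1 + CS) * w + \<kappa>1 * L"
      using approximation_bound[OF f g(1)] unfolding L_def[symmetric] Q_def[symmetric] by simp
    have "N (\<lambda>x. f x - G f x) \<le> (Q * (1 + CS) + \<kappa>1) * (L + w)"
    proof -
      have "0 \<le> Q * (1 + CS) * L" "0 \<le> \<kappa>1 * w"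
        using Q0 CS(1) L0 w0 \<kappa>1 by auto
      then show ?thesis using n by (simp add: algebra_simps)
    qed
    note n = this
    have db: "has_weak_deriv_in_Lp p (mi_unit i) (weak_D \<beta> (G f)) \<and>
      Lp_norm p (weak_D (mi_unit i) (weak_D \<beta> (G f))) \<le> B * \<sigma> * Lp_norm p (weak_D \<beta> (G f))"
      if "mi_abs \<beta> = s" for \<beta> i
      using assms(16)[OF \<sigma>] mem that by (auto simp: deriv_bound_def)
    have "(1 / \<sigma>) ^ s * Sobolev_seminorm p s (G f) \<le> M * modulus p s (G f) (1 / \<sigma>)"
      unfolding M_def by (rule seminorm_le_modulus[OF p s \<sigma> Gf _ _ db]) (auto simp: b'_def)
    also have "\<dots> \<le> M * (2 ^ s * N (\<lambda>x. f x - G f x) + w)"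
    proof (rule mult_left_mono[OF _ M0])
      have "N (\<lambda>x. G f x - f x) = N (\<lambda>x. f x - G f x)"
        by (simp add: Lp_norm_def abs_minus_commute)
      then show "modulus p s (G f) (1 / \<sigma>) \<le> 2 ^ s * N (\<lambda>x. f x - G f x) + w"
        using modulus_triangle[OF p Sobolev_Lp[OF Gf] fL, of "1 / \<sigma>" s] \<sigma> by (simp add: w_def)
    qed
    finally have "K f (G f) \<le> (1 + M * 2 ^ s) * N (\<lambda>x. f x - G f x) + M * w"
      by (simp add: algebra_simps)
    also have "\<dots> \<le> (1 + M * 2 ^ s) * ((Q * (1 + CS) + \<kappa>1) * (L + w)) + M * (L + w)"
      using n M0 L0 by (intro add_mono mult_left_mono) auto
    also have "\<dots> = V * (L + w)"
      unfolding V_def by (simp only: distrib_right mult.assoc)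
    finally have "K f (G f) \<le> V * (L + w)" .
    then show "1 / V * (N (\<lambda>x. f x - G f x) + \<sigma> powr (- real s) * Sobolev_seminorm p s (G f))
        \<le> lp_norm p \<sigma> (X \<sigma>) (\<lambda>x. \<A> f x - f x) + modulus p s f (1 / \<sigma>)"
      using V0 by (simp add: L_def w_def sigma_powr pos_divide_le_eq mult.commute)
  qed
qed

end
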